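(* Let $A_S$ be a large-type Artin group with $|S|\ge 3$. Then its Artin complex $X_S$ is systolic.
   Context: Artin groups: let $S$ be a finite set and for all distinct $s,t\in S$ let $m_{st}=m_{ts}\in\{2,3,\dots,\infty\}$. The Artin group is $A_S=\langle S \mid \underbrace{sts\cdots}_{m_{st}}=\underbrace{tst\cdots}_{m_{st}} \text{ whenever } m_{st}\neq\infty\rangle$. It is of large type if $m_{st}\ge 3$ for all distinct $s,t\in S$. For $S'\subseteq S$, $A_{S'}$ is the subgroup generated by $S'$. Artin complex ($|S|\ge 2$): let $K$ be a simplex of dimension $|S|-1$ whose codimension 1 faces are denoted $\Delta_s$, $s\in S$; for $S'\subsetneq S$ put $\Delta_{S'}=\bigcap_{s\in S'}\Delta_s$ (with $\Delta_\emptyset=K$), to which the local group $A_{S'}$ is attached. Then $X_S=(A_S\times K)/\sim$, where $(g,x)\sim(g',x')$ iff $x=x'$ and $g^{-1}g'$ lies in the local group of the smallest face of $K$ containing $x$. Equivalently, $X_S$ is the simplicial complex whose vertices are the cosets $gA_{S\setminus\{s\}}$ ($g\in A_S$, $s\in S$) and whose simplices are the sets $\{gA_{S\setminus\{s\}} : s\in T\}$ with $g\in A_S$ and $\emptyset\ne T\subseteq S$. Systolicity: the link $Lk_X(Y)$ of a simplex $Y$ in a simplicial complex $X$ is the subcomplex of simplices disjoint from $Y$ that together with $Y$ span a simplex of $X$. An embedded cycle $\gamma$ in the 1-skeleton of $X$ is full if every simplex of $X$ whose vertices all lie in $\gamma$ is a simplex of $\gamma$; $|\gamma|$ is its number of edges.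 The systole $\operatorname{sys}(X)\in\{3,4,\dots,\infty\}$ is the minimum of $|\gamma|$ over all embedded full cycles $\gamma$ of $X$ ($\infty$ if there are none). $X$ is locally $k$-large if $\operatorname{sys}(Lk_X(Y))\ge k$ for every simplex $Y$ of $X$. $X$ is $k$-systolic if it is connected, simply connected and locally $k$-large; it is systolic if it is $6$-systolic. *)

theory Defs
  imports "HOL-Analysis.Analysis" "HOL-Algebra.Generated_Groups" "HOL-Library.Extended_Nat"
begin

section \<open>Groups given by generators and relations\<close>

text \<open>A letter \<open>(s, True)\<close> stands for the generator \<open>s\<close>, and \<open>(s, False)\<close> for its formal inverse.\<close>

type_synonym 's word = "('s \<times> bool) list"

definition words :: "'s set \<Rightarrow> 's word set" where
  "words S = lists (S \<times> UNIV)"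

inductive pres_eq :: "'s set \<Rightarrow> ('s word \<times> 's word) set \<Rightarrow> 's word \<Rightarrow> 's word \<Rightarrow> bool"
  for S R where
  refl: "w \<in> words S \<Longrightarrow> pres_eq S R w w"
| sym: "pres_eq S R u v \<Longrightarrow> pres_eq S R v u"
| trans: "pres_eq S R u v \<Longrightarrow> pres_eq S R v w \<Longrightarrow> pres_eq S R u w"
| append: "pres_eq S R u u' \<Longrightarrow> pres_eq S R v v' \<Longrightarrow> pres_eq S R (u @ v) (u' @ v')"
| cancel: "s \<in> S \<Longrightarrow> pres_eq S R [(s, b), (s, \<not> b)] []"
| relator: "(u, v) \<in> R \<Longrightarrow> u \<in> words S \<Longrightarrow> v \<in> words S \<Longrightarrow> pres_eq S R u v"

definition pres_class :: "'s set \<Rightarrow> ('s word \<times> 's word) set \<Rightarrow> 's word \<Rightarrow> 's word set" where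
  "pres_class S R w = {v. pres_eq S R w v}"

definition presented_group ::
    "'s set \<Rightarrow> ('s word \<times> 's word) set \<Rightarrow> 's word set monoid" where
  "presented_group S R =
     \<lparr>carrier = pres_class S R ` words S,
      mult = (\<lambda>A B. \<Union>u\<in>A. \<Union>v\<in>B. pres_class S R (u @ v)),
      one = pres_class S R []\<rparr>"

lemma pres_eq_words: "pres_eq S R u v \<Longrightarrow> u \<in> words S \<and> v \<in> words S"
  by (induction rule: pres_eq.induct) (auto simp: words_def)

lemma pres_class_eq_iff:
  "u \<in> words S \<Longrightarrow> pres_class S R u = pres_class S R v \<longleftrightarrow> pres_eq S R u v"
  unfolding pres_class_def set_eq_iff mem_Collect_eq
  by (meson pres_eq.refl pres_eq.sym pres_eq.trans)

lemma words_append: "u \<in> words S \<Longrightarrow> v \<in> words S \<Longrightarrow> u @ v \<in> words S"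
  by (auto simp: words_def)

lemma presented_mult:
  assumes "u \<in> words S" "v \<in> words S"
  shows "pres_class S R u \<otimes>\<^bsub>presented_group S R\<^esub> pres_class S R v = pres_class S R (u @ v)"
proof -
  have "pres_class S R (u' @ v') = pres_class S R (u @ v)"
    if "u' \<in> pres_class S R u" "v' \<in> pres_class S R v" for u' v'
  proof -
    have "pres_eq S R (u @ v) (u' @ v')"
      using that by (auto simp: pres_class_def intro: pres_eq.append)
    then show ?thesis
      using pres_class_eq_iff words_append[OF assms] by metis
  qed
  moreover have "u \<in> pres_class S R u" "v \<in> pres_class S R v"
    using assms by (auto simp: pres_class_def intro: pres_eq.refl)
  ultimately have "(\<Union>u'\<in>pres_class S R u. \<Union>v'\<in>pres_class S R v. pres_class S R (u' @ v')) =
      pres_class S R (u @ v)" by blast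
  then show ?thesis by (simp add: presented_group_def)
qed

lemma presented_inverse:
  "w \<in> words S \<Longrightarrow>
    \<exists>v\<in>words S. pres_eq S R (v @ w) []"
proof (induction w)
  case Nil
  then show ?case by (auto simp: words_def intro!: bexI[of _ "[]"] pres_eq.refl)
next
  case (Cons x w)
  obtain s b where x: "x = (s, b)" by (cases x)
  from Cons.prems have s: "s \<in> S" and w: "w \<in> words S" by (auto simp: words_def x)
  obtain v where v: "v \<in> words S" "pres_eq S R (v @ w) []" using Cons.IH[OF w] by blast
  have "pres_eq S R ([(s, \<not> b), (s, b)] @ w) ([] @ w)"
    using pres_eq.cancel[OF s, of R "\<not> b"] w by (intro pres_eq.append pres_eq.refl) auto
  then have "pres_eq S R (v @ ([(s, \<not> b), (s, b)] @ w)) (v @ ([] @ w))"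
    by (rule pres_eq.append[OF pres_eq.refl[OF v(1)]])
  then have "pres_eq S R ((v @ [(s, \<not> b)]) @ x # w) []"
    using pres_eq.trans[OF _ v(2)] by (simp add: x)
  moreover have "v @ [(s, \<not> b)] \<in> words S" using v s by (auto simp: words_def)
  ultimately show ?case by blast
qed

lemma group_presented_group: "group (presented_group S R)"
proof (rule groupI)
  let ?G = "presented_group S R"
  have c: "carrier ?G = pres_class S R ` words S" and o: "\<one>\<^bsub>?G\<^esub> = pres_class S R []"
    by (auto simp: presented_group_def)
  have nil: "[] \<in> words S" by (simp add: words_def)
  show "\<one>\<^bsub>?G\<^esub> \<in> carrier ?G" by (simp add: c o nil)
  fix x y z
  assume "x \<in> carrier ?G"
  then obtain u where u: "x = pres_class S R u" "u \<in> words S" by (auto simp: c)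
  show "\<one>\<^bsub>?G\<^esub> \<otimes>\<^bsub>?G\<^esub> x = x" by (simp add: o u nil presented_mult)
  obtain v where "v \<in> words S" "pres_eq S R (v @ u) []" using presented_inverse[OF u(2)] by blast
  then have "pres_class S R v \<in> carrier ?G" "pres_class S R v \<otimes>\<^bsub>?G\<^esub> x = \<one>\<^bsub>?G\<^esub>"
    by (auto simp: c o u presented_mult pres_class_eq_iff words_append)
  then show "\<exists>y\<in>carrier ?G. y \<otimes>\<^bsub>?G\<^esub> x = \<one>\<^bsub>?G\<^esub>" by blast
  assume "y \<in> carrier ?G"
  then obtain v where v: "y = pres_class S R v" "v \<in> words S" by (auto simp: c)
  show "x \<otimes>\<^bsub>?G\<^esub> y \<in> carrier ?G" by (simp add: c u v presented_mult words_append)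
  assume "z \<in> carrier ?G"
  then obtain w where w: "z = pres_class S R w" "w \<in> words S" by (auto simp: c)
  show "x \<otimes>\<^bsub>?G\<^esub> y \<otimes>\<^bsub>?G\<^esub> z = x \<otimes>\<^bsub>?G\<^esub> (y \<otimes>\<^bsub>?G\<^esub> z)"
    by (simp add: u v w presented_mult words_append)
qed


section \<open>Artin groups and Artin complexes\<close>

text \<open>The values of \<open>m\<close> on the diagonal and outside \<open>S\<close> are irrelevant.\<close>

definition coxeter_matrix :: "'s set \<Rightarrow> ('s \<Rightarrow> 's \<Rightarrow> enat) \<Rightarrow> bool" where
  "coxeter_matrix S m \<longleftrightarrow> (\<forall>s\<in>S. \<forall>t\<in>S. s \<noteq> t \<longrightarrow> m s t = m t s \<and> 2 \<le> m s t)"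

definition large_type :: "'s set \<Rightarrow> ('s \<Rightarrow> 's \<Rightarrow> enat) \<Rightarrow> bool" where
  "large_type S m \<longleftrightarrow> (\<forall>s\<in>S. \<forall>t\<in>S. s \<noteq> t \<longrightarrow> 3 \<le> m s t)"

text \<open>\<open>alternating_word n s t\<close> is the word \<open>sts\<dots>\<close> with \<open>n\<close> letters.\<close>

fun alternating_word :: "nat \<Rightarrow> 's \<Rightarrow> 's \<Rightarrow> 's word" where
  "alternating_word 0 s t = []"
| "alternating_word (Suc n) s t = (s, True) # alternating_word n t s"

definition artin_relations :: "'s set \<Rightarrow> ('s \<Rightarrow> 's \<Rightarrow> enat) \<Rightarrow> ('s word \<times> 's word) set" where
  "artin_relations S m =
     {(alternating_word n s t, alternating_word n t s) | n s t.
        s \<in> S \<and> t \<in> S \<and> s \<noteq> t \<and> m s t = enat n}"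

definition artin_group :: "'s set \<Rightarrow> ('s \<Rightarrow> 's \<Rightarrow> enat) \<Rightarrow> 's word set monoid" where
  "artin_group S m = presented_group S (artin_relations S m)"

definition artin_generator :: "'s set \<Rightarrow> ('s \<Rightarrow> 's \<Rightarrow> enat) \<Rightarrow> 's \<Rightarrow> 's word set" where
  "artin_generator S m s = pres_class S (artin_relations S m) [(s, True)]"

definition standard_parabolic ::
    "'s set \<Rightarrow> ('s \<Rightarrow> 's \<Rightarrow> enat) \<Rightarrow> 's set \<Rightarrow> 's word set set" where
  "standard_parabolic S m T = generate (artin_group S m) (artin_generator S m ` T)"

text \<open>
  A simplicial complex is represented by the set of its simplices, each simplex being the
  finite nonempty set of its vertices; the empty set is not a simplex.
\<close>

definition abstract_complex :: "'v set set \<Rightarrow> bool" where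
  "abstract_complex X \<longleftrightarrow>
     (\<forall>\<sigma>\<in>X. finite \<sigma> \<and> \<sigma> \<noteq> {} \<and> (\<forall>\<tau>. \<tau> \<subseteq> \<sigma> \<and> \<tau> \<noteq> {} \<longrightarrow> \<tau> \<in> X))"

definition artin_complex :: "'s set \<Rightarrow> ('s \<Rightarrow> 's \<Rightarrow> enat) \<Rightarrow> 's word set set set set" where
  "artin_complex S m =
     {(\<lambda>s. g <#\<^bsub>artin_group S m\<^esub> standard_parabolic S m (S - {s})) ` T | g T.
        g \<in> carrier (artin_group S m) \<and> T \<subseteq> S \<and> T \<noteq> {}}"

lemma group_artin_group: "group (artin_group S m)"
  unfolding artin_group_def by (rule group_presented_group)

lemma abstract_complex_artin_complex:
  assumes "finite S"
  shows "abstract_complex (artin_complex S m)"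
proof -
  let ?v = "\<lambda>g s. g <#\<^bsub>artin_group S m\<^esub> standard_parabolic S m (S - {s})"
  have "\<tau> \<in> artin_complex S m"
    if g: "g \<in> carrier (artin_group S m)" "T \<subseteq> S" "\<tau> \<subseteq> ?v g ` T" "\<tau> \<noteq> {}" for g T \<tau>
  proof -
    obtain T' where "T' \<subseteq> T" "\<tau> = ?v g ` T'" using g(3) by (auto simp: subset_image_iff)
    then show ?thesis using g unfolding artin_complex_def by blast
  qed
  moreover have "finite (?v g ` T)" if "T \<subseteq> S" for g T
    using that assms finite_subset by blast
  ultimately show ?thesis
    unfolding abstract_complex_def by (auto simp: artin_complex_def)
qed


section \<open>Topology of the geometric realization\<close>

text \<open>
  Points are given by their barycentric coordinates. The type \<^typ>\<open>'v \<Rightarrow> real\<close> carries the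
  product topology, which on a single closed simplex is the Euclidean one; the realization
  carries the weak topology determined by its closed simplices.
\<close>

definition closed_simplex :: "'v set \<Rightarrow> ('v \<Rightarrow> real) set" where
  "closed_simplex \<sigma> =
     {x. (\<forall>v. 0 \<le> x v) \<and> (\<forall>v. v \<notin> \<sigma> \<longrightarrow> x v = 0) \<and> (\<Sum>v\<in>\<sigma>. x v) = 1}"

definition realization :: "'v set set \<Rightarrow> ('v \<Rightarrow> real) topology" where
  "realization X = topology (\<lambda>U. U \<subseteq> (\<Union>\<sigma>\<in>X. closed_simplex \<sigma>) \<and>
     (\<forall>\<sigma>\<in>X. openin (top_of_set (closed_simplex \<sigma>)) (U \<inter> closed_simplex \<sigma>)))"

lemma openin_realization:
  "openin (realization X) U \<longleftrightarrow> U \<subseteq> (\<Union>\<sigma>\<in>X. closed_simplex \<sigma>) \<and>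
     (\<forall>\<sigma>\<in>X. openin (top_of_set (closed_simplex \<sigma>)) (U \<inter> closed_simplex \<sigma>))"
proof -
  have "istopology (\<lambda>U. U \<subseteq> (\<Union>\<sigma>\<in>X. closed_simplex \<sigma>) \<and>
     (\<forall>\<sigma>\<in>X. openin (top_of_set (closed_simplex \<sigma>)) (U \<inter> closed_simplex \<sigma>)))"
    unfolding istopology_def
  proof (intro conjI allI impI ballI)
    fix U V \<sigma>
    assume "U \<subseteq> (\<Union>\<sigma>\<in>X. closed_simplex \<sigma>) \<and>
      (\<forall>\<sigma>\<in>X. openin (top_of_set (closed_simplex \<sigma>)) (U \<inter> closed_simplex \<sigma>))"
      and "V \<subseteq> (\<Union>\<sigma>\<in>X. closed_simplex \<sigma>) \<and>
      (\<forall>\<sigma>\<in>X. openin (top_of_set (closed_simplex \<sigma>)) (V \<inter> closed_simplex \<sigma>))"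
      and "\<sigma> \<in> X"
    then have "openin (top_of_set (closed_simplex \<sigma>))
        ((U \<inter> closed_simplex \<sigma>) \<inter> (V \<inter> closed_simplex \<sigma>))" by blast
    then show "openin (top_of_set (closed_simplex \<sigma>)) (U \<inter> V \<inter> closed_simplex \<sigma>)"
      by (simp add: Int_ac)
  next
    fix \<U> :: "('a \<Rightarrow> real) set set" and \<sigma>
    assume a: "\<forall>U\<in>\<U>. U \<subseteq> (\<Union>\<sigma>\<in>X. closed_simplex \<sigma>) \<and>
      (\<forall>\<sigma>\<in>X. openin (top_of_set (closed_simplex \<sigma>)) (U \<inter> closed_simplex \<sigma>))"
      and "\<sigma> \<in> X"
    then have "openin (top_of_set (closed_simplex \<sigma>)) (\<Union>U\<in>\<U>. U \<inter> closed_simplex \<sigma>)"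
      by (intro openin_Union) (auto simp only: image_iff)
    then show "openin (top_of_set (closed_simplex \<sigma>)) (\<Union>\<U> \<inter> closed_simplex \<sigma>)"
      by (simp only: Int_Union2)
  qed blast+
  then show ?thesis
    unfolding realization_def by (simp add: topology_inverse')
qed

lemma topspace_realization: "topspace (realization X) = (\<Union>\<sigma>\<in>X. closed_simplex \<sigma>)"
proof
  show "topspace (realization X) \<subseteq> (\<Union>\<sigma>\<in>X. closed_simplex \<sigma>)"
    by (metis openin_realization openin_topspace)
  have "openin (realization X) (\<Union>\<sigma>\<in>X. closed_simplex \<sigma>)"
    unfolding openin_realization by (auto simp: Int_absorb1 SUP_upper)
  then show "(\<Union>\<sigma>\<in>X. closed_simplex \<sigma>) \<subseteq> topspace (realization X)"
    by (rule openin_subset)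
qed

text \<open>
  The library's \<^const>\<open>simply_connected\<close> is about subsets of a type with a topology; this is the
  corresponding notion for arbitrary topological spaces.
\<close>

definition simply_connected_space :: "'a topology \<Rightarrow> bool" where
  "simply_connected_space T \<longleftrightarrow> path_connected_space T \<and>
     (\<forall>p. pathin T p \<and> p 1 = p 0 \<longrightarrow>
        homotopic_with (\<lambda>r. r 0 = p 0 \<and> r 1 = p 0) (top_of_set {0..1}) T p (\<lambda>_. p 0))"

lemma simply_connected_space_top_of_set:
  fixes A :: "'a::real_normed_vector set"
  shows "simply_connected_space (top_of_set A) \<longleftrightarrow> simply_connected A"
proof -
  have "path_connected_space (top_of_set A) \<longleftrightarrow> path_connected A"
    by (metis path_connectedin_euclidean path_connectedin_topspace path_connectedin_absolute
        topspace_euclidean_subtopology)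
  then show ?thesis
    unfolding simply_connected_space_def simply_connected_eq_contractible_path homotopic_paths_def
      pathin_canon_iff linepath_refl
    by (simp add: pathstart_def pathfinish_def path_image_def image_subset_iff_funcset conj_assoc)
qed


section \<open>Systolicity\<close>

definition link :: "'v set set \<Rightarrow> 'v set \<Rightarrow> 'v set set" where
  "link X \<sigma> = {\<tau>\<in>X. \<tau> \<inter> \<sigma> = {} \<and> \<tau> \<union> \<sigma> \<in> X}"

text \<open>An embedded cycle is given by the list of its vertices in cyclic order.\<close>

definition cycle_edges :: "'v list \<Rightarrow> 'v set set" where
  "cycle_edges c = {{c ! i, c ! (Suc i mod length c)} | i. i < length c}"

definition embedded_cycle :: "'v set set \<Rightarrow> 'v list \<Rightarrow> bool" where
  "embedded_cycle X c \<longleftrightarrow> 3 \<le> length c \<and> distinct c \<and> cycle_edges c \<subseteq> X"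

definition full_cycle :: "'v set set \<Rightarrow> 'v list \<Rightarrow> bool" where
  "full_cycle X c \<longleftrightarrow> embedded_cycle X c \<and>
     (\<forall>\<sigma>\<in>X. \<sigma> \<subseteq> set c \<longrightarrow> \<sigma> \<in> cycle_edges c \<or> (\<exists>v\<in>set c. \<sigma> = {v}))"

text \<open>The infimum of the empty set in \<^typ>\<open>enat\<close> is \<open>\<infinity>\<close>.\<close>

definition systole :: "'v set set \<Rightarrow> enat" where
  "systole X = (INF c\<in>{c. full_cycle X c}. enat (card (cycle_edges c)))"

definition locally_large :: "nat \<Rightarrow> 'v set set \<Rightarrow> bool" where
  "locally_large k X \<longleftrightarrow> (\<forall>\<sigma>\<in>X. enat k \<le> systole (link X \<sigma>))"

definition k_systolic :: "nat \<Rightarrow> 'v set set \<Rightarrow> bool" where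
  "k_systolic k X \<longleftrightarrow> connected_space (realization X) \<and>
     simply_connected_space (realization X) \<and> locally_large k X"

definition systolic :: "'v set set \<Rightarrow> bool" where
  "systolic X \<longleftrightarrow> k_systolic 6 X"

end

theory Submission
  imports Defs
begin

text \<open>
  The proof is by induction over links. The link of a simplex of the Artin complex
  \<open>X\<^sub>S\<close> is a copy of the Artin complex of a proper subset of \<open>S\<close>.
  Call a complex six-large if it has no full cycles of length at most five. Then
  \<open>X\<^sub>S\<close> is systolic as soon as it is simply connected and
  \<open>X\<^sub>U\<close> is six-large for all proper subsets \<open>U\<close>, and four facts are
  needed.

  Local to global (\<open>six_large_local_to_global\<close>): a simply connected complex whose
  vertex links are six-large is itself six-large. The universal cover is constructed as an
  increasing union of balls around a vertex. Largeness of links makes the construction of the next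
  ball consistent, and shows that simplices of a sphere project to simplices of the previous sphere.
  Since the complex is simply connected, it is its own cover, and a diagonal of a short cycle is
  found by projecting towards the centre. This reduces six-largeness of \<open>X\<^sub>U\<close>
  with \<open>|U| \<ge> 3\<close> to smaller \<open>U\<close>.

  Links (\<open>link_coset_complex\<close>): the identification of links rests on the theorem of van
  der Lek that standard parabolic subgroups are Artin groups and intersect as expected
  (\<open>parabolic_injective\<close>, \<open>parabolic_intersection\<close>). It is derived here
  from a retraction of words (\<open>project\<close>), which follows the coset of the underlying
  element of the Coxeter group and turns each letter that fixes this coset into a generator of the
  parabolic subgroup. That the retraction respects braid relations is a statement about Coxeter
  groups, proved from the exchange condition and Deodhar's lemma.

  The dihedral case (\<open>coset_complex_two\<close>): for \<open>U = {s, t}\<close> the complex is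
  a bipartite graph, and it has to be shown that it has no cycle of length four, that is, that no
  nontrivial relation \<open>s\<^sup>a t\<^sup>b s\<^sup>c t\<^sup>d = 1\<close> holds. This is read
  off a representation on a plane, in which the generators have the eigenvalue \<open>-9\<close>. It
  is here that the type has to be large: if \<open>s\<close> and \<open>t\<close> commute, such
  relations exist.

  Simple connectedness (\<open>edge_simply_connected_coset_complex\<close>,
  \<open>simply_connected_realization\<close>): edge paths correspond to words in the generators.
  For \<open>|U| \<ge> 3\<close> each defining relation involves at most two generators and so takes
  place in the star of a vertex. Edge-path homotopies are turned into homotopies in the geometric
  realization by decomposing paths into pieces in open stars of vertices.
\<close>

section \<open>Developing a complex ball by ball\<close>

text \<open>
  The vertices and edges of a complex enter through \<open>E\<close>, its triangles through
  \<open>T\<close>. The last three assumptions say that no link of a vertex has a full cycle of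
  length three, four or five.
\<close>

locale six_large_links =
  fixes E :: "'v \<Rightarrow> 'v \<Rightarrow> bool" and T :: "'v \<Rightarrow> 'v \<Rightarrow> 'v \<Rightarrow> bool"
  assumes E_sym: "E a b \<Longrightarrow> E b a" and E_irrefl: "\<not> E a a"
    and T_swap: "T a b c \<Longrightarrow> T b a c" and T_rot: "T a b c \<Longrightarrow> T b c a"
    and T_E: "T a b c \<Longrightarrow> E a b"
    and no_empty_3: "T v a b \<Longrightarrow> T v b c \<Longrightarrow> T v c a \<Longrightarrow> T a b c"
    and no_empty_4: "T v a b \<Longrightarrow> T v b c \<Longrightarrow> T v c d \<Longrightarrow> T v d a \<Longrightarrow> a \<noteq> c \<Longrightarrow> b \<noteq> d \<Longrightarrow>
        T v a c \<or> T v b d"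
    and no_empty_5: "T v a b \<Longrightarrow> T v b c \<Longrightarrow> T v c d \<Longrightarrow> T v d e \<Longrightarrow> T v e a \<Longrightarrow> distinct [a, b, c, d, e] \<Longrightarrow>
        T v a c \<or> T v b d \<or> T v c e \<or> T v d a \<or> T v e b"
begin

lemma T_perm: "T a b c \<Longrightarrow> T b a c" "T a b c \<Longrightarrow> T b c a" "T a b c \<Longrightarrow> T a c b" "T a b c \<Longrightarrow> T c a b" "T a b c \<Longrightarrow> T c b a"
  using T_swap T_rot by blast+

lemma T_ac: "T a b c = T b a c" "T a b c = T a c b"
  using T_swap T_rot by blast+

lemma T_edges: "T a b c \<Longrightarrow> E a b" "T a b c \<Longrightarrow> E b c" "T a b c \<Longrightarrow> E a c"
  using T_E T_ac by metis+

lemma E_neq: "E a b \<Longrightarrow> a \<noteq> b" using E_irrefl by blast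

end

text \<open>
  The ball of radius \<open>n\<close> around a base vertex in the universal cover. A vertex of the
  cover is a list: its head is the vertex below it, and its length is one more than its distance
  from the base. Neighbours are determined by what they lie over, and every edge below lifts at a
  vertex that is not on the sphere of radius \<open>n\<close>.

  What makes the induction on the radius work are the last three assumptions. Together they say that
  a simplex of a sphere projects to a simplex of the previous sphere, which is the combinatorial
  form of non-positive curvature.
\<close>

locale developed_ball = six_large_links +
  fixes n :: nat and B :: "'a list set" and A :: "'a list \<Rightarrow> 'a list \<Rightarrow> bool"
  assumes len_pos: "w \<in> B \<Longrightarrow> 1 \<le> length w" and len_le: "w \<in> B \<Longrightarrow> length w \<le> Suc n"
    and adj_left: "A w z \<Longrightarrow> w \<in> B" and adj_right: "A w z \<Longrightarrow> z \<in> B" and adj_sym: "A w z \<Longrightarrow> A z w"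
    and adj_edge: "A w z \<Longrightarrow> E (hd w) (hd z)" and adj_len: "A w z \<Longrightarrow> length w \<le> Suc (length z)"
    and adj_inj: "A w z \<Longrightarrow> A w z' \<Longrightarrow> hd z = hd z' \<Longrightarrow> z = z'"
    and adj_triangle: "A w z \<Longrightarrow> A w z' \<Longrightarrow> A z z' \<longleftrightarrow> T (hd w) (hd z) (hd z')"
    and adj_lift: "w \<in> B \<Longrightarrow> length w \<le> n \<Longrightarrow> E (hd w) x \<Longrightarrow> \<exists>z. A w z \<and> hd z = x"
    and parents_adj: "A w u \<Longrightarrow> A w u' \<Longrightarrow> length w = Suc (length u) \<Longrightarrow> length w = Suc (length u') \<Longrightarrow>
        u = u' \<or> A u u'"
    and parent_ex: "w \<in> B \<Longrightarrow> 2 \<le> length w \<Longrightarrow> \<exists>u. A w u \<and> length w = Suc (length u)"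
    and common_parent_ex: "A w w' \<Longrightarrow> length w = length w' \<Longrightarrow> \<exists>u. A w u \<and> A w' u \<and> length w = Suc (length u)"
begin

text \<open>
  The edge from the head of \<open>w\<close> to \<open>x\<close> still has to be lifted at the
  boundary vertex \<open>w\<close>. Two such lifts over the same \<open>x\<close> must be given the
  same new end point exactly when the triangle over the edge between their starting points has to
  close up.
\<close>

definition free where
  "free w x \<longleftrightarrow> w \<in> B \<and> length w = Suc n \<and> E (hd w) x \<and> (\<forall>z. A w z \<longrightarrow> hd z \<noteq> x)"

definition same_child where
  "same_child x w w' \<longleftrightarrow> free w x \<and> free w' x \<and>
     (w = w' \<or> A w w' \<and> T (hd w) (hd w') x)"

text \<open>
  The tail of the new list is a chosen parent, so that equality of lists is
  \<open>same_child\<close>.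
\<close>

definition child where
  "child w x = x # (SOME w'. same_child x w w')"

definition next_verts where
  "next_verts = B \<union> {child w x | w x. free w x}"

definition next_adj where
  "next_adj y z \<longleftrightarrow> A y z \<or>
     (\<exists>w x. free w x \<and> (y = child w x \<and> z = w \<or> y = w \<and> z = child w x)) \<or>
     (\<exists>w x x'. free w x \<and> free w x' \<and> T (hd w) x x' \<and>
        y = child w x \<and> z = child w x')"

abbreviation "C \<equiv> free"
abbreviation "Q \<equiv> same_child"
abbreviation "ch \<equiv> child"
abbreviation "B' \<equiv> next_verts"
abbreviation "A' \<equiv> next_adj"

lemmas bD = len_pos len_le adj_left adj_right adj_sym adj_edge adj_len adj_inj adj_triangle adj_lift
  parents_adj parent_ex common_parent_ex

lemma free_spread:
  assumes "C w x" "A w a" "T (hd w) (hd a) x"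
  shows "C a x" "Q x w a"
proof -
  have no: False if "A a z" "hd z = x" for z
  proof -
    have "A w z"
      using bD(9)[OF bD(5)[OF assms(2)] that(1)] bD(5)[OF assms(2)] that assms(3) by (auto simp: T_ac bD(5))
    then show False using assms(1) that unfolding free_def by blast
  qed
  have Ex: "E (hd a) x" using assms(3) T_edges by blast
  have "length a = Suc n"
    using bD(10)[OF bD(4)[OF assms(2)], of x] Ex no bD(2)[OF bD(4)[OF assms(2)]]
    by (meson le_antisym not_less_eq_eq)
  then show "C a x"
    using no Ex bD(4)[OF assms(2)] unfolding free_def by blast
  then show "Q x w a" using assms unfolding same_child_def by blast
qed

lemma Q_sym: "Q x w w' \<Longrightarrow> Q x w' w"
  unfolding same_child_def using bD(5) by (auto simp: T_ac)

lemma Q_refl: "C w x \<Longrightarrow> Q x w w" unfolding same_child_def by blast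

text \<open>
  In the link of the vertex below \<open>w'\<close>, the vertices below \<open>w\<close>,
  \<open>x\<close>, \<open>w''\<close> and the common parents \<open>u'\<close>, \<open>u\<close>
  form a cycle of length four or five. A diagonal through \<open>x\<close> would make
  \<open>x\<close> a neighbour of a parent, at which every edge has been lifted. So the vertices
  below \<open>w\<close> and \<open>w''\<close> are adjacent, and then \<open>w\<close> and
  \<open>w''\<close> are adjacent too.
\<close>

lemma Q_trans:
  assumes "Q x w' w" "Q x w' w''"
  shows "Q x w w''"
proof (cases "w = w' \<or> w' = w'' \<or> w = w''")
  case True
  then show ?thesis using assms Q_sym Q_refl unfolding same_child_def by blast
next
  case False
  have a: "A w' w" "T (hd w') (hd w) x" "A w' w''" "T (hd w') (hd w'') x"
    and c: "C w' x" "C w x" "C w'' x"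
    using assms False unfolding same_child_def by auto
  have len: "length w' = Suc n" "length w = Suc n" "length w'' = Suc n"
    using c unfolding free_def by auto
  obtain u where u: "A w' u" "A w u" "length w' = Suc (length u)"
    using bD(13)[OF a(1)] len by auto
  obtain u' where u': "A w' u'" "A w'' u'" "length w' = Suc (length u')"
    using bD(13)[OF a(3)] len by auto
  have uu: "u = u' \<or> A u u'" using bD(11)[OF u(1) u'(1) u(3) u'(3)] .
  \<comment> \<open>The cycle of the argument lives in the link of the following vertex.\<close>
  let ?p = "hd w'"
  have t1: "T ?p (hd w) (hd u)" using bD(9)[OF a(1) u(1)] u(2) by blast
  have t2: "T ?p (hd w'') (hd u')" using bD(9)[OF a(3) u'(1)] u'(2) by blast
  have nx: "\<not> T ?p x (hd y)" if "A w' y" "length w' = Suc (length y)" for y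
    using free_spread(1)[OF c(1) that(1)] that(2) len unfolding free_def by (auto simp: T_ac)
  have xu: "x \<noteq> hd y" if "A w' y" for y using c(1) that unfolding free_def by blast
  have ne: "hd w \<noteq> hd w''" using bD(8)[OF a(1) a(3)] False by blast
  have t3: "T ?p (hd w) (hd w'')"
  proof (cases "u = u'")
    case True
    have "hd u \<noteq> x" using xu[OF u(1)] by blast
    then have "T ?p (hd w) (hd w'') \<or> T ?p x (hd u)"
      using no_empty_4[of ?p "hd w" x "hd w''" "hd u"] a(2,4) t1 t2 ne True by (auto simp: T_ac)
    then show ?thesis using nx[OF u(1) u(3)] by blast
  next
    case False
    then have tu: "T ?p (hd u) (hd u')" using uu bD(9)[OF u(1) u'(1)] by blast
    have four: ?thesis if "T ?p (hd w) (hd u')"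
      using no_empty_4[of ?p "hd w" x "hd w''" "hd u'"] a(2,4) t2 ne that xu[OF u'(1)]
        nx[OF u'(1) u'(3)] by (auto simp: T_ac)
    have four': ?thesis if "T ?p (hd w'') (hd u)"
      using no_empty_4[of ?p "hd w''" x "hd w" "hd u"] a(2,4) t1 ne that xu[OF u(1)]
        nx[OF u(1) u(3)] by (auto simp: T_ac)
    have d1: "hd w \<noteq> hd u'" "hd w'' \<noteq> hd u"
      using bD(8)[OF a(1) u'(1)] bD(8)[OF a(3) u(1)] len u(3) u'(3) by auto
    have "distinct [hd w, x, hd w'', hd u', hd u]"
      using ne xu a u u' d1 E_neq T_edges a t1 t2 tu by (metis distinct_length_2_or_more distinct_singleton)
    then have "T ?p (hd w) (hd w'') \<or> T ?p x (hd u') \<or> T ?p (hd w'') (hd u) \<or> T ?p (hd u') (hd w) \<or> T ?p (hd u) x"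
      using no_empty_5[of ?p "hd w" x "hd w''" "hd u'" "hd u"] a(2,4) t1 t2 tu by (auto simp: T_ac)
    then show ?thesis using four four' nx[OF u(1,3)] nx[OF u'(1,3)] by (auto simp: T_ac)
  qed
  then have "A w w''" using bD(9)[OF a(1) a(3)] by blast
  moreover have "T (hd w) (hd w'') x"
    using no_empty_3[of ?p "hd w" "hd w''" x] t3 a(2,4) by (auto simp: T_ac)
  ultimately show ?thesis using c unfolding same_child_def by blast
qed

lemma Q_Eps: "C w x \<Longrightarrow> Q x w (SOME w'. Q x w w')"
  using Q_refl someI[of "Q x w"] by blast

lemma child_eq_iff:
  assumes "C w x" "C w' y"
  shows "ch w x = ch w' y \<longleftrightarrow> x = y \<and> Q x w w'"
proof
  assume eq: "ch w x = ch w' y"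
  then have "x = y" by (simp add: child_def)
  moreover have "Q x w w'"
    using Q_Eps[OF assms(1)] Q_Eps[OF assms(2)] eq unfolding child_def
    by (metis Q_sym Q_trans list.inject)
  ultimately show "x = y \<and> Q x w w'" by blast
next
  assume "x = y \<and> Q x w w'"
  then have x: "x = y" and q: "Q x w w'" by auto
  have "Q x w = Q x w'"
  proof
    show "Q x w a = Q x w' a" for a
      using Q_trans[OF q, of a] Q_trans[OF Q_sym[OF q], of a] by blast
  qed
  then show "ch w x = ch w' y" by (simp add: child_def x)
qed

lemma child_len: "C w x \<Longrightarrow> length (ch w x) = Suc (Suc n)"
proof -
  assume "C w x"
  then have "Q x w (SOME w'. Q x w w')" by (rule Q_Eps)
  then have "length (SOME w'. Q x w w') = Suc n" unfolding same_child_def[of x w] free_def by blast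
  then show ?thesis by (simp add: child_def)
qed

lemma hd_child [simp]: "hd (ch w x) = x" by (simp add: child_def)

lemma child_notin: "C w x \<Longrightarrow> ch w x \<notin> B"
  using child_len bD(2) by fastforce

lemma A'_verts: "A' y z \<Longrightarrow> y \<in> B' \<and> z \<in> B'"
  using bD(3,4) unfolding next_adj_def next_verts_def free_def by blast

lemma B'_cases:
  assumes "y \<in> B'"
  obtains "y \<in> B" | w x where "C w x" "y = ch w x" "y \<notin> B"
  using assms child_notin unfolding next_verts_def by blast

lemma Q_free: "Q x w a \<Longrightarrow> C a x" "Q x w a \<Longrightarrow> C w x" unfolding same_child_def by blast+

lemma free_B: "C w x \<Longrightarrow> w \<in> B" unfolding free_def by blast

lemma A'_cases:
  assumes "A' y z"
  obtains "A y z" | w x where "C w x" "y = ch w x" "z = w" | w x where "C w x" "y = w" "z = ch w x"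
    | w x x' where "C w x" "C w x'" "T (hd w) x x'" "y = ch w x" "z = ch w x'"
  using assms unfolding next_adj_def by blast

lemma child_adj: "C w x \<Longrightarrow> A' w (ch w x)" "C w x \<Longrightarrow> A' (ch w x) w" unfolding next_adj_def by blast+

lemma sibling_adj: "C w x \<Longrightarrow> C w x' \<Longrightarrow> T (hd w) x x' \<Longrightarrow> A' (ch w x) (ch w x')"
  unfolding next_adj_def by blast

lemma A_A': "A y z \<Longrightarrow> A' y z" unfolding next_adj_def by blast

lemma A'_sym: "A' y z \<Longrightarrow> A' z y"
proof (erule A'_cases)
  fix w x x' assume "C w x" "C w x'" "T (hd w) x x'" "y = ch w x" "z = ch w x'"
  then show ?thesis using sibling_adj[of w x' x] T_ac(2)[of "hd w"] by simp
qed (use child_adj A_A' bD(5) in auto)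

lemma old_old: assumes "y \<in> B" "z \<in> B" shows "A' y z \<longleftrightarrow> A y z"
proof
  assume "A' y z" then show "A y z" using assms child_notin by (cases rule: A'_cases) auto
qed (rule A_A')

lemma old_new: assumes "A' y z" "y \<in> B" "z \<notin> B" shows "\<exists>x. C y x \<and> z = ch y x"
  using assms(1)
proof (cases rule: A'_cases)
  case 1 then show ?thesis using bD(4) assms by blast
next
  case (2 w x) then show ?thesis using child_notin assms by blast
next
  case (3 w x) then show ?thesis by blast
next
  case (4 w x x') then show ?thesis using child_notin assms by blast
qed

lemma new_old: assumes "A' y z" "y \<notin> B" "z \<in> B" shows "\<exists>x. C z x \<and> y = ch z x"
  using old_new[OF A'_sym[OF assms(1)]] assms by blast

lemma new_new: assumes "A' y z" "y \<notin> B" "z \<notin> B"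
  shows "\<exists>u x x'. C u x \<and> C u x' \<and> T (hd u) x x' \<and> y = ch u x \<and> z = ch u x'"
  using assms(1)
proof (cases rule: A'_cases)
  case 1 then show ?thesis using bD(4) assms by blast
next
  case (2 w x) then show ?thesis using free_B assms by blast
next
  case (3 w x) then show ?thesis using free_B assms by blast
next
  case (4 w x x') then show ?thesis by blast
qed

lemma Q_T: "Q x w a \<Longrightarrow> w \<noteq> a \<Longrightarrow> T (hd w) (hd a) x" "Q x w a \<Longrightarrow> w \<noteq> a \<Longrightarrow> A w a"
  unfolding same_child_def by blast+

lemma child_adj_iff: assumes "C w x" "a \<in> B" shows "A' a (ch w x) \<longleftrightarrow> Q x w a"
proof
  assume "A' a (ch w x)"
  then obtain x' where x': "C a x'" "ch w x = ch a x'"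
    using old_new[OF _ assms(2) child_notin[OF assms(1)]] by blast
  then show "Q x w a" using child_eq_iff[OF assms(1) x'(1)] by blast
next
  assume q: "Q x w a"
  then have a: "C a x" by (rule Q_free)
  then have "ch w x = ch a x" using child_eq_iff[OF assms(1) a] q by blast
  then show "A' a (ch w x)" using child_adj[OF a] by simp
qed

lemma T_move: assumes "T (hd u) x x'" "Q x u a" "Q x' u a" shows "T (hd a) x x'"
proof (cases "u = a")
  case False
  then show ?thesis using no_empty_3[of "hd u" "hd a" x x'] Q_T(1)[OF assms(2)] Q_T(1)[OF assms(3)] assms(1) by (auto simp: T_ac)
qed (use assms in simp)

lemma A'_E: assumes "A' y z" shows "E (hd y) (hd z)" "length y \<le> Suc (length z)"
proof -
  have "E (hd y) (hd z) \<and> length y \<le> Suc (length z)"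
    using assms
  proof (elim A'_cases)
    fix w x x' assume "C w x" "C w x'" "T (hd w) x x'" "y = ch w x" "z = ch w x'"
    then show ?thesis using T_edges child_len by auto
  next
    assume "A y z" then show ?thesis using bD(6,7) by blast
  next
    fix w x assume "C w x" "y = ch w x" "z = w"
    then show ?thesis using child_len[of w x] E_sym unfolding free_def by auto
  next
    fix w x assume "C w x" "y = w" "z = ch w x"
    then show ?thesis using child_len[of w x] E_sym unfolding free_def by auto
  qed
  then show "E (hd y) (hd z)" "length y \<le> Suc (length z)" by auto
qed

lemma A'_inj: assumes "A' y z" "A' y z'" "hd z = hd z'" shows "z = z'"
proof (cases "y \<in> B")
  case yB: True
  have mixed: False if "A' y z" "A' y z'" "hd z = hd z'" "z \<in> B" "z' \<notin> B" for z z'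
    using old_new[OF that(2) yB that(5)] old_old[OF yB that(4)] that unfolding free_def by auto
  consider "z \<in> B" "z' \<in> B" | "z \<notin> B" "z' \<notin> B" using mixed assms by metis
  then show ?thesis
  proof cases
    case 1 then show ?thesis using assms old_old yB bD(8) by metis
  next
    case 2
    then show ?thesis using old_new[OF assms(1) yB 2(1)] old_new[OF assms(2) yB 2(2)] assms(3) by auto
  qed
next
  case yB: False
  have mixed: False if m: "A' y z" "A' y z'" "hd z = hd z'" "z \<in> B" "z' \<notin> B" for z z'
  proof -
    obtain x where x: "C z x" "y = ch z x" using new_old[OF m(1) yB m(4)] by blast
    obtain u r x' where u: "C u r" "C u x'" "T (hd u) r x'" "y = ch u r" "z' = ch u x'"
      using new_new[OF m(2) yB m(5)] by blast
    have "Q r u z" using child_eq_iff[OF u(1) x(1)] u(4) x(2) by metis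
    then have "u = z \<or> A u z" using Q_T by blast
    then show False using u(2,5) that(3) E_neq unfolding free_def by force
  qed
  consider "z \<in> B" "z' \<in> B" | "z \<notin> B" "z' \<notin> B" using mixed assms by metis
  then show ?thesis
  proof cases
    case 1
    obtain x x' where x: "C z x" "y = ch z x" "C z' x'" "y = ch z' x'"
      using new_old[OF assms(1) yB 1(1)] new_old[OF assms(2) yB 1(2)] by blast
    then have "Q x z z'" using child_eq_iff[OF x(1,3)] by metis
    then show ?thesis using Q_T(2) bD(6) E_neq assms(3) by metis
  next
    case 2
    obtain u r x where u: "C u r" "C u x" "T (hd u) r x" "y = ch u r" "z = ch u x"
      using new_new[OF assms(1) yB 2(1)] by blast
    obtain u' r' x' where u': "C u' r'" "C u' x'" "T (hd u') r' x'" "y = ch u' r'" "z' = ch u' x'"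
      using new_new[OF assms(2) yB 2(2)] by blast
    have r: "r = r'" "Q r u u'" using child_eq_iff[OF u(1) u'(1)] u u' by auto
    have x: "x = x'" using assms(3) u u' by simp
    show ?thesis
    proof (cases "u = u'")
      case False
      then have "T (hd u) (hd u') x"
        using no_empty_3[of r "hd u" "hd u'" x] Q_T(1)[OF r(2)] u(3) u'(3) r(1) x by (auto simp: T_ac)
      then have "Q x u u'" using free_spread(2)[OF u(2)] Q_T(2)[OF r(2) False] by blast
      then show ?thesis using child_eq_iff[OF u(2) u'(2)] u u' x by simp
    qed (use u u' x in simp)
  qed
qed

text \<open>
  Two new vertices over \<open>x\<close> and \<open>x'\<close> that are adjacent to the same new
  vertex over \<open>r\<close>, each through a parent of its own, have a parent in common as soon as
  \<open>r\<close>, \<open>x\<close> and \<open>x'\<close> span a triangle: the two parents,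
  \<open>x'\<close> and \<open>x\<close> form a cycle of length four in the link of
  \<open>r\<close>, and either of its diagonals makes one of the parents serve for all three.
\<close>

lemma common_parent:
  assumes "C u1 r" "C u1 x" "T (hd u1) r x" "C u2 r" "C u2 x'" "T (hd u2) r x'" "T r x x'" "Q r u1 u2"
  shows "\<exists>u. Q r u1 u \<and> Q x u1 u \<and> Q x' u2 u \<and> T (hd u) x x'"
proof (cases "u1 = u2")
  case True
  then have "T (hd u1) x x'" using no_empty_3[of r "hd u1" x x'] assms by (auto simp: T_ac)
  then show ?thesis using assms True Q_refl by blast
next
  case False
  note A = Q_T(2)[OF assms(8) False] and t = Q_T(1)[OF assms(8) False]
  have "hd u1 \<noteq> x'" using assms(5) bD(5)[OF A] unfolding free_def by blast
  moreover have "hd u2 \<noteq> x" using assms(2) A unfolding free_def by blast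
  ultimately have "T r (hd u1) x' \<or> T r (hd u2) x"
    using no_empty_4[of r "hd u1" "hd u2" x' x] assms t by (auto simp: T_ac)
  then show ?thesis
  proof
    assume h: "T r (hd u1) x'"
    have "T (hd u1) (hd u2) x'"
      using no_empty_3[of r "hd u1" "hd u2" x'] h t assms(6) by (auto simp: T_ac)
    then have "Q x' u2 u1" using free_spread(2)[OF assms(5) bD(5)[OF A]] by (auto simp: T_ac)
    moreover have "T (hd u1) x x'" using no_empty_3[of r "hd u1" x x'] h assms by (auto simp: T_ac)
    ultimately show ?thesis using Q_refl assms by blast
  next
    assume h: "T r (hd u2) x"
    have "T (hd u1) (hd u2) x"
      using no_empty_3[of r "hd u1" "hd u2" x] h t assms(3) by (auto simp: T_ac)
    then have "Q x u1 u2" using free_spread(2)[OF assms(2) A] by (auto simp: T_ac)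
    moreover have "T (hd u2) x x'" using no_empty_3[of r "hd u2" x x'] h assms by (auto simp: T_ac)
    ultimately show ?thesis using Q_refl assms by blast
  qed
qed

text \<open>
  If three new vertices are pairwise adjacent, each pair through a parent of its own, then the three
  parents are pairwise adjacent, and a cycle of length four in the link of the first parent produces
  one parent of all three. The triangle below then lies in the link of that parent.
\<close>

lemma siblings_span:
  assumes "C u1 r" "C u1 x" "T (hd u1) r x" "C u2 r" "C u2 x'" "T (hd u2) r x'"
    "C u3 x" "C u3 x'" "T (hd u3) x x'" "Q r u1 u2" "Q x u1 u3" "Q x' u2 u3"
  shows "T r x x'"
proof -
  have one: "T r x x'" if "T (hd u) r x" "T (hd u) r x'" "T (hd u) x x'" for u
    using no_empty_3[of "hd u" r x x'] that by (auto simp: T_ac)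
  have Qm: "Q y v u1 \<Longrightarrow> Q y v u2 \<Longrightarrow> Q y u1 u2" for y v using Q_sym Q_trans by blast
  consider "u1 = u2" | "u1 = u3" | "u2 = u3" | "u1 \<noteq> u2" "u1 \<noteq> u3" "u2 \<noteq> u3" by blast
  then show ?thesis
  proof cases
    case 1
    then have "T (hd u1) x x'" using T_move[OF assms(9)] Q_sym assms by blast
    then show ?thesis using one assms 1 by blast
  next
    case 2
    then have "T (hd u1) r x'" using T_move[OF assms(6)] Q_sym assms by blast
    then show ?thesis using one assms 2 by blast
  next
    case 3
    then have "T (hd u2) r x" using T_move[OF assms(3)] Q_sym assms by blast
    then show ?thesis using one assms 3 by blast
  next
    case 4
    note t12 = Q_T(1)[OF assms(10) 4(1)] and t13 = Q_T(1)[OF assms(11) 4(2)] and t23 = Q_T(1)[OF assms(12) 4(3)]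
    note A12 = Q_T(2)[OF assms(10) 4(1)] and A13 = Q_T(2)[OF assms(11) 4(2)] and A23 = Q_T(2)[OF assms(12) 4(3)]
    have tt: "T (hd u1) (hd u2) (hd u3)" using bD(9)[OF A12 A13] A23 by blast
    have "hd u2 \<noteq> x" using assms(2) A12 unfolding free_def by blast
    moreover have "hd u3 \<noteq> r" using assms(1) A13 unfolding free_def by blast
    ultimately have "T (hd u1) (hd u2) x \<or> T (hd u1) r (hd u3)"
      using no_empty_4[of "hd u1" "hd u2" r x "hd u3"] t12 t13 tt assms(3) by (auto simp: T_ac)
    then show ?thesis
    proof
      assume h: "T (hd u1) (hd u2) x"
      then have q: "Q x u1 u2" using free_spread(2)[OF assms(2) A12] by blast
      have "T (hd u2) r x" using T_move[OF assms(3) assms(10) q] .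
      moreover have "Q x u3 u2" using q assms(11) Q_sym Q_trans by blast
      then have "T (hd u2) x x'" using T_move[OF assms(9)] Q_sym assms(12) by blast
      ultimately show ?thesis using one assms by blast
    next
      assume "T (hd u1) r (hd u3)"
      then have q: "Q r u1 u3" using free_spread(2)[OF assms(1) A13] by (auto simp: T_ac)
      have "T (hd u3) r x" using T_move[OF assms(3) q assms(11)] .
      moreover have "Q r u2 u3" using q assms(10) Q_sym Q_trans by blast
      then have "T (hd u3) r x'" using T_move[OF assms(6)] assms(12) by blast
      ultimately show ?thesis using one assms by blast
    qed
  qed
qed

text \<open>
  The case distinction is on which of the three vertices are new. If all are,
  \<open>common_parent\<close> and \<open>siblings_span\<close> are the two directions.
\<close>

lemma A'_T: assumes "A' y z" "A' y z'" shows "A' z z' \<longleftrightarrow> T (hd y) (hd z) (hd z')"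
proof -
  have mixed: "A' z z' \<longleftrightarrow> T (hd y) (hd z) (hd z')" if yz: "A' y z" "A' y z'" "z \<in> B" "z' \<notin> B" for z z'
  proof (cases "y \<in> B")
    case True
    then obtain x where x: "C y x" "z' = ch y x" using old_new yz by blast
    have A: "A y z" using that old_old True by blast
    have "A' z z' \<longleftrightarrow> Q x y z" using child_adj_iff x that by blast
    then show ?thesis using free_spread(2)[OF x(1) A] Q_T(1)[of x y z] x A bD(6) E_neq by fastforce
  next
    case False
    obtain r where r: "C z r" "y = ch z r" using new_old[OF yz(1) False yz(3)] by blast
    obtain u r' x where u: "C u r'" "C u x" "T (hd u) r' x" "y = ch u r'" "z' = ch u x"
      using new_new[OF yz(2) False yz(4)] by blast
    have q: "r' = r" "Q r u z" using child_eq_iff[OF u(1) r(1)] u r by auto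
    have "A' z z' \<longleftrightarrow> Q x u z" using child_adj_iff u yz by blast
    also have "\<dots> \<longleftrightarrow> T (hd z) r x"
    proof
      show "Q x u z \<Longrightarrow> T (hd z) r x" using T_move u q by blast
      assume h: "T (hd z) r x"
      show "Q x u z"
      proof (cases "u = z")
        case False
        have "T (hd u) (hd z) x"
          using no_empty_3[of r "hd u" "hd z" x] Q_T(1)[OF q(2) False] h u(3) q(1) by (auto simp: T_ac)
        then show ?thesis using free_spread(2)[OF u(2) Q_T(2)[OF q(2) False]] by blast
      qed (use u Q_refl in blast)
    qed
    finally show ?thesis using r u by (auto simp: T_ac)
  qed
  consider "z \<in> B" "z' \<in> B" | "z \<in> B" "z' \<notin> B" | "z \<notin> B" "z' \<in> B" | "z \<notin> B" "z' \<notin> B" by blast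
  then show ?thesis
  proof cases
    case 1
    show ?thesis
    proof (cases "y \<in> B")
      case True then show ?thesis using 1 assms old_old bD(9) by metis
    next
      case False
      obtain x x' where x: "C z x" "y = ch z x" "C z' x'" "y = ch z' x'"
        using new_old[OF assms(1) False 1(1)] new_old[OF assms(2) False 1(2)] by blast
      have q: "Q x z z'" using child_eq_iff[OF x(1,3)] x by metis
      have y: "hd y = x" using x(2) by simp
      show ?thesis
      proof (cases "z = z'")
        case True
        have "\<not> A z z" "\<not> T x (hd z) (hd z)" using bD(6) E_irrefl T_edges(2) by blast+
        then show ?thesis using True y old_old[OF 1] by metis
      next
        case False
        have "T x (hd z) (hd z')" "A z z'" using Q_T[OF q False] by (auto simp: T_ac)
        then show ?thesis using y old_old[OF 1] by metis
      qed
    qed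
  next
    case 2 then show ?thesis using mixed assms by blast
  next
    case 3 then show ?thesis using mixed[OF assms(2,1)] A'_sym by (auto simp: T_ac)
  next
    case 4
    show ?thesis
    proof (cases "y \<in> B")
      case True
      obtain x x' where x: "C y x" "z = ch y x" "C y x'" "z' = ch y x'"
        using old_new[OF assms(1) True 4(1)] old_new[OF assms(2) True 4(2)] by blast
      have "T (hd y) x x'" if h: "A' z z'"
      proof -
        obtain u s s' where u: "C u s" "C u s'" "T (hd u) s s'" "z = ch u s" "z' = ch u s'"
          using new_new[OF h 4] by blast
        have "s = x" "s' = x'" "Q s u y" "Q s' u y"
          using child_eq_iff[OF u(1) x(1)] child_eq_iff[OF u(2) x(3)] u x by auto
        then show ?thesis using T_move u by blast
      qed
      then show ?thesis using sibling_adj x by auto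
    next
      case False
      obtain u1 r x where u1: "C u1 r" "C u1 x" "T (hd u1) r x" "y = ch u1 r" "z = ch u1 x"
        using new_new[OF assms(1) False 4(1)] by blast
      obtain u2 r' x' where u2: "C u2 r'" "C u2 x'" "T (hd u2) r' x'" "y = ch u2 r'" "z' = ch u2 x'"
        using new_new[OF assms(2) False 4(2)] by blast
      have r: "r' = r" "Q r u1 u2" using child_eq_iff[OF u1(1) u2(1)] u1 u2 by auto
      show ?thesis
      proof
        assume "A' z z'"
        then obtain u3 s s' where u3: "C u3 s" "C u3 s'" "T (hd u3) s s'" "z = ch u3 s" "z' = ch u3 s'"
          using new_new[OF _ 4] by blast
        have s: "s = x" "s' = x'" "Q x u1 u3" "Q x' u2 u3"
          using child_eq_iff[OF u1(2) u3(1)] child_eq_iff[OF u2(2) u3(2)] u1 u2 u3 by auto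
        have "T r x x'" using siblings_span[OF u1(1-3) _ u2(2)] u2(1,3) u3(1-3) r s by blast
        then show "T (hd y) (hd z) (hd z')" using u1 u2 by simp
      next
        assume "T (hd y) (hd z) (hd z')"
        then have "T r x x'" using u1 u2 by simp
        then obtain u where u: "Q x u1 u" "Q x' u2 u" "T (hd u) x x'"
          using common_parent[OF u1(1-3) _ u2(2)] u2(1,3) r by blast
        have "z = ch u x" "z' = ch u x'"
          using child_eq_iff u1 u2 u Q_free by metis+
        then show "A' z z'" using sibling_adj u Q_free by blast
      qed
    qed
  qed
qed

lemma next_ball: "developed_ball E T (Suc n) B' A'"
proof unfold_locales
  fix w assume w: "w \<in> B'"
  then show "1 \<le> length w" "length w \<le> Suc (Suc n)"
    using bD(1,2) child_len by (elim B'_cases; force)+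
  show "\<exists>u. A' w u \<and> length w = Suc (length u)" if l: "2 \<le> length w"
  proof (cases rule: B'_cases[OF w])
    case 1
    then show ?thesis using bD(12)[OF 1 l] old_old bD(4) by metis
  next
    case (2 v x)
    then show ?thesis using child_adj(2)[OF 2(1)] child_len[OF 2(1)] unfolding free_def by auto
  qed
  fix x assume l: "length w \<le> Suc n" and x: "E (hd w) x"
  have wB: "w \<in> B" using w l child_len by (elim B'_cases) auto
  show "\<exists>z. A' w z \<and> hd z = x"
  proof (cases "\<exists>z. A w z \<and> hd z = x")
    case True then show ?thesis using old_old wB bD(4) by metis
  next
    case False
    then have "\<not> length w \<le> n" using bD(10)[OF wB _ x] by blast
    then have "length w = Suc n" using l by simp
    then have "C w x" using False wB x unfolding free_def by blast
    then show ?thesis using child_adj hd_child by blast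
  qed
next
  fix w z assume a: "A' w z"
  show "w \<in> B'" "z \<in> B'" "A' z w" "E (hd w) (hd z)" "length w \<le> Suc (length z)"
    using A'_verts[OF a] A'_sym[OF a] A'_E[OF a] by blast+
  show "\<exists>u. A' w u \<and> A' z u \<and> length w = Suc (length u)" if l: "length w = length z"
  proof -
    have iff: "v \<in> B \<longleftrightarrow> length v \<le> Suc n" if "v \<in> B'" for v
      using that bD(2) child_len by (elim B'_cases) auto
    consider "w \<in> B" "z \<in> B" | "w \<notin> B" "z \<notin> B" using iff A'_verts[OF a] l by auto
    then show ?thesis
    proof cases
      case 1
      then show ?thesis using bD(13)[of w z] a l old_old bD(4) by metis
    next
      case 2
      then obtain u x x' where u: "C u x" "C u x'" "w = ch u x" "z = ch u x'" using new_new[OF a] by blast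
      then show ?thesis using A'_sym child_adj child_len unfolding free_def by metis
    qed
  qed
next
  fix w z z' assume "A' w z" "A' w z'"
  then show "A' z z' = T (hd w) (hd z) (hd z')" by (rule A'_T)
next
  fix w z z' assume "A' w z" "A' w z'" "hd z = hd z'"
  then show "z = z'" by (rule A'_inj)
next
  fix w u u' assume a: "A' w u" "A' w u'" "length w = Suc (length u)" "length w = Suc (length u')"
  have len: "length v \<le> Suc (Suc n)" if "v \<in> B'" for v
    using that bD(2) child_len by (elim B'_cases) fastforce+
  have uB: "v \<in> B" if "A' w v" "length w = Suc (length v)" for v
    using len A'_verts[OF that(1)] that(2) child_len by (metis B'_cases Suc_n_not_le_n)
  show "u = u' \<or> A' u u'"
  proof (cases "w \<in> B")
    case True
    then show ?thesis using a uB old_old bD(11) by metis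
  next
    case False
    obtain x x' where x: "C u x" "w = ch u x" "C u' x'" "w = ch u' x'"
      using new_old[OF a(1) False uB[OF a(1,3)]] new_old[OF a(2) False uB[OF a(2,4)]] by blast
    then have "Q x u u'" using child_eq_iff[OF x(1,3)] by metis
    then show ?thesis using Q_T(2) old_old uB a by blast
  qed
qed

end

section \<open>The developed cover and path lifting\<close>

lemma (in six_large_links) base_ball: "developed_ball E T 0 {[v]} (\<lambda>_ _. False)"
  by unfold_locales auto

context six_large_links
begin

primrec stage :: "'v \<Rightarrow> nat \<Rightarrow> 'v list set \<times> ('v list \<Rightarrow> 'v list \<Rightarrow> bool)" where
  "stage v 0 = ({[v]}, \<lambda>_ _. False)"
| "stage v (Suc n) = (developed_ball.next_verts E T n (fst (stage v n)) (snd (stage v n)),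
     developed_ball.next_adj E T n (fst (stage v n)) (snd (stage v n)))"

lemma stage_ball: "developed_ball E T n (fst (stage v n)) (snd (stage v n))"
proof (induction n)
  case 0 show ?case using base_ball by simp
next
  case (Suc n) then show ?case using developed_ball.next_ball by fastforce
qed

definition cover_vert where "cover_vert v w \<longleftrightarrow> (\<exists>n. w \<in> fst (stage v n))"
definition cover_adj where "cover_adj v w z \<longleftrightarrow> (\<exists>n. snd (stage v n) w z)"

text \<open>
  A new vertex is a list longer than every old one, so a stage can be recovered from any later one
  by length; this is what makes the union over all stages inherit the properties of the stages.
\<close>

lemma stage_mono:
  assumes "k \<le> n"
  shows "fst (stage v k) \<subseteq> fst (stage v n)"
    and "w \<in> fst (stage v k) \<Longrightarrow> z \<in> fst (stage v k) \<Longrightarrow> snd (stage v n) w z \<longleftrightarrow> snd (stage v k) w z"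
    and "w \<in> fst (stage v n) \<Longrightarrow> length w \<le> Suc k \<Longrightarrow> w \<in> fst (stage v k)"
proof -
  have "fst (stage v k) \<subseteq> fst (stage v n) \<and>
    (\<forall>w z. w \<in> fst (stage v k) \<longrightarrow> z \<in> fst (stage v k) \<longrightarrow> snd (stage v n) w z \<longleftrightarrow> snd (stage v k) w z) \<and>
    (\<forall>w\<in>fst (stage v n). length w \<le> Suc k \<longrightarrow> w \<in> fst (stage v k))"
    using assms
  proof (induction n rule: dec_induct)
    case (step n)
    interpret developed_ball E T n "fst (stage v n)" "snd (stage v n)" by (rule stage_ball)
    have 1: "fst (stage v n) \<subseteq> fst (stage v (Suc n))" by (simp add: next_verts_def)
    have 2: "w \<in> fst (stage v n)" if "w \<in> fst (stage v (Suc n))" "length w \<le> Suc k" for w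
    proof -
      have "w \<in> next_verts" using that by simp
      then show ?thesis using child_len that(2) step.hyps by (cases rule: B'_cases) auto
    qed
    have 3: "snd (stage v (Suc n)) w z \<longleftrightarrow> snd (stage v n) w z"
      if "w \<in> fst (stage v n)" "z \<in> fst (stage v n)" for w z
      using old_old[OF that] by simp
    show ?case using step.IH 1 2 3 by (meson subset_iff)
  qed auto
  then show "fst (stage v k) \<subseteq> fst (stage v n)"
    "w \<in> fst (stage v k) \<Longrightarrow> z \<in> fst (stage v k) \<Longrightarrow> snd (stage v n) w z \<longleftrightarrow> snd (stage v k) w z"
    "w \<in> fst (stage v n) \<Longrightarrow> length w \<le> Suc k \<Longrightarrow> w \<in> fst (stage v k)" by blast+
qed

lemma cover_adj_stage: assumes "cover_adj v w z"
  shows "\<exists>k. \<forall>n\<ge>k. snd (stage v n) w z \<and> w \<in> fst (stage v n) \<and> z \<in> fst (stage v n)"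
proof -
  obtain k where k: "snd (stage v k) w z" using assms unfolding cover_adj_def by blast
  have v: "w \<in> fst (stage v k)" "z \<in> fst (stage v k)"
    using developed_ball.adj_left[OF stage_ball k] developed_ball.adj_right[OF stage_ball k] by auto
  have "snd (stage v n) w z \<and> w \<in> fst (stage v n) \<and> z \<in> fst (stage v n)" if "k \<le> n" for n
    using stage_mono(1,2)[OF that] k v by blast
  then show ?thesis by blast
qed

lemma cover_adj_iff: assumes "w \<in> fst (stage v n)" "z \<in> fst (stage v n)"
  shows "cover_adj v w z \<longleftrightarrow> snd (stage v n) w z"
proof
  assume "cover_adj v w z"
  then obtain k where "\<forall>n\<ge>k. snd (stage v n) w z" using cover_adj_stage by metis
  then have "snd (stage v (max k n)) w z" by simp
  then show "snd (stage v n) w z" using stage_mono(2)[of n "max k n"] assms by simp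
qed (auto simp: cover_adj_def)

lemma cover_vert_stage: assumes "cover_vert v w" "length w \<le> Suc n" shows "w \<in> fst (stage v n)"
proof -
  obtain k where "w \<in> fst (stage v k)" using assms unfolding cover_vert_def by blast
  then have "w \<in> fst (stage v (max k n))" using stage_mono(1)[of k "max k n"] by auto
  then show ?thesis using stage_mono(3)[of n "max k n"] assms by simp
qed

lemma cover_root: "cover_vert v [v]" unfolding cover_vert_def by (rule exI[of _ 0]) simp

lemma cover_root_unique: "cover_vert v w \<Longrightarrow> length w = 1 \<Longrightarrow> w = [v]"
  using cover_vert_stage[of v w 0] by simp

lemma cover_len: "cover_vert v w \<Longrightarrow> 1 \<le> length w"
  unfolding cover_vert_def using developed_ball.len_pos[OF stage_ball] by blast

lemma cover_sym: "cover_adj v w z \<Longrightarrow> cover_adj v z w"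
  unfolding cover_adj_def using developed_ball.adj_sym[OF stage_ball] by blast

lemma cover_edge: "cover_adj v w z \<Longrightarrow> E (hd w) (hd z)"
  unfolding cover_adj_def using developed_ball.adj_edge[OF stage_ball] by blast

lemma cover_verts: "cover_adj v w z \<Longrightarrow> cover_vert v w \<and> cover_vert v z"
  unfolding cover_adj_def cover_vert_def
  using developed_ball.adj_left[OF stage_ball] developed_ball.adj_right[OF stage_ball] by blast

lemma cover_adj_len: "cover_adj v w z \<Longrightarrow> length w \<le> Suc (length z)"
  unfolding cover_adj_def using developed_ball.adj_len[OF stage_ball] by blast

lemma cover_two: assumes "cover_adj v w z" "cover_adj v w z'"
  obtains n where "snd (stage v n) w z" "snd (stage v n) w z'"
    "w \<in> fst (stage v n)" "z \<in> fst (stage v n)" "z' \<in> fst (stage v n)"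
proof -
  obtain k k' where "\<forall>n\<ge>k. snd (stage v n) w z \<and> w \<in> fst (stage v n) \<and> z \<in> fst (stage v n)"
    "\<forall>n\<ge>k'. snd (stage v n) w z' \<and> w \<in> fst (stage v n) \<and> z' \<in> fst (stage v n)"
    using cover_adj_stage[OF assms(1)] cover_adj_stage[OF assms(2)] by blast
  then show thesis using that[of "max k k'"] by simp
qed

lemma cover_inj: assumes "cover_adj v w z" "cover_adj v w z'" "hd z = hd z'" shows "z = z'"
  using cover_two[OF assms(1,2)] developed_ball.adj_inj[OF stage_ball] assms(3) by metis

lemma cover_triangle: assumes "cover_adj v w z" "cover_adj v w z'"
  shows "cover_adj v z z' \<longleftrightarrow> T (hd w) (hd z) (hd z')"
  using cover_two[OF assms] developed_ball.adj_triangle[OF stage_ball] cover_adj_iff by metis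

lemma cover_lift: assumes "cover_vert v w" "E (hd w) x" shows "\<exists>z. cover_adj v w z \<and> hd z = x"
  using cover_vert_stage[OF assms(1), of "length w"] developed_ball.adj_lift[OF stage_ball _ _ assms(2)]
  unfolding cover_adj_def by (metis le_Suc_eq le_refl)

lemma cover_parents: assumes "cover_adj v w u" "cover_adj v w u'" "length w = Suc (length u)" "length w = Suc (length u')"
  shows "u = u' \<or> cover_adj v u u'"
  using cover_two[OF assms(1,2)] developed_ball.parents_adj[OF stage_ball] cover_adj_iff assms(3,4) by metis

lemma cover_parent: assumes "cover_vert v w" "2 \<le> length w"
  shows "\<exists>u. cover_adj v w u \<and> length w = Suc (length u)"
  using assms developed_ball.parent_ex[OF stage_ball] unfolding cover_vert_def cover_adj_def by blast

lemma cover_common: assumes "cover_adj v w w'" "length w = length w'"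
  shows "\<exists>u. cover_adj v w u \<and> cover_adj v w' u \<and> length w = Suc (length u)"
  using assms developed_ball.common_parent_ex[OF stage_ball] unfolding cover_adj_def by blast

text \<open>
  Paths may pause at a vertex. This makes the set of paths closed under the elementary moves of
  edge-path homotopy.
\<close>

inductive lifts :: "'v \<Rightarrow> 'v list \<Rightarrow> 'v list \<Rightarrow> 'v list \<Rightarrow> bool" for v where
  single: "hd w = a \<Longrightarrow> lifts v w [a] w"
| step: "hd w = a \<Longrightarrow> w = z \<or> cover_adj v w z \<Longrightarrow> lifts v z p w' \<Longrightarrow> lifts v w (a # p) w'"

lemma lifts_hd: "lifts v w p w' \<Longrightarrow> p \<noteq> [] \<and> hd p = hd w"
  by (induction rule: lifts.induct) auto

lemma lifts_Cons: "lifts v w (a # b # p) w' \<longleftrightarrow>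
    hd w = a \<and> (\<exists>z. (w = z \<or> cover_adj v w z) \<and> hd z = b \<and> lifts v z (b # p) w')"
  (is "?l \<longleftrightarrow> ?r")
proof
  assume ?l
  then show ?r
  proof cases
    case (step z) then show ?thesis using lifts_hd[OF step(3)] by auto
  qed
qed (auto intro: lifts.step)

lemma lifts_single: "lifts v w [a] w' \<longleftrightarrow> hd w = a \<and> w = w'"
  by (auto intro: lifts.single elim: lifts.cases dest: lifts_hd)

lemma lifts_unique: "lifts v w p w1 \<Longrightarrow> lifts v w p w2 \<Longrightarrow> w1 = w2"
proof (induction arbitrary: w2 rule: lifts.induct)
  case (single w a) then show ?case by (simp add: lifts_single)
next
  case (step w a z p w')
  obtain b q where p: "p = b # q" "hd z = b" using lifts_hd[OF step(3)] by (cases p) auto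
  obtain z' where z': "w = z' \<or> cover_adj v w z'" "hd z' = b" "lifts v z' (b # q) w2"
    using step.prems unfolding p lifts_Cons by blast
  have "z = z'" using step(2) z' p(2) cover_inj cover_edge E_irrefl by metis
  then show ?case using step.IH z' p by blast
qed

lemma lifts_snoc: "lifts v w p u \<Longrightarrow> cover_adj v u w' \<Longrightarrow> lifts v w (p @ [hd w']) w'"
  by (induction rule: lifts.induct) (auto intro: lifts.intros)

definition walk where "walk p \<longleftrightarrow> p \<noteq> [] \<and> successively (\<lambda>a b. a = b \<or> E a b) p"

lemma lifts_walk: "lifts v w p w' \<Longrightarrow> walk p \<and> last p = hd w'"
proof (induction rule: lifts.induct)
  case (step w a z p w')
  obtain b q where p: "p = b # q" "hd z = b" using lifts_hd[OF step(3)] by (cases p) auto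
  then show ?case using step cover_edge[of v w z] by (auto simp: walk_def)
qed (simp add: walk_def)

lemma cover_reachable: "cover_vert v w \<Longrightarrow> \<exists>p. lifts v [v] p w"
proof (induction "length w" arbitrary: w rule: less_induct)
  case less
  show ?case
  proof (cases "length w = 1")
    case True
    then show ?thesis using cover_root_unique less.prems lifts.single by metis
  next
    case False
    then obtain u where u: "cover_adj v w u" "length w = Suc (length u)"
      using cover_parent[OF less.prems] cover_len[OF less.prems] by force
    then obtain p where "lifts v [v] p u" using less.hyps[of u] cover_verts by auto
    then show ?thesis using lifts_snoc cover_sym[OF u(1)] by blast
  qed
qed

text \<open>
  The end point of a lift does not notice an elementary homotopy across a triangle, because
  triangles lift. Hence two edge-homotopic paths with the same starting point have lifts with the
  same end, and over an edge-simply connected complex the developed cover is the complex itself.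
\<close>

lemma lifts_shortcut:
  assumes "a = b \<or> b = c \<or> a = c \<and> E a b \<or> T a b c" and vert: "cover_vert v w"
  shows "lifts v w (a # b # c # p) w' \<longleftrightarrow> lifts v w (a # c # p) w'"
proof
  assume "lifts v w (a # b # c # p) w'"
  then obtain z1 z2 where z: "hd w = a" "w = z1 \<or> cover_adj v w z1" "hd z1 = b"
    "z1 = z2 \<or> cover_adj v z1 z2" "hd z2 = c" "lifts v z2 (c # p) w'"
    unfolding lifts_Cons by blast
  have "w = z2 \<or> cover_adj v w z2"
    using assms(1)
  proof (elim disjE conjE)
    assume "a = b" then have "w = z1" using z cover_edge E_irrefl by metis
    then show ?thesis using z by blast
  next
    assume "b = c" then have "z1 = z2" using z cover_edge E_irrefl by metis
    then show ?thesis using z by blast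
  next
    assume "a = c" "E a b" then show ?thesis using z cover_inj[of v z1 w z2] cover_sym E_irrefl by metis
  next
    assume t: "T a b c"
    then have "cover_adj v z1 w" "cover_adj v z1 z2" using z T_edges E_irrefl cover_sym by metis+
    then show ?thesis using cover_triangle[of v z1 w z2] z t T_perm by metis
  qed
  then show "lifts v w (a # c # p) w'" unfolding lifts_Cons using z by blast
next
  assume "lifts v w (a # c # p) w'"
  then obtain z2 where z: "hd w = a" "w = z2 \<or> cover_adj v w z2" "hd z2 = c" "lifts v z2 (c # p) w'"
    unfolding lifts_Cons by blast
  have "\<exists>z1. (w = z1 \<or> cover_adj v w z1) \<and> hd z1 = b \<and> (z1 = z2 \<or> cover_adj v z1 z2)"
    using assms(1)
  proof (elim disjE conjE)
    assume h: "a = c" "E a b"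
    have "w = z2" using z h cover_edge E_irrefl by metis
    then show ?thesis using cover_lift[OF vert, of b] z h cover_sym by metis
  next
    assume t: "T a b c"
    have w2: "cover_adj v w z2" using z t T_edges E_irrefl by metis
    obtain z1 where z1: "cover_adj v w z1" "hd z1 = b" using cover_lift[OF vert, of b] z t T_edges by metis
    have "cover_adj v z1 z2" using cover_triangle[OF z1(1) w2] z z1 t by metis
    then show ?thesis using z1 by blast
  qed (use z in metis)+
  then show "lifts v w (a # b # c # p) w'" unfolding lifts_Cons using z by blast
qed

lemma lifts_dup: "lifts v w (a # a # p) w' \<longleftrightarrow> lifts v w (a # p) w'"
proof
  assume "lifts v w (a # a # p) w'"
  then obtain z where z: "hd w = a" "w = z \<or> cover_adj v w z" "hd z = a" "lifts v z (a # p) w'"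
    unfolding lifts_Cons by blast
  then have "w = z" using cover_edge E_irrefl by metis
  then show "lifts v w (a # p) w'" using z by simp
next
  assume "lifts v w (a # p) w'"
  then show "lifts v w (a # a # p) w'" unfolding lifts_Cons using lifts_hd by force
qed

lemma lifts_Cons_cong:
  assumes "\<And>z w'. cover_vert v z \<Longrightarrow> lifts v z p w' \<longleftrightarrow> lifts v z q w'" "p = [] \<longleftrightarrow> q = []" "cover_vert v w"
  shows "lifts v w (a # p) w' \<longleftrightarrow> lifts v w (a # q) w'"
proof -
  have *: "lifts v w (a # q) w'" if h: "lifts v w (a # p) w'" and eq: "\<And>z w'. cover_vert v z \<Longrightarrow> lifts v z p w' \<Longrightarrow> lifts v z q w'"
    and "p = [] \<longleftrightarrow> q = []" for p q
    using h
  proof cases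
    case single then show ?thesis using that lifts.single by simp
  next
    case (step z)
    have "cover_vert v z" using step(2) cover_verts assms(3) by blast
    then show ?thesis using lifts.step[OF step(1,2)] eq step(3) by blast
  qed
  show ?thesis using *[of p q] *[of q p] assms by blast
qed

text \<open>The assumption holds for edge-simply connected complexes. Under it, distances in
  the cover are distances in the complex, and short cycles through the base vertex can be read off
  the spheres around it.\<close>
context
  fixes v
  assumes inj: "\<And>w w'. cover_vert v w \<Longrightarrow> cover_vert v w' \<Longrightarrow> hd w = hd w' \<Longrightarrow> w = w'"
begin

lemma cover_adj_iff_edge: assumes "cover_vert v w" "cover_vert v z" shows "cover_adj v w z \<longleftrightarrow> E (hd w) (hd z)"
  using cover_edge cover_lift[OF assms(1)] inj cover_verts assms by metis

lemma cover_nbr: assumes "cover_vert v w" "E (hd w) x" obtains z where "cover_vert v z" "hd z = x" "cover_adj v w z"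
  using cover_lift[OF assms] cover_verts by blast

lemma three_cycle: assumes "E v a" "E a b" "E b v" shows "T v a b"
proof -
  obtain wa where a: "cover_vert v wa" "hd wa = a" "cover_adj v [v] wa"
    using cover_nbr[OF cover_root] assms by auto
  obtain wb where b: "cover_vert v wb" "hd wb = b" "cover_adj v wa wb" using cover_nbr[OF a(1)] a assms by auto
  have "cover_adj v [v] wb" using cover_adj_iff_edge[OF cover_root b(1)] b assms E_sym by simp
  then show ?thesis using cover_triangle[OF a(3)] a b by simp
qed

lemma root_nbr: assumes "E v x" obtains z where "cover_vert v z" "hd z = x" "cover_adj v [v] z" "length z = 2"
proof -
  obtain z where z: "cover_vert v z" "hd z = x" "cover_adj v [v] z"
    using cover_nbr[OF cover_root] assms by auto
  have "length z \<noteq> 1" using cover_root_unique[OF z(1)] z assms E_irrefl by force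
  then have "length z = 2" using cover_adj_len[OF cover_sym[OF z(3)]] cover_len[OF z(1)] by simp
  then show thesis using that z by blast
qed

lemma second_nbr: assumes "cover_vert v z" "length z = 2" "cover_adj v z y" "hd y \<noteq> v" "\<not> E v (hd y)" shows "length y = 3"
proof -
  have y: "cover_vert v y" using cover_verts assms by blast
  have "length y \<noteq> 1" using cover_root_unique[OF y] assms(4) by force
  moreover have "length y \<noteq> 2"
  proof
    assume 2: "length y = 2"
    obtain u where u: "cover_adj v y u" "length y = Suc (length u)" using cover_parent[OF y] 2 by auto
    then have "u = [v]" using cover_root_unique 2 cover_verts by auto
    then show False using cover_edge[OF u(1)] assms(5) E_sym by simp
  qed
  moreover have "length y \<le> 3" using cover_adj_len[OF cover_sym[OF assms(3)]] assms(2) by simp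
  ultimately show ?thesis using cover_len[OF y] by linarith
qed

text \<open>
  If \<open>b\<close> is not a neighbour of \<open>v\<close>, it has distance two from
  \<open>v\<close> and \<open>a\<close>, \<open>c\<close> are parents of it; parents of the same
  vertex are adjacent.
\<close>

lemma four_cycle: assumes "E v a" "E a b" "E b c" "E c v" "v \<noteq> b" "a \<noteq> c" shows "E v b \<or> E a c"
proof (rule disjCI)
  assume n: "\<not> E a c"
  show "E v b"
  proof (rule ccontr)
    assume vb: "\<not> E v b"
    obtain wa where a: "cover_vert v wa" "hd wa = a" "cover_adj v [v] wa" "length wa = 2"
      using root_nbr assms by blast
    obtain wc where c: "cover_vert v wc" "hd wc = c" "cover_adj v [v] wc" "length wc = 2"
      using root_nbr assms E_sym by blast
    obtain wb where b: "cover_vert v wb" "hd wb = b" "cover_adj v wa wb" using cover_nbr[OF a(1)] a assms by auto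
    have l: "length wb = 3" using second_nbr[OF a(1,4) b(3)] b vb assms by blast
    have "cover_adj v wb wc" using cover_adj_iff_edge[OF b(1) c(1)] b c assms by simp
    then have "wa = wc \<or> cover_adj v wa wc" using cover_parents cover_sym[OF b(3)] l a c by simp
    then show False using n assms a c cover_edge by metis
  qed
qed

text \<open>
  If there is no diagonal, \<open>b\<close> and \<open>c\<close> are adjacent vertices at distance
  two from \<open>v\<close>. Their common parent is adjacent to all five vertices of the cycle, and
  its link has no full cycle of length five.
\<close>

lemma five_cycle:
  assumes "E v a" "E a b" "E b c" "E c d" "E d v" "distinct [v, a, b, c, d]"
  shows "E v b \<or> E a c \<or> E b d \<or> E c v \<or> E d a"
proof (rule ccontr)
  assume "\<not> (E v b \<or> E a c \<or> E b d \<or> E c v \<or> E d a)"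
  then have n: "\<not> E v b" "\<not> E a c" "\<not> E b d" "\<not> E v c" "\<not> E a d" using E_sym by blast+
  obtain wa where a: "cover_vert v wa" "hd wa = a" "cover_adj v [v] wa" "length wa = 2"
    using root_nbr assms by blast
  obtain wd where d: "cover_vert v wd" "hd wd = d" "cover_adj v [v] wd" "length wd = 2"
    using root_nbr assms E_sym by blast
  obtain wb where b: "cover_vert v wb" "hd wb = b" "cover_adj v wa wb" using cover_nbr[OF a(1)] a assms by auto
  obtain wc where c: "cover_vert v wc" "hd wc = c" "cover_adj v wd wc" using cover_nbr[OF d(1)] d E_sym[OF assms(4)] by metis
  have l: "length wb = 3" "length wc = 3"
    using second_nbr[OF a(1,4) b(3)] second_nbr[OF d(1,4) c(3)] b c n assms(6) by auto
  have bc: "cover_adj v wb wc" using cover_adj_iff_edge[OF b(1) c(1)] b c assms by simp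
  then obtain e where e: "cover_adj v wb e" "cover_adj v wc e" "length e = 2"
    using cover_common[OF bc] l by auto
  have ev: "cover_vert v e" using cover_verts e by blast
  obtain u where u: "cover_adj v e u" "length e = Suc (length u)" using cover_parent[OF ev] e by auto
  have re: "cover_adj v e [v]" using u e cover_root_unique[of v u] cover_verts by auto
  have "wa = e \<or> cover_adj v wa e" using cover_parents[OF cover_sym[OF b(3)] e(1)] l a e by simp
  moreover have "wa \<noteq> e" using cover_edge[OF e(2)] c n(2) a E_sym by metis
  ultimately have ea: "cover_adj v e wa" using cover_sym by blast
  have "wd = e \<or> cover_adj v wd e" using cover_parents[OF cover_sym[OF c(3)] e(2)] l d e by simp
  moreover have "wd \<noteq> e" using cover_edge[OF e(1)] b n(3) d by metis
  ultimately have ed: "cover_adj v e wd" using cover_sym by blast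
  note eb = cover_sym[OF e(1)] and ec = cover_sym[OF e(2)]
  have "T (hd e) v a" "T (hd e) a b" "T (hd e) b c" "T (hd e) c d" "T (hd e) d v"
    using cover_triangle[OF re ea] cover_triangle[OF ea eb] cover_triangle[OF eb ec] cover_triangle[OF ec ed]
      cover_triangle[OF ed re] a b c d bc cover_sym by auto
  then have "T (hd e) v b \<or> T (hd e) a c \<or> T (hd e) b d \<or> T (hd e) c v \<or> T (hd e) d a"
    using no_empty_5 assms(6) by blast
  then show False using n T_edges(2) E_sym by blast
qed

end

end

section \<open>From local to global largeness\<close>

definition edge :: "'v set set \<Rightarrow> 'v \<Rightarrow> 'v \<Rightarrow> bool" where
  "edge X a b \<longleftrightarrow> a \<noteq> b \<and> {a, b} \<in> X"

definition triangle :: "'v set set \<Rightarrow> 'v \<Rightarrow> 'v \<Rightarrow> 'v \<Rightarrow> bool" where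
  "triangle X a b c \<longleftrightarrow> distinct [a, b, c] \<and> {a, b, c} \<in> X"

definition edge_path :: "'v set set \<Rightarrow> 'v list \<Rightarrow> bool" where
  "edge_path X p \<longleftrightarrow> p \<noteq> [] \<and> {hd p} \<in> X \<and> successively (\<lambda>a b. {a, b} \<in> X) p"

text \<open>
  Edge-path homotopy. Repeated vertices are allowed in a path and a simplex \<open>{a, b, c}\<close>
  may be degenerate, so \<open>tri\<close> covers spurs and backtracking as well as triangles.
\<close>

inductive path_homotopic :: "'v set set \<Rightarrow> 'v list \<Rightarrow> 'v list \<Rightarrow> bool" for X where
  refl: "path_homotopic X p p"
| sym: "path_homotopic X p q \<Longrightarrow> path_homotopic X q p"
| trans: "path_homotopic X p q \<Longrightarrow> path_homotopic X q r \<Longrightarrow> path_homotopic X p r"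
| dup: "path_homotopic X (a # a # p) (a # p)"
| tri: "{a, b, c} \<in> X \<Longrightarrow> path_homotopic X (a # b # c # p) (a # c # p)"
| cons: "path_homotopic X p q \<Longrightarrow> path_homotopic X (a # p) (a # q)"

definition edge_simply_connected :: "'v set set \<Rightarrow> bool" where
  "edge_simply_connected X \<longleftrightarrow>
     (\<forall>x y. {x} \<in> X \<and> {y} \<in> X \<longrightarrow> (\<exists>p. edge_path X p \<and> hd p = x \<and> last p = y)) \<and>
     (\<forall>p q. edge_path X p \<and> edge_path X q \<and> hd p = hd q \<and> last p = last q \<longrightarrow> path_homotopic X p q)"

text \<open>
  The absence of full cycles of length three, four and five, phrased by edges and triangles only.
\<close>

definition six_large :: "'v set set \<Rightarrow> bool" where
  "six_large X \<longleftrightarrow>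
     (\<forall>a b c. edge X a b \<and> edge X b c \<and> edge X c a \<longrightarrow> {a, b, c} \<in> X) \<and>
     (\<forall>a b c d. edge X a b \<and> edge X b c \<and> edge X c d \<and> edge X d a \<and> a \<noteq> c \<and> b \<noteq> d \<longrightarrow>
        edge X a c \<or> edge X b d) \<and>
     (\<forall>a b c d e. edge X a b \<and> edge X b c \<and> edge X c d \<and> edge X d e \<and> edge X e a \<and> distinct [a, b, c, d, e] \<longrightarrow>
        edge X a c \<or> edge X b d \<or> edge X c e \<or> edge X d a \<or> edge X e b)"

lemma six_largeD:
  assumes "six_large X"
  shows "edge X a b \<Longrightarrow> edge X b c \<Longrightarrow> edge X c a \<Longrightarrow> {a, b, c} \<in> X"
    and "edge X a b \<Longrightarrow> edge X b c \<Longrightarrow> edge X c d \<Longrightarrow> edge X d a \<Longrightarrow> a \<noteq> c \<Longrightarrow> b \<noteq> d \<Longrightarrow>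
      edge X a c \<or> edge X b d"
    and "edge X a b \<Longrightarrow> edge X b c \<Longrightarrow> edge X c d \<Longrightarrow> edge X d e \<Longrightarrow> edge X e a \<Longrightarrow> distinct [a, b, c, d, e] \<Longrightarrow>
      edge X a c \<or> edge X b d \<or> edge X c e \<or> edge X d a \<or> edge X e b"
  using assms unfolding six_large_def by fast+

lemma face: "abstract_complex X \<Longrightarrow> \<sigma> \<in> X \<Longrightarrow> \<tau> \<subseteq> \<sigma> \<Longrightarrow> \<tau> \<noteq> {} \<Longrightarrow> \<tau> \<in> X"
  unfolding abstract_complex_def by blast

lemma link_edge: assumes "abstract_complex X" shows "edge (link X {v}) a b \<longleftrightarrow> triangle X v a b"
proof -
  have "{a, b} \<in> X" if "{v, a, b} \<in> X" using face[OF assms that] by blast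
  then show ?thesis unfolding edge_def triangle_def link_def by (auto simp: insert_commute)
qed

lemma six_large_links_complex:
  assumes X: "abstract_complex X" and L: "\<And>v. {v} \<in> X \<Longrightarrow> six_large (link X {v})"
  shows "six_large_links (edge X) (triangle X)"
proof
  show "edge X a b \<Longrightarrow> edge X b a" "\<not> edge X a a" for a b by (auto simp: edge_def insert_commute)
  show "triangle X a b c \<Longrightarrow> triangle X b a c" "triangle X a b c \<Longrightarrow> triangle X b c a" for a b c
    by (auto simp: triangle_def insert_commute)
  show "triangle X a b c \<Longrightarrow> edge X a b" for a b c
    using face[OF X, of "{a, b, c}" "{a, b}"] by (auto simp: triangle_def edge_def)
  have L': "six_large (link X {v})" if "triangle X v a b" for v a b
    using L face[OF X, of "{v, a, b}" "{v}"] that by (auto simp: triangle_def)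
  note E = link_edge[OF X]
  show "triangle X a b c" if "triangle X v a b" "triangle X v b c" "triangle X v c a" for v a b c
  proof -
    have "{a, b, c} \<in> link X {v}" using six_largeD(1)[OF L'[OF that(1)], of a b c] that by (simp add: E)
    then show ?thesis using that unfolding link_def triangle_def by auto
  qed
  show "triangle X v a c \<or> triangle X v b d"
    if "triangle X v a b" "triangle X v b c" "triangle X v c d" "triangle X v d a" "a \<noteq> c" "b \<noteq> d" for v a b c d
    using six_largeD(2)[OF L'[OF that(1)], of a b c d] that by (simp add: E)
  show "triangle X v a c \<or> triangle X v b d \<or> triangle X v c e \<or> triangle X v d a \<or> triangle X v e b"
    if "triangle X v a b" "triangle X v b c" "triangle X v c d" "triangle X v d e" "triangle X v e a"
      "distinct [a, b, c, d, e]" for v a b c d e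
    using six_largeD(3)[OF L'[OF that(1)], of a b c d e] that by (simp add: E)
qed

text \<open>
  The combinatorial Cartan--Hadamard theorem for systolic complexes: develop the complex from a
  vertex of the given cycle. Since edge-path homotopies lift, the development is injective, and the
  sphere conditions of \<open>developed_ball\<close> produce a diagonal of every short cycle.
\<close>

theorem six_large_local_to_global:
  assumes X: "abstract_complex X" and sc: "edge_simply_connected X"
    and L: "\<And>v. {v} \<in> X \<Longrightarrow> six_large (link X {v})"
  shows "six_large X"
proof -
  interpret six_large_links "edge X" "triangle X" by (rule six_large_links_complex[OF X L])
  have step: "a = b \<or> b = c \<or> a = c \<and> edge X a b \<or> triangle X a b c" if "{a, b, c} \<in> X" for a b c
    using that face[OF X that, of "{a, b}"] unfolding edge_def triangle_def by auto
  \<comment> \<open>The end point of a lift is an invariant of the edge-path homotopy class.\<close>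
  have hom: "(p = [] \<longleftrightarrow> q = []) \<and> (\<forall>w w'. cover_vert v w \<longrightarrow> lifts v w p w' = lifts v w q w')" if "path_homotopic X p q" for v p q
    using that
  proof (induction rule: path_homotopic.induct)
    case (dup a p) then show ?case using lifts_dup by simp
  next
    case (tri a b c p) then show ?case using lifts_shortcut[OF step[OF tri]] by simp
  next
    case (cons p q a) then show ?case using lifts_Cons_cong[of v p q] by simp
  qed auto
  have inj: "w = w'" if v: "{v} \<in> X" and w: "cover_vert v w" "cover_vert v w'" "hd w = hd w'" for v w w'
  proof -
    have ep: "edge_path X p" if "walk p" "hd p = v" for p
    proof -
      have e2: "{y} \<in> X" if "edge X x y" for x y
        using face[OF X, of "{x, y}" "{y}"] that by (auto simp: edge_def)
      have "successively (\<lambda>a b. {a, b} \<in> X) p" if "walk p" "{hd p} \<in> X" for p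
        using that
      proof (induction p)
        case (Cons a q)
        show ?case
        proof (cases q)
          case (Cons b r)
          have ab: "a = b \<or> edge X a b" and q: "walk q" using Cons Cons.prems(1) by (auto simp: walk_def)
          have "{b} \<in> X" using ab Cons.prems(2) e2 by auto
          moreover have "{a, b} \<in> X" using ab Cons.prems(2) by (auto simp: edge_def)
          ultimately show ?thesis using Cons.IH[OF q] Cons by simp
        qed simp
      qed simp
      then show ?thesis using that v by (simp add: edge_path_def walk_def)
    qed
    obtain p p' where p: "lifts v [v] p w" "lifts v [v] p' w'" using cover_reachable w by metis
    have "path_homotopic X p p'"
      using sc ep lifts_walk[OF p(1)] lifts_walk[OF p(2)] lifts_hd[OF p(1)] lifts_hd[OF p(2)] w(3)
      unfolding edge_simply_connected_def by simp
    then have "lifts v [v] p w'" using hom cover_root p(2) by blast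
    then show "w = w'" using lifts_unique p(1) by blast
  qed
  have vX: "{a} \<in> X" if "edge X a b" for a b using face[OF X, of "{a, b}" "{a}"] that by (auto simp: edge_def)
  show ?thesis unfolding six_large_def
  proof (intro conjI allI impI)
    fix a b c assume h: "edge X a b \<and> edge X b c \<and> edge X c a"
    have "triangle X a b c" by (rule three_cycle) (use h inj[OF vX[of a b]] in auto)
    then show "{a, b, c} \<in> X" by (simp add: triangle_def)
  next
    fix a b c d assume h: "edge X a b \<and> edge X b c \<and> edge X c d \<and> edge X d a \<and> a \<noteq> c \<and> b \<noteq> d"
    show "edge X a c \<or> edge X b d" by (rule four_cycle) (use h inj[OF vX[of a b]] in auto)
  next
    fix a b c d e
    assume h: "edge X a b \<and> edge X b c \<and> edge X c d \<and> edge X d e \<and> edge X e a \<and> distinct [a, b, c, d, e]"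
    show "edge X a c \<or> edge X b d \<or> edge X c e \<or> edge X d a \<or> edge X e b"
      by (rule five_cycle) (use h inj[OF vX[of a b]] in auto)
  qed
qed

lemma cycle_edges_card:
  assumes "distinct c" "3 \<le> length c" shows "card (cycle_edges c) = length c"
proof -
  let ?n = "length c"
  let ?f = "\<lambda>i. {c ! i, c ! (Suc i mod ?n)}"
  have "inj_on ?f {..<?n}"
  proof (rule inj_onI)
    fix i j assume i: "i \<in> {..<?n}" and j: "j \<in> {..<?n}" and eq: "?f i = ?f j"
    have n0: "0 < ?n" using assms by linarith
    have m: "Suc i mod ?n < ?n" "Suc j mod ?n < ?n" using n0 by auto
    have "c ! i = c ! j \<or> c ! i = c ! (Suc j mod ?n) \<and> c ! j = c ! (Suc i mod ?n)"
      using eq by (auto simp: doubleton_eq_iff)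
    then have "i = j \<or> i = Suc j mod ?n \<and> j = Suc i mod ?n"
      using i j m nth_eq_iff_index_eq[OF assms(1), of i j] nth_eq_iff_index_eq[OF assms(1), of i "Suc j mod ?n"]
        nth_eq_iff_index_eq[OF assms(1), of j "Suc i mod ?n"] by blast
    then show "i = j"
    proof
      assume h: "i = Suc j mod ?n \<and> j = Suc i mod ?n"
      have j: "j = (if Suc i = ?n then 0 else Suc i)" using conjunct2[OF h] i by (metis mod_less mod_self lessThan_iff Suc_lessI)
      have i: "i = (if Suc j = ?n then 0 else Suc j)" using conjunct1[OF h] \<open>j \<in> {..<?n}\<close> by (metis mod_less mod_self lessThan_iff Suc_lessI)
      have "Suc i = ?n \<and> j = 0 \<or> j = Suc i" "Suc j = ?n \<and> i = 0 \<or> i = Suc j" using i j by metis+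
      then show ?thesis using assms(2) by linarith
    qed
  qed
  moreover have "cycle_edges c = ?f ` {..<?n}" by (auto simp: cycle_edges_def)
  ultimately show ?thesis by (simp add: card_image)
qed

lemma systole_if_six_large:
  assumes X: "abstract_complex X" and "six_large X" shows "enat 6 \<le> systole X"
proof -
  have "6 \<le> card (cycle_edges c)" if f: "full_cycle X c" for c
  proof (rule ccontr)
    assume small: "\<not> 6 \<le> card (cycle_edges c)"
    have c: "3 \<le> length c" "distinct c" "cycle_edges c \<subseteq> X" using f by (auto simp: full_cycle_def embedded_cycle_def)
    have "length c < 6" using cycle_edges_card[OF c(2,1)] small by simp
    then have n: "length c = 3 \<or> length c = 4 \<or> length c = 5" using c(1) by auto
    have e: "edge X (c ! i) (c ! (Suc i mod length c))" if "i < length c" for i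
    proof -
      have *: "{c ! i, c ! (Suc i mod length c)} \<in> X" using c(3) that by (auto simp: cycle_edges_def)
      moreover have "i \<noteq> Suc i mod length c" using that c(1) by (auto simp: mod_Suc)
      moreover have "Suc i mod length c < length c" using c(1) by (intro mod_less_divisor) linarith
      ultimately have "c ! i \<noteq> c ! (Suc i mod length c)" using that nth_eq_iff_index_eq[OF c(2) that] by blast
      then show ?thesis using * by (simp add: edge_def)
    qed
    have no: "\<not> edge X a b" if ab: "a \<in> set c" "b \<in> set c" "{a, b} \<notin> cycle_edges c" for a b
    proof
      assume e: "edge X a b"
      then have "{a, b} \<in> X" "{a, b} \<subseteq> set c" using ab by (auto simp: edge_def)
      then have "{a, b} \<in> cycle_edges c \<or> (\<exists>v\<in>set c. {a, b} = {v})"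
        using f unfolding full_cycle_def by blast
      then show False using ab(3) e by (auto simp: edge_def)
    qed
    have no3: "{a, b, d} \<notin> X" if abd: "c = [a, b, d]" for a b d
    proof
      have card: "card {a, b, d} = 3" using c(2) abd by auto
      assume "{a, b, d} \<in> X"
      then have "{a, b, d} \<in> cycle_edges c \<or> (\<exists>v\<in>set c. {a, b, d} = {v})"
        using f abd unfolding full_cycle_def by (metis list.set(1,2) order_refl)
      moreover have "\<exists>x y. \<sigma> = {x, y}" if "\<sigma> \<in> cycle_edges c \<or> (\<exists>v\<in>set c. \<sigma> = {v})" for \<sigma>
        using that unfolding cycle_edges_def by blast
      ultimately obtain x y where xy: "{a, b, d} = {x, y}" by blast
      have "card {x, y} \<le> 2" by (simp add: card_insert_if)
      then show False using xy card by simp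
    qed
    show False
      using n
    proof (elim disjE)
      assume l: "length c = 3"
      then obtain a b d where abd: "c = [a, b, d]" by (auto simp: length_Suc_conv numeral_eq_Suc)
      have "edge X a b" "edge X b d" "edge X d a" using e[of 0] e[of 1] e[of 2] abd by auto
      then have "{a, b, d} \<in> X" using six_largeD(1)[OF assms(2)] by blast
      then show False using no3 abd by blast
    next
      assume l: "length c = 4"
      then obtain a b d g where abd: "c = [a, b, d, g]" by (auto simp: length_Suc_conv numeral_eq_Suc)
      have "edge X a b" "edge X b d" "edge X d g" "edge X g a" using e[of 0] e[of 1] e[of 2] e[of 3] abd by auto
      moreover have "a \<noteq> d" "b \<noteq> g" using c(2) abd by auto
      ultimately have "edge X a d \<or> edge X b g" using six_largeD(2)[OF assms(2)] by blast
      moreover have "cycle_edges c \<subseteq> {{a, b}, {b, d}, {d, g}, {g, a}}"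
      proof
        fix x assume "x \<in> cycle_edges c"
        then obtain i where i: "i < 4" "x = {c ! i, c ! (Suc i mod 4)}" using l by (auto simp: cycle_edges_def)
        then have "i = 0 \<or> i = 1 \<or> i = 2 \<or> i = 3" by linarith
        then show "x \<in> {{a, b}, {b, d}, {d, g}, {g, a}}" using i(2) abd by (elim disjE) auto
      qed
      then have "{a, d} \<notin> cycle_edges c" "{b, g} \<notin> cycle_edges c"
        using c(2) abd by (auto simp: doubleton_eq_iff)
      ultimately show False using no[of a d] no[of b g] abd by auto
    next
      assume l: "length c = 5"
      then obtain a b d g h where abd: "c = [a, b, d, g, h]" by (auto simp: length_Suc_conv numeral_eq_Suc)
      have "edge X a b" "edge X b d" "edge X d g" "edge X g h" "edge X h a"
        using e[of 0] e[of 1] e[of 2] e[of 3] e[of 4] abd by auto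
      then have "edge X a d \<or> edge X b g \<or> edge X d h \<or> edge X g a \<or> edge X h b"
        using six_largeD(3)[OF assms(2), of a b d g h] c(2) unfolding abd by blast
      moreover have "cycle_edges c \<subseteq> {{a, b}, {b, d}, {d, g}, {g, h}, {h, a}}"
      proof
        fix x assume "x \<in> cycle_edges c"
        then obtain i where i: "i < 5" "x = {c ! i, c ! (Suc i mod 5)}" using l by (auto simp: cycle_edges_def)
        then have "i = 0 \<or> i = 1 \<or> i = 2 \<or> i = 3 \<or> i = 4" by linarith
        then show "x \<in> {{a, b}, {b, d}, {d, g}, {g, h}, {h, a}}" using i(2) abd by (elim disjE) auto
      qed
      then have "{a, d} \<notin> cycle_edges c" "{b, g} \<notin> cycle_edges c" "{d, h} \<notin> cycle_edges c"
        "{g, a} \<notin> cycle_edges c" "{h, b} \<notin> cycle_edges c"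
        using c(2) abd by (auto simp: doubleton_eq_iff)
      ultimately show False using no[of a d] no[of b g] no[of d h] no[of g a] no[of h b] abd by auto
    qed
  qed
  then show ?thesis unfolding systole_def by (auto intro!: INF_greatest)
qed

section \<open>Simple connectedness of the realization\<close>

text \<open>
  A path in the realization stays in a finite subcomplex, where it is a concatenation of paths in
  open stars of vertices. The list of these vertices is an edge path, and the list together with the
  end points determines the path up to homotopy. In this way edge-path homotopies become homotopies
  of paths. Inside a finite subcomplex the weak topology is the product topology, so that the
  library's \<open>homotopic_paths\<close> applies.
\<close>

definition vert :: "'v \<Rightarrow> 'v \<Rightarrow> real" where "vert v = (\<lambda>u. if u = v then 1 else 0)"
definition mix :: "real \<Rightarrow> ('v \<Rightarrow> real) \<Rightarrow> ('v \<Rightarrow> real) \<Rightarrow> 'v \<Rightarrow> real" where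
  "mix t x y = (\<lambda>u. (1 - t) * x u + t * y u)"

definition underlying :: "'v set set \<Rightarrow> ('v \<Rightarrow> real) set" where
  "underlying F = (\<Union>\<sigma>\<in>F. closed_simplex \<sigma>)"

definition star :: "'v set set \<Rightarrow> 'v \<Rightarrow> ('v \<Rightarrow> real) set" where
  "star F v = {x \<in> underlying F. 0 < x v}"

lemma mix_ends [simp]: "mix 0 x y = x" "mix 1 x y = y" by (auto simp: mix_def)

lemma vert_in: "finite \<sigma> \<Longrightarrow> v \<in> \<sigma> \<Longrightarrow> vert v \<in> closed_simplex \<sigma>"
  by (auto simp: closed_simplex_def vert_def)

lemma mix_in: assumes "x \<in> closed_simplex \<sigma>" "y \<in> closed_simplex \<sigma>" "0 \<le> t" "t \<le> 1"
  shows "mix t x y \<in> closed_simplex \<sigma>"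
  using assms by (auto simp: closed_simplex_def mix_def sum.distrib sum_distrib_left[symmetric])

lemma support: "x \<in> closed_simplex \<sigma> \<Longrightarrow> 0 < x v \<Longrightarrow> v \<in> \<sigma>"
  unfolding closed_simplex_def by fastforce

lemma nonneg: "x \<in> closed_simplex \<sigma> \<Longrightarrow> 0 \<le> x v"
  unfolding closed_simplex_def by blast

lemma continuous_mix:
  fixes f g :: "'b::topological_space \<Rightarrow> 'v \<Rightarrow> real"
  assumes "continuous_on A t" "continuous_on A f" "continuous_on A g"
  shows "continuous_on A (\<lambda>a. mix (t a) (f a) (g a))"
  unfolding mix_def
  by (intro continuous_on_coordinatewise_then_product continuous_intros assms
      continuous_on_product_then_coordinatewise[OF assms(2)] continuous_on_product_then_coordinatewise[OF assms(3)])

text \<open>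
  \<open>ramp\<close> is zero at both ends and one on the middle third of the unit interval;
  \<open>squeeze\<close> runs through the unit interval during the middle third. Pulling a path
  towards a vertex according to \<open>ramp\<close> while running through it according to
  \<open>squeeze\<close> thus gives a path that sits at the vertex whenever the original one moves.
\<close>

definition ramp :: "real \<Rightarrow> real" where "ramp s = min 1 (min (3 * s) (3 * (1 - s)))"
definition squeeze :: "real \<Rightarrow> real" where "squeeze s = max 0 (min 1 (3 * s - 1))"

text \<open>
  The right-hand side depends on the end points of \<open>p\<close> only, and therefore any two
  paths with the same end points in an open star are homotopic.
\<close>

lemma star_path_canonical:
  assumes fin: "\<And>\<sigma>. \<sigma> \<in> F \<Longrightarrow> finite \<sigma>" and p: "path p" "path_image p \<subseteq> star F v"
  shows "homotopic_paths (underlying F) p (\<lambda>s. mix (ramp s) (p (squeeze s)) (vert v))"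
proof -
  define k :: "real \<times> real \<Rightarrow> real" where
    "k = (\<lambda>(t, s). (1 - max 0 (2 * t - 1)) * s + max 0 (2 * t - 1) * squeeze s)"
  \<comment> \<open>The first half of the homotopy pulls the path to the vertex, the second half
    changes its speed. All the time it moves in simplices that contain both the vertex and a point
    of the given path.\<close>
  define h where "h = (\<lambda>(t, s). mix (min 1 (2 * t) * ramp s) (p (k (t, s))) (vert v))"
  have k01: "k (t, s) \<in> {0..1}" if "t \<in> {0..1}" "s \<in> {0..1}" for t s
  proof -
    have "squeeze s \<in> {0..1}" by (auto simp: squeeze_def)
    moreover have "max 0 (2 * t - 1) \<in> {0..1}" using that by auto
    ultimately show ?thesis unfolding k_def
      using convex_bound_le[of s 1 "squeeze s" "1 - max 0 (2 * t - 1)" "max 0 (2 * t - 1)"] that by auto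
  qed
  have r01: "min 1 (2 * t) * ramp s \<in> {0..1}" if "t \<in> {0..1}" "s \<in> {0..1}" for t s
    using that by (auto simp: ramp_def intro!: mult_le_one)
  have pc: "continuous_on {0..1} p" using p(1) by (simp add: path_def)
  have kc: "continuous_on ({0..1} \<times> {0..1}) k"
    unfolding k_def squeeze_def case_prod_beta by (intro continuous_intros)
  have "continuous_on ({0..1} \<times> {0..1}) (\<lambda>z. mix (min 1 (2 * fst z) * ramp (snd z)) (p (k z)) (vert v))"
    unfolding ramp_def
    by (intro continuous_mix continuous_intros continuous_on_compose2[OF pc kc]) (use k01 in auto)
  then have hc: "continuous_on ({0..1} \<times> {0..1}) h" by (simp add: h_def case_prod_beta')
  have hin: "h (t, s) \<in> underlying F" if "t \<in> {0..1}" "s \<in> {0..1}" for t s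
  proof -
    have "p (k (t, s)) \<in> star F v" using p(2) k01[OF that] by (auto simp: path_image_def)
    then obtain \<sigma> where \<sigma>: "\<sigma> \<in> F" "p (k (t, s)) \<in> closed_simplex \<sigma>" "v \<in> \<sigma>"
      using support by (force simp: star_def underlying_def)
    then have "h (t, s) \<in> closed_simplex \<sigma>"
      unfolding h_def using r01[OF that] vert_in[OF fin[OF \<sigma>(1)] \<sigma>(3)] by (auto intro!: mix_in)
    then show ?thesis using \<sigma> by (auto simp: underlying_def)
  qed
  show ?thesis
    unfolding homotopic_paths
    by (rule exI[of _ h]) (use hc hin in \<open>auto simp: h_def k_def ramp_def squeeze_def pathstart_def pathfinish_def\<close>)
qed

lemma star_paths_homotopic:
  assumes fin: "\<And>\<sigma>. \<sigma> \<in> F \<Longrightarrow> finite \<sigma>" and p: "path p" "path_image p \<subseteq> star F v"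
    and q: "path q" "path_image q \<subseteq> star F v" and ends: "pathstart p = pathstart q" "pathfinish p = pathfinish q"
  shows "homotopic_paths (underlying F) p q"
proof -
  have "mix (ramp s) (p (squeeze s)) (vert v) = mix (ramp s) (q (squeeze s)) (vert v)" if "s \<in> {0..1}" for s
  proof -
    consider "s \<le> 1/3" | "1/3 \<le> s" "s \<le> 2/3" | "2/3 \<le> s" by linarith
    then show ?thesis
    proof cases
      case 1 then have "squeeze s = 0" by (simp add: squeeze_def)
      then show ?thesis using ends by (simp add: pathstart_def)
    next
      case 2 then have "ramp s = 1" by (simp add: ramp_def)
      then show ?thesis by simp
    next
      case 3 then have "squeeze s = 1" by (simp add: squeeze_def)
      then show ?thesis using ends by (simp add: pathfinish_def)
    qed
  qed
  moreover note cp = star_path_canonical[OF fin p] and cq = star_path_canonical[OF fin q]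
  ultimately have "homotopic_paths (underlying F) (\<lambda>s. mix (ramp s) (p (squeeze s)) (vert v)) (\<lambda>s. mix (ramp s) (q (squeeze s)) (vert v))"
    using homotopic_paths_imp_path[OF cp] homotopic_paths_imp_subset[OF cp] by (intro homotopic_paths_eq) auto
  then show ?thesis using cp cq homotopic_paths_trans homotopic_paths_sym by blast
qed

lemma line_in_stars:
  assumes "\<sigma> \<in> F" "x \<in> closed_simplex \<sigma>" "y \<in> closed_simplex \<sigma>" "\<And>v. v \<in> W \<Longrightarrow> 0 < x v \<and> 0 < y v"
  shows "path (\<lambda>t. mix t x y)" "path_image (\<lambda>t. mix t x y) \<subseteq> underlying F"
    "v \<in> W \<Longrightarrow> path_image (\<lambda>t. mix t x y) \<subseteq> star F v"
proof -
  show "path (\<lambda>t. mix t x y)" unfolding path_def by (intro continuous_mix continuous_intros)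
  show 1: "path_image (\<lambda>t. mix t x y) \<subseteq> underlying F"
    using mix_in[OF assms(2,3)] assms(1) by (auto simp: path_image_def underlying_def)
  show "path_image (\<lambda>t. mix t x y) \<subseteq> star F v" if v: "v \<in> W"
  proof -
    have "0 < mix t x y v" if "t \<in> {0..1}" for t
    proof (cases "t = 1")
      case False
      then have "0 < (1 - t) * x v" "0 \<le> t * y v" using assms(4)[OF v] that by auto
      then show ?thesis by (simp add: mix_def)
    qed (use assms(4)[OF v] in simp)
    then show ?thesis using 1 by (auto simp: star_def path_image_def)
  qed
qed

text \<open>
  Both points are joined to the midpoint of the edge from \<open>v\<close> to \<open>w\<close>,
  along segments which stay in the stars of both vertices.
\<close>

lemma star_inter_path:
  assumes fin: "\<And>\<sigma>. \<sigma> \<in> F \<Longrightarrow> finite \<sigma>" and x: "x \<in> star F v \<inter> star F w" and y: "y \<in> star F v \<inter> star F w"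
  obtains g where "path g" "path_image g \<subseteq> star F v" "path_image g \<subseteq> star F w" "pathstart g = x" "pathfinish g = y"
proof -
  define z where "z = mix (1/2) (vert v) (vert w)"
  have zpos: "0 < z v" "0 < z w" by (auto simp: z_def mix_def vert_def)
  have to: "\<exists>g. path g \<and> path_image g \<subseteq> star F v \<and> path_image g \<subseteq> star F w \<and> pathstart g = x \<and> pathfinish g = z"
    if x: "x \<in> star F v \<inter> star F w" for x
  proof -
    obtain \<sigma> where \<sigma>: "\<sigma> \<in> F" "x \<in> closed_simplex \<sigma>" and pos: "0 < x v" "0 < x w"
      using x by (auto simp: star_def underlying_def)
    have "z \<in> closed_simplex \<sigma>"
      unfolding z_def using vert_in[OF fin[OF \<sigma>(1)]] support[OF \<sigma>(2)] pos by (intro mix_in) auto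
    then show ?thesis
      using line_in_stars[of \<sigma> F x z "{v, w}"] \<sigma> pos zpos
      by (intro exI[of _ "\<lambda>t. mix t x z"]) (auto simp: pathstart_def pathfinish_def)
  qed
  obtain g1 g2 where g: "path g1" "path_image g1 \<subseteq> star F v" "path_image g1 \<subseteq> star F w" "pathstart g1 = x" "pathfinish g1 = z"
    "path g2" "path_image g2 \<subseteq> star F v" "path_image g2 \<subseteq> star F w" "pathstart g2 = y" "pathfinish g2 = z"
    using to[OF x] to[OF y] by blast
  show thesis
    by (rule that[of "g1 +++ reversepath g2"]) (use g in \<open>auto simp: path_image_join\<close>)
qed

inductive carried :: "'v set set \<Rightarrow> 'v list \<Rightarrow> (real \<Rightarrow> 'v \<Rightarrow> real) \<Rightarrow> bool" for F where
  one: "path p \<Longrightarrow> path_image p \<subseteq> star F v \<Longrightarrow> carried F [v] p"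
| more: "path p \<Longrightarrow> path_image p \<subseteq> star F v \<Longrightarrow> carried F vs q \<Longrightarrow> pathfinish p = pathstart q \<Longrightarrow>
    carried F (v # vs) (p +++ q)"

lemma star_sub: "star F v \<subseteq> underlying F" by (auto simp: star_def)

lemma carried_path:
  assumes "carried F vs p"
  shows "path p" "path_image p \<subseteq> underlying F" "vs \<noteq> []" "pathstart p \<in> star F (hd vs)" "pathfinish p \<in> star F (last vs)"
proof -
  have "path p \<and> path_image p \<subseteq> underlying F \<and> vs \<noteq> [] \<and> pathstart p \<in> star F (hd vs) \<and> pathfinish p \<in> star F (last vs)"
    using assms
  proof (induction rule: carried.induct)
    case (one p v)
    then show ?case using star_sub by fastforce
  next
    case (more p v vs q)
    then show ?case using star_sub[of F v] pathstart_in_path_image[of p] by (auto simp: path_image_join)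
  qed
  then show "path p" "path_image p \<subseteq> underlying F" "vs \<noteq> []" "pathstart p \<in> star F (hd vs)" "pathfinish p \<in> star F (last vs)"
    by auto
qed

lemma underlying_mono: "F \<subseteq> F' \<Longrightarrow> underlying F \<subseteq> underlying F'"
  by (auto simp: underlying_def)

lemma star_mono: "F \<subseteq> F' \<Longrightarrow> star F v \<subseteq> star F' v"
  using underlying_mono[of F F'] by (auto simp: star_def)

lemma carried_mono: "carried F vs p \<Longrightarrow> F \<subseteq> F' \<Longrightarrow> carried F' vs p"
proof (induction rule: carried.induct)
  case (one p v) then show ?case using star_mono[of F F' v] by (blast intro: carried.one)
next
  case (more p v vs q) then show ?case using star_mono[of F F' v] by (blast intro: carried.more)
qed

lemma carried_Cons:
  assumes "carried F (v # w # vs) p"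
  obtains p1 p2 where "path p1" "path_image p1 \<subseteq> star F v" "carried F (w # vs) p2" "pathfinish p1 = pathstart p2" "p = p1 +++ p2"
  using assms by (cases rule: carried.cases) auto

lemma carried_single: "carried F [v] p \<Longrightarrow> path p \<and> path_image p \<subseteq> star F v"
  by (cases rule: carried.cases) (auto dest: carried_path)

lemma carried_prepend:
  assumes q: "carried F (w # ws) q" and g: "path g" "path_image g \<subseteq> star F w" "pathfinish g = pathstart q"
  obtains q' where "carried F (w # ws) q'" "homotopic_paths (underlying F) (g +++ q) q'"
proof (cases ws)
  case Nil
  then have "path q" "path_image q \<subseteq> star F w" using carried_single[of F w q] q by blast+
  then have "carried F [w] (g +++ q)" using g by (intro carried.one) (auto simp: path_image_join)
  then show thesis using that[of "g +++ q"] Nil carried_path(1,2)[of F "[w]"] by simp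
next
  case (Cons u us)
  then obtain q1 q2 where q12: "path q1" "path_image q1 \<subseteq> star F w" "carried F (u # us) q2"
    "pathfinish q1 = pathstart q2" "q = q1 +++ q2" using q carried_Cons by metis
  have c: "carried F (w # ws) ((g +++ q1) +++ q2)"
    unfolding Cons using g q12 by (intro carried.more) (auto simp: path_image_join)
  have "homotopic_paths (underlying F) (g +++ (q1 +++ q2)) ((g +++ q1) +++ q2)"
    using g q12 carried_path[OF q12(3)] star_sub[of F w] by (intro homotopic_paths_assoc) auto
  then show thesis using that c q12(5) by blast
qed

text \<open>
  Compare two decompositions at their first break: both break points lie in the intersection of the
  first two open stars, and a path between them in that intersection can be moved from one factor to
  the other.
\<close>

lemma carried_unique:
  assumes fin: "\<And>\<sigma>. \<sigma> \<in> F \<Longrightarrow> finite \<sigma>"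
  shows "carried F vs p \<Longrightarrow> carried F vs q \<Longrightarrow> pathstart p = pathstart q \<Longrightarrow> pathfinish p = pathfinish q \<Longrightarrow>
    homotopic_paths (underlying F) p q"
proof (induction vs arbitrary: p q)
  case Nil then show ?case using carried_path by blast
next
  case (Cons v vs)
  show ?case
  proof (cases vs)
    case Nil
    then show ?thesis using Cons.prems carried_single[of F v] star_paths_homotopic[OF fin] by metis
  next
    case c: (Cons w ws)
    obtain p1 p2 where p: "path p1" "path_image p1 \<subseteq> star F v" "carried F (w # ws) p2" "pathfinish p1 = pathstart p2" "p = p1 +++ p2"
      using Cons.prems(1) c carried_Cons by metis
    obtain q1 q2 where q: "path q1" "path_image q1 \<subseteq> star F v" "carried F (w # ws) q2" "pathfinish q1 = pathstart q2" "q = q1 +++ q2"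
      using Cons.prems(2) c carried_Cons by metis
    have "pathfinish p1 \<in> star F v \<inter> star F w"
      using p carried_path(4)[OF p(3)] pathfinish_in_path_image[of p1] by auto
    moreover have "pathfinish q1 \<in> star F v \<inter> star F w"
      using q carried_path(4)[OF q(3)] pathfinish_in_path_image[of q1] by auto
    ultimately obtain g where g: "path g" "path_image g \<subseteq> star F v" "path_image g \<subseteq> star F w"
      "pathstart g = pathfinish p1" "pathfinish g = pathfinish q1"
      using star_inter_path[OF fin, of F "pathfinish p1" v w "pathfinish q1"] by metis
    obtain r where r: "carried F (w # ws) r" "homotopic_paths (underlying F) (g +++ q2) r"
      using carried_prepend[OF q(3) g(1,3)] g q by metis
    have rs: "pathstart r = pathstart p2" "pathfinish r = pathfinish p2"
      using homotopic_paths_imp_pathstart[OF r(2)] homotopic_paths_imp_pathfinish[OF r(2)] g p q Cons.prems by auto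
    have "homotopic_paths (underlying F) p2 (g +++ q2)"
      using Cons.IH[of p2 r] p(3) r rs c homotopic_paths_trans homotopic_paths_sym by metis
    moreover have p1: "homotopic_paths (underlying F) p1 p1" using p star_sub[of F v] by auto
    ultimately have 1: "homotopic_paths (underlying F) p (p1 +++ (g +++ q2))"
      unfolding p(5) using p(4) by (intro homotopic_paths_join) auto
    have 2: "homotopic_paths (underlying F) (p1 +++ (g +++ q2)) ((p1 +++ g) +++ q2)"
      using p g q star_sub[of F v] carried_path[OF q(3)] by (intro homotopic_paths_assoc) auto
    have "homotopic_paths (underlying F) (p1 +++ g) q1"
      using p q g Cons.prems by (intro star_paths_homotopic[OF fin, of F "p1 +++ g" v q1]) (auto simp: path_image_join)
    then have 3: "homotopic_paths (underlying F) ((p1 +++ g) +++ q2) q"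
      unfolding q(5) using carried_path[OF q(3)] g q by (intro homotopic_paths_join) auto
    show ?thesis using 1 2 3 homotopic_paths_trans by blast
  qed
qed

lemma carried_append:
  assumes "carried F vs p" "carried F ws q" "pathfinish p = pathstart q"
  shows "\<exists>r. carried F (vs @ ws) r \<and> homotopic_paths (underlying F) (p +++ q) r"
  using assms
proof (induction rule: carried.induct)
  case (one p v)
  then have "carried F ([v] @ ws) (p +++ q)" by (auto intro: carried.more)
  then show ?case using carried_path(1,2) homotopic_paths_refl by metis
next
  case (more p v vs r)
  then obtain t where t: "carried F (vs @ ws) t" "homotopic_paths (underlying F) (r +++ q) t" by auto
  have "pathstart t = pathstart r" using homotopic_paths_imp_pathstart[OF t(2)] by simp
  then have c: "carried F ((v # vs) @ ws) (p +++ t)" using t more by (auto intro: carried.more)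
  have P: "path_image p \<subseteq> underlying F" using more(2) star_sub[of F v] by blast
  have "homotopic_paths (underlying F) ((p +++ r) +++ q) (p +++ (r +++ q))"
    using more P carried_path[OF more(3)] carried_path[OF more.prems(1)]
    by (intro homotopic_paths_sym[OF homotopic_paths_assoc]) auto
  also have "homotopic_paths (underlying F) (p +++ (r +++ q)) (p +++ t)"
    using t more P by (intro homotopic_paths_join) auto
  finally show ?case using c by blast
qed

definition center :: "'v \<Rightarrow> 'v \<Rightarrow> 'v \<Rightarrow> 'v \<Rightarrow> real" where
  "center a b c = mix (1/2) (mix (1/2) (vert a) (vert b)) (vert c)"

lemma center_star: assumes "{a, b, c} \<in> F"
  shows "center a b c \<in> star F a" "center a b c \<in> star F b" "center a b c \<in> star F c"
proof -
  have v: "vert u \<in> closed_simplex {a, b, c}" if "u \<in> {a, b, c}" for u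
    using vert_in[of "{a, b, c}" u] that by simp
  have "center a b c \<in> closed_simplex {a, b, c}"
    unfolding center_def by (intro mix_in v) auto
  then have "center a b c \<in> underlying F" using assms by (auto simp: underlying_def)
  then show "center a b c \<in> star F a" "center a b c \<in> star F b" "center a b c \<in> star F c"
    by (auto simp: star_def center_def mix_def vert_def)
qed

lemma const_path: "path (\<lambda>_. x)" "path_image (\<lambda>_. x) = {x}" "pathstart (\<lambda>_. x) = x" "pathfinish (\<lambda>_. x) = x"
  by (auto simp: path_def path_image_def pathstart_def pathfinish_def)

lemma carried_dup:
  assumes fin: "\<And>\<sigma>. \<sigma> \<in> F \<Longrightarrow> finite \<sigma>"
  shows "carried F (a # a # p) x \<Longrightarrow> \<exists>y. carried F (a # p) y \<and> homotopic_paths (underlying F) x y"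
    and "carried F (a # p) x \<Longrightarrow> \<exists>y. carried F (a # a # p) y \<and> homotopic_paths (underlying F) x y"
proof -
  show 1: "\<exists>y. carried F (a # p) y \<and> homotopic_paths (underlying F) x y" if x: "carried F (a # a # p) x" for x
  proof -
    obtain x1 x2 where h: "path x1" "path_image x1 \<subseteq> star F a" "carried F (a # p) x2" "pathfinish x1 = pathstart x2" "x = x1 +++ x2"
      using x by (rule carried_Cons)
    show ?thesis using carried_prepend[OF h(3,1,2,4)] h(5) by blast
  qed
  assume x: "carried F (a # p) x"
  define z where "z = (\<lambda>_. pathstart x) +++ x"
  have z: "carried F (a # a # p) z"
    unfolding z_def using x const_path carried_path(4)[OF x] by (intro carried.more) auto
  obtain y where y: "carried F (a # p) y" "homotopic_paths (underlying F) z y" using 1[OF z] by blast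
  have "pathstart y = pathstart x" "pathfinish y = pathfinish x"
    using homotopic_paths_imp_pathstart[OF y(2)] homotopic_paths_imp_pathfinish[OF y(2)]
    by (auto simp: z_def const_path)
  then have "homotopic_paths (underlying F) x y" using carried_unique[OF fin x y(1)] by simp
  then show "\<exists>y. carried F (a # a # p) y \<and> homotopic_paths (underlying F) x y"
    using z y(2) homotopic_paths_trans homotopic_paths_sym by blast
qed

text \<open>
  A path that passes the stars of \<open>a\<close>, \<open>b\<close>, \<open>c\<close> may be
  replaced by one through the centre of the triangle which pauses there during its visit to the star
  of \<open>b\<close>. The pause can be dropped or inserted.
\<close>

lemma carried_shortcut:
  assumes fin: "\<And>\<sigma>. \<sigma> \<in> F \<Longrightarrow> finite \<sigma>" and abc: "{a, b, c} \<in> F"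
  shows "carried F (a # b # c # p) x \<Longrightarrow> \<exists>y. carried F (a # c # p) y \<and> homotopic_paths (underlying F) x y"
    and "carried F (a # c # p) x \<Longrightarrow> \<exists>y. carried F (a # b # c # p) y \<and> homotopic_paths (underlying F) x y"
proof -
  note m = center_star[OF abc]
  let ?m = "center a b c"
  have aux: "\<exists>y z. carried F (a # b # c # p) y \<and> carried F (a # c # p) z \<and> homotopic_paths (underlying F) y z \<and>
      pathstart y = pathstart x1 \<and> pathfinish y = pathfinish x2"
    if x1: "path x1" "path_image x1 \<subseteq> star F a" and g1: "path g1" "path_image g1 \<subseteq> star F a"
      "pathfinish x1 = pathstart g1" "pathfinish g1 = ?m"
      and g2: "path g2" "path_image g2 \<subseteq> star F c" "pathstart g2 = ?m" "pathfinish g2 = pathstart x2"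
      and x2: "carried F (c # p) x2" for x1 g1 g2 x2
  proof -
    obtain t where t: "carried F (c # p) t" "homotopic_paths (underlying F) (g2 +++ x2) t"
      using carried_prepend[OF x2 g2(1,2,4)] by blast
    have ts: "pathstart t = ?m" "pathfinish t = pathfinish x2"
      using homotopic_paths_imp_pathstart[OF t(2)] homotopic_paths_imp_pathfinish[OF t(2)] g2 by auto
    obtain t' where t': "carried F (c # p) t'" "homotopic_paths (underlying F) ((\<lambda>_. ?m) +++ t) t'"
      using carried_prepend[OF t(1), of "\<lambda>_. ?m"] const_path m(3) ts(1) by (metis empty_subsetI insert_subset)
    have ts': "pathstart t' = ?m"
      using homotopic_paths_imp_pathstart[OF t'(2)] const_path(3)[of ?m] by simp
    define h where "h = x1 +++ g1"
    define r where "r = (\<lambda>_::real. ?m) +++ t"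
    have h: "path h" "path_image h \<subseteq> star F a" "pathfinish h = ?m" "pathstart h = pathstart x1"
      unfolding h_def using x1 g1 by (auto simp: path_image_join)
    have r: "carried F (b # c # p) r" "pathstart r = ?m" "pathfinish r = pathfinish x2"
      unfolding r_def using t(1) const_path m(2) ts by (auto intro!: carried.more)
    have 1: "carried F (a # b # c # p) (h +++ r)" using carried.more[OF h(1,2) r(1)] h(3) r(2) by simp
    have 2: "carried F (a # c # p) (h +++ t')" using carried.more[OF h(1,2) t'(1)] h(3) ts' by simp
    have hh: "homotopic_paths (underlying F) h h" using h(1,2) star_sub[of F a] by auto
    have 3: "homotopic_paths (underlying F) (h +++ r) (h +++ t')"
      using homotopic_paths_join[OF hh t'(2)] h(3) r(2) unfolding r_def by simp
    show ?thesis using 1 2 3 h(4) r(3) pathstart_join pathfinish_join by metis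
  qed
  show "\<exists>y. carried F (a # c # p) y \<and> homotopic_paths (underlying F) x y" if x: "carried F (a # b # c # p) x"
  proof -
    obtain x1 x' where h: "path x1" "path_image x1 \<subseteq> star F a" "carried F (b # c # p) x'" "pathfinish x1 = pathstart x'" "x = x1 +++ x'"
      using x by (rule carried_Cons)
    obtain xb x2 where h2: "path xb" "path_image xb \<subseteq> star F b" "carried F (c # p) x2" "pathfinish xb = pathstart x2" "x' = xb +++ x2"
      using h(3) by (rule carried_Cons)
    have "pathfinish x1 \<in> star F a \<inter> star F b" using h carried_path(4)[OF h(3)] pathfinish_in_path_image[of x1] by auto
    then obtain g1 where g1: "path g1" "path_image g1 \<subseteq> star F a" "pathfinish x1 = pathstart g1" "pathfinish g1 = ?m"
      using star_inter_path[OF fin, of F "pathfinish x1" a b ?m] m by (metis IntI)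
    have "pathstart x2 \<in> star F b \<inter> star F c"
      using h2 carried_path(4)[OF h2(3)] pathfinish_in_path_image[of xb] by auto
    then obtain g2 where g2: "path g2" "path_image g2 \<subseteq> star F c" "pathstart g2 = ?m" "pathfinish g2 = pathstart x2"
      using star_inter_path[OF fin, of F ?m b c "pathstart x2"] m by (metis IntI)
    obtain y z where yz: "carried F (a # b # c # p) y" "carried F (a # c # p) z" "homotopic_paths (underlying F) y z"
      "pathstart y = pathstart x1" "pathfinish y = pathfinish x2"
      using aux[OF h(1,2) g1 g2 h2(3)] by blast
    have "homotopic_paths (underlying F) x y" using carried_unique[OF fin x yz(1)] yz h(5) h2(5) by simp
    then show ?thesis using yz homotopic_paths_trans by blast
  qed
  show "\<exists>y. carried F (a # b # c # p) y \<and> homotopic_paths (underlying F) x y" if x: "carried F (a # c # p) x"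
  proof -
    obtain x1 x2 where h: "path x1" "path_image x1 \<subseteq> star F a" "carried F (c # p) x2" "pathfinish x1 = pathstart x2" "x = x1 +++ x2"
      using x by (rule carried_Cons)
    have j: "pathstart x2 \<in> star F a \<inter> star F c" using h carried_path(4)[OF h(3)] pathfinish_in_path_image[of x1] by auto
    obtain g1 where g1: "path g1" "path_image g1 \<subseteq> star F a" "pathfinish x1 = pathstart g1" "pathfinish g1 = ?m"
      using star_inter_path[OF fin j, of ?m] m h(4) by (metis IntI)
    obtain g2 where g2: "path g2" "path_image g2 \<subseteq> star F c" "pathstart g2 = ?m" "pathfinish g2 = pathstart x2"
      using star_inter_path[OF fin _ j, of ?m] m by (metis IntI)
    obtain y z where yz: "carried F (a # b # c # p) y" "carried F (a # c # p) z" "homotopic_paths (underlying F) y z"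
      "pathstart y = pathstart x1" "pathfinish y = pathfinish x2"
      using aux[OF h(1,2) g1 g2 h(3)] by blast
    have "homotopic_paths (underlying F) z x"
      using carried_unique[OF fin yz(2) x] yz h(5) homotopic_paths_imp_pathstart[OF yz(3)] homotopic_paths_imp_pathfinish[OF yz(3)] by simp
    then show ?thesis using yz homotopic_paths_trans homotopic_paths_sym by blast
  qed
qed

text \<open>
  Elementary homotopies use simplices of \<open>X\<close> that need not belong to the finite
  subcomplex at hand, so it is allowed to grow.
\<close>

definition transports :: "'v set set \<Rightarrow> 'v list \<Rightarrow> 'v list \<Rightarrow> bool" where
  "transports X vs ws \<longleftrightarrow> (\<forall>F x. finite F \<and> F \<subseteq> X \<and> carried F vs x \<longrightarrow>
     (\<exists>F' y. finite F' \<and> F \<subseteq> F' \<and> F' \<subseteq> X \<and> carried F' ws y \<and> homotopic_paths (underlying F') x y))"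

lemma transportsI:
  assumes "\<And>F x. finite F \<Longrightarrow> F \<subseteq> X \<Longrightarrow> carried F vs x \<Longrightarrow>
    \<exists>F' y. finite F' \<and> F \<subseteq> F' \<and> F' \<subseteq> X \<and> carried F' ws y \<and> homotopic_paths (underlying F') x y"
  shows "transports X vs ws"
  using assms unfolding transports_def by blast

lemma transportsD:
  assumes "transports X vs ws" "finite F" "F \<subseteq> X" "carried F vs x"
  obtains F' y where "finite F'" "F \<subseteq> F'" "F' \<subseteq> X" "carried F' ws y" "homotopic_paths (underlying F') x y"
proof -
  have "\<exists>F' y. finite F' \<and> F \<subseteq> F' \<and> F' \<subseteq> X \<and> carried F' ws y \<and> homotopic_paths (underlying F') x y"
    using assms(1)[unfolded transports_def, rule_format, of F x] assms(2-4) by simp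
  then show thesis by (elim exE conjE) (rule that)
qed

lemma transports_refl: "transports X p p"
proof (rule transportsI)
  fix F x assume h: "finite F" "F \<subseteq> X" "carried F p x"
  then have "homotopic_paths (underlying F) x x" using carried_path[OF h(3)] by simp
  then show "\<exists>F' y. finite F' \<and> F \<subseteq> F' \<and> F' \<subseteq> X \<and> carried F' p y \<and> homotopic_paths (underlying F') x y"
    using h by blast
qed

lemma transports_trans: assumes "transports X p q" "transports X q r" shows "transports X p r"
proof (rule transportsI)
  fix F x assume h: "finite F" "F \<subseteq> X" "carried F p x"
  obtain F' y where 1: "finite F'" "F \<subseteq> F'" "F' \<subseteq> X" "carried F' q y" "homotopic_paths (underlying F') x y"
    using transportsD[OF assms(1) h] by blast
  obtain F'' z where 2: "finite F''" "F' \<subseteq> F''" "F'' \<subseteq> X" "carried F'' r z" "homotopic_paths (underlying F'') y z"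
    using transportsD[OF assms(2) 1(1,3,4)] by blast
  have "homotopic_paths (underlying F'') x z"
    using homotopic_paths_subset[OF 1(5) underlying_mono[OF 2(2)]] 2(5) homotopic_paths_trans by blast
  then show "\<exists>F' y. finite F' \<and> F \<subseteq> F' \<and> F' \<subseteq> X \<and> carried F' r y \<and> homotopic_paths (underlying F') x y"
    using 1(2) 2(1-4) by (intro exI[of _ F''] exI[of _ z]) auto
qed

lemma transports_Cons: assumes "transports X p q" "p = [] \<longleftrightarrow> q = []" shows "transports X (a # p) (a # q)"
proof (cases p)
  case Nil then show ?thesis using assms transports_refl by simp
next
  case (Cons b p')
  show ?thesis
  proof (rule transportsI)
    fix F x assume h: "finite F" "F \<subseteq> X" "carried F (a # p) x"
    obtain x1 x2 where x: "path x1" "path_image x1 \<subseteq> star F a" "carried F p x2" "pathfinish x1 = pathstart x2" "x = x1 +++ x2"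
      using h(3) unfolding Cons by (rule carried_Cons)
    obtain F' y where 1: "finite F'" "F \<subseteq> F'" "F' \<subseteq> X" "carried F' q y" "homotopic_paths (underlying F') x2 y"
      using transportsD[OF assms(1) h(1,2) x(3)] by blast
    have x1: "path_image x1 \<subseteq> star F' a" using x(2) star_mono[OF 1(2)] by blast
    have "carried F' (a # q) (x1 +++ y)"
      using x x1 1 homotopic_paths_imp_pathstart[OF 1(5)] by (intro carried.more) auto
    moreover have "homotopic_paths (underlying F') x (x1 +++ y)"
      unfolding x(5) using x x1 1 star_sub[of F' a] by (intro homotopic_paths_join) auto
    ultimately show "\<exists>F' y. finite F' \<and> F \<subseteq> F' \<and> F' \<subseteq> X \<and> carried F' (a # q) y \<and> homotopic_paths (underlying F') x y"
      using 1(1-3) by (intro exI[of _ F'] exI[of _ "x1 +++ y"]) auto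
  qed
qed

lemma path_homotopic_transports:
  assumes X: "abstract_complex X" and "path_homotopic X p q"
  shows "transports X p q \<and> transports X q p \<and> (p = [] \<longleftrightarrow> q = [])"
  using assms(2)
proof (induction rule: path_homotopic.induct)
  case (refl p) then show ?case using transports_refl by simp
next
  case (trans p q r) then show ?case using transports_trans by blast
next
  case (dup a p)
  have fin: "F \<subseteq> X \<Longrightarrow> \<sigma> \<in> F \<Longrightarrow> finite \<sigma>" for F \<sigma> using X unfolding abstract_complex_def by blast
  have "transports X (a # a # p) (a # p)"
  proof (rule transportsI)
    fix F x assume h: "finite F" "F \<subseteq> X" "carried F (a # a # p) x"
    show "\<exists>F' y. finite F' \<and> F \<subseteq> F' \<and> F' \<subseteq> X \<and> carried F' (a # p) y \<and> homotopic_paths (underlying F') x y"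
      using carried_dup(1)[OF fin[OF h(2)] h(3)] h(1,2) by (intro exI[of _ F]) simp
  qed
  moreover have "transports X (a # p) (a # a # p)"
  proof (rule transportsI)
    fix F x assume h: "finite F" "F \<subseteq> X" "carried F (a # p) x"
    show "\<exists>F' y. finite F' \<and> F \<subseteq> F' \<and> F' \<subseteq> X \<and> carried F' (a # a # p) y \<and> homotopic_paths (underlying F') x y"
      using carried_dup(2)[OF fin[OF h(2)] h(3)] h(1,2) by (intro exI[of _ F]) simp
  qed
  ultimately show ?case by simp
next
  case (tri a b c p)
  have fin: "F \<subseteq> X \<Longrightarrow> \<sigma> \<in> F \<Longrightarrow> finite \<sigma>" for F \<sigma> using X unfolding abstract_complex_def by blast
  have ins: "carried (insert {a, b, c} F) vs x" if "carried F vs x" for F vs x using carried_mono[OF that] by blast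
  have "transports X (a # b # c # p) (a # c # p)"
  proof (rule transportsI)
    fix F x assume h: "finite F" "F \<subseteq> X" "carried F (a # b # c # p) x"
    have G: "insert {a, b, c} F \<subseteq> X" "{a, b, c} \<in> insert {a, b, c} F" using h tri by auto
    have fi: "finite \<sigma>" if "\<sigma> \<in> insert {a, b, c} F" for \<sigma> using fin[OF G(1) that] .
    have "\<exists>y. carried (insert {a, b, c} F) (a # c # p) y \<and> homotopic_paths (underlying (insert {a, b, c} F)) x y"
      by (rule carried_shortcut(1)[OF _ G(2) ins[OF h(3)]]) (rule fi)
    then obtain y where "carried (insert {a, b, c} F) (a # c # p) y"
      "homotopic_paths (underlying (insert {a, b, c} F)) x y" by (elim exE conjE)
    then show "\<exists>F' y. finite F' \<and> F \<subseteq> F' \<and> F' \<subseteq> X \<and> carried F' (a # c # p) y \<and> homotopic_paths (underlying F') x y"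
      using h(1) G(1) by (intro exI[of _ "insert {a, b, c} F"] exI[of _ y]) auto
  qed
  moreover have "transports X (a # c # p) (a # b # c # p)"
  proof (rule transportsI)
    fix F x assume h: "finite F" "F \<subseteq> X" "carried F (a # c # p) x"
    have G: "insert {a, b, c} F \<subseteq> X" "{a, b, c} \<in> insert {a, b, c} F" using h tri by auto
    have fi: "finite \<sigma>" if "\<sigma> \<in> insert {a, b, c} F" for \<sigma> using fin[OF G(1) that] .
    have "\<exists>y. carried (insert {a, b, c} F) (a # b # c # p) y \<and> homotopic_paths (underlying (insert {a, b, c} F)) x y"
      by (rule carried_shortcut(2)[OF _ G(2) ins[OF h(3)]]) (rule fi)
    then obtain y where "carried (insert {a, b, c} F) (a # b # c # p) y"
      "homotopic_paths (underlying (insert {a, b, c} F)) x y" by (elim exE conjE)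
    then show "\<exists>F' y. finite F' \<and> F \<subseteq> F' \<and> F' \<subseteq> X \<and> carried F' (a # b # c # p) y \<and> homotopic_paths (underlying F') x y"
      using h(1) G(1) by (intro exI[of _ "insert {a, b, c} F"] exI[of _ y]) auto
  qed
  ultimately show ?case by simp
next
  case (cons p q a) then show ?case using transports_Cons[of X p q a] transports_Cons[of X q p a] by simp
qed auto

definition piece :: "real \<Rightarrow> real \<Rightarrow> (real \<Rightarrow> 'a) \<Rightarrow> real \<Rightarrow> 'a" where
  "piece a b g = (\<lambda>x. g ((b - a) * x + a))"

lemma piece_mem: assumes "a \<le> b" "x \<in> {0..1}" shows "(b - a) * x + a \<in> {a..b::real}"
  using assms mult_left_le[of x "b - a"] by (auto simp: mult.commute)

lemma piece_ends [simp]: "pathstart (piece a b g) = g a" "pathfinish (piece a b g) = g b"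
  by (auto simp: piece_def pathstart_def pathfinish_def)

lemma piece_image: "0 \<le> a \<Longrightarrow> a \<le> b \<Longrightarrow> b \<le> 1 \<Longrightarrow> path_image (piece a b g) \<subseteq> g ` {a..b}"
  using piece_mem[of a b] by (auto simp: path_image_def piece_def)

lemma path_piece: assumes "path g" "0 \<le> a" "a \<le> b" "b \<le> 1" shows "path (piece a b g)"
  unfolding path_def piece_def
proof (rule continuous_on_compose2[of "{0..1}" g "{0..1}" "\<lambda>x. (b - a) * x + a"])
  show "continuous_on {0..1} g" using assms(1) by (simp add: path_def)
  show "continuous_on {0..1} (\<lambda>x. (b - a) * x + a)" by (intro continuous_intros)
  show "(\<lambda>x. (b - a) * x + a) ` {0..1} \<subseteq> {0..1}" using piece_mem[OF assms(3)] assms by fastforce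
qed

lemma homotopic_join_pieces:
  assumes g: "path g" "path_image g \<subseteq> S" and abc: "0 \<le> a" "a \<le> b" "b \<le> c" "c \<le> 1"
  shows "homotopic_paths S (piece a c g) (piece a b g +++ piece b c g)"
proof (cases "a = c")
  case True
  then have "b = a" using abc by simp
  then have "piece a b g +++ piece b c g = piece a c g" using True by (auto simp: piece_def joinpaths_def)
  then show ?thesis using path_piece[OF g(1), of a c] piece_image[of a c g] g(2) abc by (force simp: path_image_def)
next
  case False
  then have ac: "0 < c - a" using abc by simp
  define f where "f t = ((b - a) * min 1 (2 * t) + (c - b) * max 0 (2 * t - 1)) / (c - a)" for t :: real
  show ?thesis
  proof (rule homotopic_paths_reparametrize[where f = f])
    show "path (piece a c g)" using path_piece[OF g(1)] abc by simp
    show "path_image (piece a c g) \<subseteq> S" using piece_image[of a c g] g(2) abc by (force simp: path_image_def)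
    show "continuous_on {0..1} f"
      unfolding f_def using ac by (intro continuous_intros) auto
    show "f \<in> {0..1} \<rightarrow> {0..1}"
    proof
      fix t :: real assume t: "t \<in> {0..1}"
      have 1: "(b - a) * min 1 (2 * t) \<le> b - a" "0 \<le> (b - a) * min 1 (2 * t)"
        using t abc mult_left_le[of "min 1 (2 * t)" "b - a"] by (auto simp: mult.commute)
      have 2: "(c - b) * max 0 (2 * t - 1) \<le> c - b" "0 \<le> (c - b) * max 0 (2 * t - 1)"
        using t abc mult_left_le[of "max 0 (2 * t - 1)" "c - b"] by (auto simp: mult.commute)
      show "f t \<in> {0..1}" using 1 2 ac abc by (auto simp: f_def field_simps)
    qed
    show "f 0 = 0" "f 1 = 1" using ac by (auto simp: f_def)
    fix t :: real assume "t \<in> {0..1}"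
    show "(piece a b g +++ piece b c g) t = piece a c g (f t)"
      using ac by (auto simp: joinpaths_def piece_def f_def add.commute)
  qed
qed

text \<open>
  By compactness of the unit interval, in the form of Bolzano's bisection principle: near each
  parameter the path stays in the open star of a vertex, and concatenation appends the lists of
  vertices.
\<close>

lemma subdivide:
  assumes cov: "\<And>x. x \<in> underlying F \<Longrightarrow> \<exists>v. 0 < x v" and g: "path g" "path_image g \<subseteq> underlying F"
  shows "\<exists>vs p. carried F vs p \<and> homotopic_paths (underlying F) g p"
proof -
  have gc: "continuous_on {0..1} g" using g(1) by (simp add: path_def)
  define P where "P a b \<longleftrightarrow> (0 \<le> a \<and> a \<le> b \<and> b \<le> 1 \<longrightarrow>
    (\<exists>vs p. carried F vs p \<and> homotopic_paths (underlying F) (piece a b g) p))" for a b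
  have "P 0 1"
  proof (rule Bolzano)
    fix a b c :: real assume h: "P a b" "P b c" "a \<le> b" "b \<le> c"
    show "P a c"
      unfolding P_def
    proof
      assume ac: "0 \<le> a \<and> a \<le> c \<and> c \<le> 1"
      obtain vs p where p: "carried F vs p" "homotopic_paths (underlying F) (piece a b g) p" using h ac unfolding P_def by auto
      obtain ws q where q: "carried F ws q" "homotopic_paths (underlying F) (piece b c g) q" using h ac unfolding P_def by auto
      have e: "pathfinish p = pathstart q"
        using homotopic_paths_imp_pathfinish[OF p(2)] homotopic_paths_imp_pathstart[OF q(2)] by simp
      obtain r where r: "carried F (vs @ ws) r" "homotopic_paths (underlying F) (p +++ q) r"
        using carried_append[OF p(1) q(1) e] by blast
      have "homotopic_paths (underlying F) (piece a c g) (piece a b g +++ piece b c g)"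
        using g h ac by (intro homotopic_join_pieces) auto
      also have "homotopic_paths (underlying F) (piece a b g +++ piece b c g) (p +++ q)"
        using p q by (intro homotopic_paths_join) auto
      also note r(2)
      finally show "\<exists>vs p. carried F vs p \<and> homotopic_paths (underlying F) (piece a c g) p" using r(1) by blast
    qed
  next
    fix x :: real assume x: "0 \<le> x" "x \<le> 1"
    then have "g x \<in> underlying F" using g(2) by (auto simp: path_image_def)
    then obtain v where v: "0 < g x v" using cov by blast
    have "continuous_on {0..1} (\<lambda>t. g t v)" using continuous_on_product_then_coordinatewise[OF gc] .
    then obtain d where d: "d > 0" "\<And>y. y \<in> {0..1} \<Longrightarrow> dist y x < d \<Longrightarrow> dist (g y v) (g x v) < g x v"
      using v x unfolding continuous_on_iff by (metis atLeastAtMost_iff)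
    have "P a b" if ab: "a \<le> x" "x \<le> b" "b - a < d" for a b
      unfolding P_def
    proof
      assume ab1: "0 \<le> a \<and> a \<le> b \<and> b \<le> 1"
      have "g y \<in> star F v" if y: "y \<in> {a..b}" for y
      proof -
        have "dist (g y v) (g x v) < g x v" using d(2)[of y] y ab ab1 by (auto simp: dist_real_def)
        then have "0 < g y v" by (auto simp: dist_real_def)
        moreover have "g y \<in> underlying F" using g(2) y ab1 by (auto simp: path_image_def)
        ultimately show ?thesis by (simp add: star_def)
      qed
      then have im: "path_image (piece a b g) \<subseteq> star F v"
        using piece_image[of a b g] ab1 by auto
      have pa: "path (piece a b g)" using path_piece[OF g(1)] ab1 by simp
      have "carried F [v] (piece a b g)" using pa im by (rule carried.one)
      moreover have "homotopic_paths (underlying F) (piece a b g) (piece a b g)"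
        using pa im star_sub[of F v] by auto
      ultimately show "\<exists>vs p. carried F vs p \<and> homotopic_paths (underlying F) (piece a b g) p" by blast
    qed
    then show "\<exists>d>0. \<forall>a b. a \<le> x \<and> x \<le> b \<and> b - a < d \<longrightarrow> P a b" using d(1) by blast
  qed simp
  then show ?thesis by (simp add: P_def piece_def)
qed

lemma carried_edge_path:
  assumes X: "abstract_complex X" "F \<subseteq> X" and c: "carried F vs p"
  shows "edge_path X vs"
proof -
  have simp: "\<sigma> \<in> X" if x: "x \<in> underlying F" "\<sigma> \<noteq> {}" "\<And>v. v \<in> \<sigma> \<Longrightarrow> 0 < x v" for x \<sigma>
  proof -
    obtain \<tau> where t: "\<tau> \<in> F" "x \<in> closed_simplex \<tau>" using x(1) by (auto simp: underlying_def)
    then have "\<sigma> \<subseteq> \<tau>" using x(3) support[OF t(2)] by blast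
    moreover have "\<tau> \<in> X" using t X(2) by blast
    ultimately show ?thesis using face[OF X(1) _ _ x(2)] by blast
  qed
  show ?thesis
    using c
  proof (induction rule: carried.induct)
    case (one p v)
    have "pathstart p \<in> star F v" using one by auto
    then have "{v} \<in> X" using simp[of "pathstart p" "{v}"] by (auto simp: star_def)
    then show ?case by (simp add: edge_path_def)
  next
    case (more p v vs q)
    have 1: "pathstart p \<in> star F v" using more by auto
    have 2: "pathfinish p \<in> star F v" "pathfinish p \<in> star F (hd vs)"
      using more carried_path(4)[OF more(3)] pathfinish_in_path_image[of p] by auto
    have "{v} \<in> X" using simp[of "pathstart p" "{v}"] 1 by (auto simp: star_def)
    moreover have "{v, hd vs} \<in> X" using simp[of "pathfinish p" "{v, hd vs}"] 2 by (auto simp: star_def)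
    ultimately show ?case using more.IH by (cases vs) (auto simp: edge_path_def)
  qed
qed

theorem null_homotopic_in_subcomplex:
  assumes X: "abstract_complex X" and sc: "edge_simply_connected X"
    and F: "finite F" "F \<subseteq> X" and g: "path g" "path_image g \<subseteq> underlying F" "pathfinish g = pathstart g"
  shows "\<exists>F'. finite F' \<and> F' \<subseteq> X \<and> homotopic_paths (underlying F') g (\<lambda>_. pathstart g)"
proof -
  have fin: "F \<subseteq> X \<Longrightarrow> \<sigma> \<in> F \<Longrightarrow> finite \<sigma>" for F \<sigma> using X unfolding abstract_complex_def by blast
  have cov: "\<exists>v. 0 < x v" if x: "x \<in> underlying F" for x
  proof (rule ccontr)
    assume no: "\<not> (\<exists>v. 0 < x v)"
    obtain \<tau> where t: "\<tau> \<in> F" "x \<in> closed_simplex \<tau>" using x by (auto simp: underlying_def)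
    have "x v = 0" for v using no nonneg[OF t(2), of v] by (meson linorder_not_less order_antisym)
    then show False using t(2) by (simp add: closed_simplex_def)
  qed
  obtain vs p where p: "carried F vs p" "homotopic_paths (underlying F) g p" using subdivide[OF cov g(1,2)] by blast
  let ?x = "pathstart g"
  have ends: "pathstart p = ?x" "pathfinish p = ?x"
    using homotopic_paths_imp_pathstart[OF p(2)] homotopic_paths_imp_pathfinish[OF p(2)] g(3) by auto
  \<comment> \<open>With its first vertex appended, the list of stars becomes a closed edge
    path.\<close>
  define v where "v = hd vs"
  have xv: "?x \<in> star F v" using carried_path(4)[OF p(1)] ends v_def by simp
  have cv: "carried F [v] (\<lambda>_. ?x)" using const_path xv by (intro carried.one) auto
  have e1: "pathfinish p = pathstart (\<lambda>_::real. ?x)" using ends const_path(3) by metis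
  obtain r where r: "carried F (vs @ [v]) r" "homotopic_paths (underlying F) (p +++ (\<lambda>_. ?x)) r"
    using carried_append[OF p(1) cv e1] by blast
  have sub: "piece 1 1 p = (\<lambda>_. ?x)" using ends(2) by (auto simp: piece_def pathfinish_def)
  have "homotopic_paths (underlying F) (piece 0 1 p) (piece 0 1 p +++ piece 1 1 p)"
    using carried_path[OF p(1)] by (intro homotopic_join_pieces) auto
  then have "homotopic_paths (underlying F) p (p +++ (\<lambda>_. ?x))" unfolding sub by (simp add: piece_def)
  then have gr: "homotopic_paths (underlying F) g r"
    using p(2) r(2) homotopic_paths_trans homotopic_paths_sym by blast
  have "path_homotopic X (vs @ [v]) [v]"
    using sc carried_edge_path[OF X F(2) r(1)] carried_edge_path[OF X F(2) cv] carried_path(3)[OF p(1)]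
    unfolding edge_simply_connected_def v_def by simp
  then have "transports X (vs @ [v]) [v]" using path_homotopic_transports[OF X] by blast
  then obtain F' y where y: "finite F'" "F \<subseteq> F'" "F' \<subseteq> X" "carried F' [v] y" "homotopic_paths (underlying F') r y"
    by (rule transportsD[OF _ F r(1)])
  have gy: "homotopic_paths (underlying F') g y"
    using homotopic_paths_subset[OF gr underlying_mono[OF y(2)]] y(5) homotopic_paths_trans by blast
  have "homotopic_paths (underlying F') y (\<lambda>_. ?x)"
    using carried_unique[OF fin[OF y(3)] y(4) carried_mono[OF cv y(2)]] const_path(3,4)
      homotopic_paths_imp_pathstart[OF gy] homotopic_paths_imp_pathfinish[OF gy] g(3) by metis
  then have "homotopic_paths (underlying F') g (\<lambda>_. ?x)" by (rule homotopic_paths_trans[OF gy])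
  then show ?thesis using y(1,3) by (intro exI[of _ F']) simp
qed

lemma closed_closed_simplex: assumes "finite \<sigma>" shows "closed (closed_simplex \<sigma>)"
proof -
  have c: "continuous_on UNIV (\<lambda>x::'a \<Rightarrow> real. x v)" for v by (rule continuous_on_product_coordinates)
  have 1: "closed {x::'a \<Rightarrow> real. 0 \<le> x v}" for v by (intro closed_Collect_le c continuous_on_const)
  have 2: "closed {x::'a \<Rightarrow> real. x v = 0}" for v by (intro closed_Collect_eq c continuous_on_const)
  have 3: "closed {x::'a \<Rightarrow> real. (\<Sum>v\<in>\<sigma>. x v) = 1}" by (intro closed_Collect_eq continuous_on_sum c continuous_on_const)
  have "closed_simplex \<sigma> = (\<Inter>v. {x. 0 \<le> x v}) \<inter> (\<Inter>v\<in>-\<sigma>. {x. x v = 0}) \<inter> {x. (\<Sum>v\<in>\<sigma>. x v) = 1}"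
    by (auto simp: closed_simplex_def)
  moreover have "closed \<dots>" using 1 2 3 by (intro closed_Int closed_INT) auto
  ultimately show ?thesis by simp
qed

lemma closed_point: "closed {x :: 'a \<Rightarrow> real}"
proof -
  have "{x} = (\<Inter>v. {y. y v = x v})" by auto
  moreover have "closed {y. y v = x v}" for v
    by (intro closed_Collect_eq continuous_on_product_coordinates continuous_on_const)
  ultimately show ?thesis by (simp add: closed_INT)
qed

text \<open>
  A set which is open in the weak topology has a closed complement in each closed simplex. As closed
  simplices are closed in the product topology, a finite union of such complements is closed there.
\<close>

lemma continuous_inclusion:
  assumes "finite F" "F \<subseteq> X" "\<And>\<sigma>. \<sigma> \<in> F \<Longrightarrow> finite \<sigma>"
  shows "continuous_map (top_of_set (underlying F)) (realization X) (\<lambda>x. x)"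
  unfolding continuous_map_def
proof (intro conjI allI impI)
  show "(\<lambda>x. x) \<in> topspace (top_of_set (underlying F)) \<rightarrow> topspace (realization X)"
    using assms(2) by (auto simp: topspace_realization underlying_def)
  fix U assume "openin (realization X) U"
  then have U: "openin (top_of_set (closed_simplex \<sigma>)) (U \<inter> closed_simplex \<sigma>)" if "\<sigma> \<in> F" for \<sigma>
    using that assms(2) unfolding openin_realization by blast
  have "closed (closed_simplex \<sigma> - U)" if s: "\<sigma> \<in> F" for \<sigma>
  proof -
    have "closedin (top_of_set (closed_simplex \<sigma>)) (closed_simplex \<sigma> - U \<inter> closed_simplex \<sigma>)"
      using U[OF s] by (simp add: closedin_def double_diff)
    then show ?thesis using closedin_closed_trans closed_closed_simplex[OF assms(3)[OF s]] by (metis Diff_Int2 Int_absorb Diff_Int_distrib2 Int_commute inf.idem Diff_Int Diff_cancel sup_bot.right_neutral)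
  qed
  then have cl: "closed (\<Union>\<sigma>\<in>F. closed_simplex \<sigma> - U)" using assms(1) by (intro closed_UN) auto
  have "{x \<in> topspace (top_of_set (underlying F)). x \<in> U} = underlying F \<inter> - (\<Union>\<sigma>\<in>F. closed_simplex \<sigma> - U)"
    by (auto simp: underlying_def)
  then show "openin (top_of_set (underlying F)) {x \<in> topspace (top_of_set (underlying F)). x \<in> U}"
    using cl by (metis openin_open open_Compl)
qed

lemma continuous_forget: "continuous_map (realization X) euclidean (\<lambda>x. x)"
  unfolding continuous_map_def
proof (intro conjI allI impI)
  fix U :: "('a \<Rightarrow> real) set" assume "openin euclidean U"
  then have "open U" by simp
  then have "openin (top_of_set (closed_simplex \<sigma>)) ({x \<in> topspace (realization X). x \<in> U} \<inter> closed_simplex \<sigma>)" if "\<sigma> \<in> X" for \<sigma>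
  proof -
    have "{x \<in> topspace (realization X). x \<in> U} \<inter> closed_simplex \<sigma> = closed_simplex \<sigma> \<inter> U"
      using that by (auto simp: topspace_realization)
    then show ?thesis using \<open>open U\<close> by (metis openin_open)
  qed
  then show "openin (realization X) {x \<in> topspace (realization X). x \<in> U}"
    unfolding openin_realization by (auto simp: topspace_realization)
qed auto

text \<open>
  Choose one point of the compact set in each open simplex that the set meets. Every subset of the
  set of chosen points meets each closed simplex in a finite set, hence is closed in the weak
  topology. So the set of chosen points has no limit point and is finite.
\<close>

lemma compact_in_finite_subcomplex:
  assumes X: "abstract_complex X" and K: "compactin (realization X) K"
  shows "\<exists>F. finite F \<and> F \<subseteq> X \<and> K \<subseteq> underlying F"
proof -
  define supp :: "('a \<Rightarrow> real) \<Rightarrow> 'a set" where "supp x = {v. 0 < x v}" for x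
  have xs: "x \<in> closed_simplex (supp x) \<and> supp x \<in> X" if x: "x \<in> topspace (realization X)" for x
  proof -
    obtain \<sigma> where s: "\<sigma> \<in> X" "x \<in> closed_simplex \<sigma>" using x by (auto simp: topspace_realization)
    have sub: "supp x \<subseteq> \<sigma>" using support[OF s(2)] by (auto simp: supp_def)
    have fin: "finite \<sigma>" using X s unfolding abstract_complex_def by blast
    have z: "x v = 0" if "v \<notin> supp x" for v using that nonneg[OF s(2), of v] by (simp add: supp_def)
    have "(\<Sum>v\<in>supp x. x v) = (\<Sum>v\<in>\<sigma>. x v)" using z by (intro sum.mono_neutral_left fin sub) auto
    then have "(\<Sum>v\<in>supp x. x v) = 1" using s(2) by (simp add: closed_simplex_def)
    moreover from this have "supp x \<noteq> {}" by auto
    ultimately show ?thesis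
      using z nonneg[OF s(2)] face[OF X s(1) sub] by (auto simp: closed_simplex_def)
  qed
  have KX: "K \<subseteq> topspace (realization X)" using K by (rule compactin_subset_topspace)
  define pick where "pick \<sigma> = (SOME x. x \<in> K \<and> supp x = \<sigma>)" for \<sigma>
  have pick: "pick \<sigma> \<in> K \<and> supp (pick \<sigma>) = \<sigma>" if "\<sigma> \<in> supp ` K" for \<sigma>
  proof -
    from that obtain x where "x \<in> K" "supp x = \<sigma>" by blast
    then show ?thesis unfolding pick_def using someI[of "\<lambda>x. x \<in> K \<and> supp x = \<sigma>" x] by simp
  qed
  define D where "D = pick ` supp ` K"
  have D: "D \<subseteq> K" "inj_on supp D"
  proof -
    show "D \<subseteq> K" using pick unfolding D_def by (auto simp del: image_image)
    have "pick (supp x) = x" if "x \<in> D" for x using that pick unfolding D_def by (auto simp del: image_image)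
    then show "inj_on supp D" by (rule inj_on_inverseI)
  qed
  have fin: "finite D"
  proof (rule ccontr)
    assume inf: "infinite D"
    have "topspace (realization X) - E \<in> {U. openin (realization X) U}" if E: "E \<subseteq> D" for E
    proof -
      have "openin (top_of_set (closed_simplex \<sigma>)) ((topspace (realization X) - E) \<inter> closed_simplex \<sigma>)" if s: "\<sigma> \<in> X" for \<sigma>
      proof -
        have "supp ` (E \<inter> closed_simplex \<sigma>) \<subseteq> Pow \<sigma>" using support by (fastforce simp: supp_def)
        moreover have "finite \<sigma>" using X s unfolding abstract_complex_def by blast
        ultimately have "finite (supp ` (E \<inter> closed_simplex \<sigma>))" using finite_subset by blast
        then have "finite (E \<inter> closed_simplex \<sigma>)"
          using inj_on_subset[OF D(2)] E by (metis finite_imageD inf.coboundedI1)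
        then have "closed (\<Union>x\<in>E \<inter> closed_simplex \<sigma>. {x})" using closed_point by (intro closed_UN) auto
        then have "closed (E \<inter> closed_simplex \<sigma>)" by simp
        moreover have "(topspace (realization X) - E) \<inter> closed_simplex \<sigma> = closed_simplex \<sigma> \<inter> - (E \<inter> closed_simplex \<sigma>)"
          using s by (auto simp: topspace_realization)
        ultimately show ?thesis by (metis openin_open open_Compl)
      qed
      then show ?thesis unfolding mem_Collect_eq openin_realization by (auto simp: topspace_realization)
    qed
    then have op: "openin (realization X) (topspace (realization X) - E)" if "E \<subseteq> D" for E using that by blast
    obtain y where y: "y \<in> K" "y \<in> realization X derived_set_of D"
      using compactin_imp_Bolzano_Weierstrass[OF K] inf D(1) by blast
    have "y \<in> topspace (realization X) - (D - {y})" using y(1) KX by auto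
    then obtain z where "z \<noteq> y" "z \<in> D" "z \<in> topspace (realization X) - (D - {y})"
      using y(2)[unfolded in_derived_set_of, THEN conjunct2, rule_format, of "topspace (realization X) - (D - {y})"]
        op[of "D - {y}"] by auto
    then show False by simp
  qed
  have "supp ` D = supp ` K" using pick by (force simp: D_def image_iff)
  then have "supp ` K = supp ` D" by simp
  then have "finite (supp ` K)" using fin by simp
  moreover have "supp ` K \<subseteq> X" "K \<subseteq> underlying (supp ` K)" using xs KX by (auto simp: underlying_def)
  ultimately show ?thesis by blast
qed

theorem simply_connected_realization:
  assumes X: "abstract_complex X" and sc: "edge_simply_connected X"
  shows "simply_connected_space (realization X)"
proof -
  have fin: "F \<subseteq> X \<Longrightarrow> \<sigma> \<in> F \<Longrightarrow> finite \<sigma>" for F \<sigma> using X unfolding abstract_complex_def by blast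
  have incl: "pathin (realization X) g" if F: "finite F" "F \<subseteq> X" and g: "path g" "path_image g \<subseteq> underlying F" for F g
  proof -
    have c: "continuous_map (top_of_set {0..1}) (top_of_set (underlying F)) g"
      using g by (auto simp: path_def path_image_def)
    show ?thesis
      unfolding pathin_def using continuous_map_compose[OF c continuous_inclusion[OF F fin[OF F(2)]]]
      by (simp add: comp_def)
  qed
  have seg: "\<exists>g. pathin (realization X) g \<and> g 0 = x \<and> g 1 = y"
    if s: "\<sigma> \<in> X" "x \<in> closed_simplex \<sigma>" "y \<in> closed_simplex \<sigma>" for \<sigma> x y
    using incl[of "{\<sigma>}" "\<lambda>t. mix t x y"] line_in_stars(1,2)[of \<sigma> "{\<sigma>}" x y "{}"] s
    by (intro exI[of _ "\<lambda>t. mix t x y"]) auto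
  let ?R = "path_component_of (realization X)"
  have segR: "?R x y" if "\<sigma> \<in> X" "x \<in> closed_simplex \<sigma>" "y \<in> closed_simplex \<sigma>" for \<sigma> x y
    using seg[OF that] unfolding path_component_of_def .
  have vertR: "?R (vert (hd p)) (vert (last p))" if "edge_path X p" for p
    using that
  proof (induction p)
    case (Cons a p)
    show ?case
    proof (cases p)
      case Nil
      have "{a} \<in> X" using Cons.prems by (simp add: edge_path_def)
      then show ?thesis using Nil segR[of "{a}" "vert a" "vert a"] vert_in[of "{a}" a] by simp
    next
      case c: (Cons b q)
      have ab: "{a, b} \<in> X" using Cons.prems c by (simp add: edge_path_def)
      have "?R (vert a) (vert b)" using segR[OF ab] vert_in[of "{a, b}"] by simp
      moreover have "edge_path X p" using Cons.prems c face[OF X ab, of "{b}"] by (simp add: edge_path_def)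
      then have "?R (vert b) (vert (last p))" using Cons.IH c by simp
      ultimately show ?thesis using c path_component_of_trans by force
    qed
  qed (simp add: edge_path_def)
  have toV: "\<exists>v. {v} \<in> X \<and> ?R x (vert v)" if x: "x \<in> topspace (realization X)" for x
  proof -
    obtain \<sigma> where s: "\<sigma> \<in> X" "x \<in> closed_simplex \<sigma>" using x by (auto simp: topspace_realization)
    then obtain v where v: "v \<in> \<sigma>" using X unfolding abstract_complex_def by blast
    have f: "finite \<sigma>" using X s unfolding abstract_complex_def by blast
    then show ?thesis using segR[OF s vert_in[OF f v]] face[OF X s(1), of "{v}"] v by auto
  qed
  have "path_connected_space (realization X)"
    unfolding path_connected_space_iff_path_component
  proof (intro ballI)
    fix x y assume "x \<in> topspace (realization X)" "y \<in> topspace (realization X)"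
    then obtain v w where v: "{v} \<in> X" "?R x (vert v)" "{w} \<in> X" "?R y (vert w)" using toV by metis
    then obtain p where p: "edge_path X p" "hd p = v" "last p = w" using sc unfolding edge_simply_connected_def by blast
    then show "?R x y" using vertR[OF p(1)] v path_component_of_trans path_component_of_sym by metis
  qed
  moreover have "homotopic_with (\<lambda>r. r 0 = p 0 \<and> r 1 = p 0) (top_of_set {0..1}) (realization X) p (\<lambda>_. p 0)"
    if p: "pathin (realization X) p" "p 1 = p 0" for p
  proof -
    have "compactin (realization X) (p ` {0..1})"
      using image_compactin[of "top_of_set {0..1}" "{0..1}" "realization X" p] p(1)
      by (auto simp: pathin_def compactin_subtopology)
    then obtain F where F: "finite F" "F \<subseteq> X" "p ` {0..1} \<subseteq> underlying F"
      using compact_in_finite_subcomplex[OF X] by blast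
    have "continuous_map (top_of_set {0..1}) euclidean p"
      using continuous_map_compose[OF p(1)[unfolded pathin_def] continuous_forget] by (simp add: comp_def)
    then have "path p" by (simp add: path_def)
    moreover have "path_image p \<subseteq> underlying F" "pathfinish p = pathstart p"
      using F(3) p(2) by (auto simp: path_image_def pathstart_def pathfinish_def)
    ultimately obtain F' where F': "finite F'" "F' \<subseteq> X" "homotopic_paths (underlying F') p (\<lambda>_. pathstart p)"
      using null_homotopic_in_subcomplex[OF X sc F(1,2)] by blast
    have "homotopic_with (\<lambda>r. r 0 = p 0 \<and> r 1 = p 0) (top_of_set {0..1}) (realization X) ((\<lambda>x. x) \<circ> p) ((\<lambda>x. x) \<circ> (\<lambda>_. pathstart p))"
      using F'(3) unfolding homotopic_paths_def
      by (rule homotopic_with_compose_continuous_map_left[OF _ continuous_inclusion[OF F'(1,2) fin[OF F'(2)]]])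
        (use p(2) in \<open>auto simp: pathstart_def pathfinish_def\<close>)
    then show ?thesis by (simp add: comp_def pathstart_def)
  qed
  ultimately show ?thesis unfolding simply_connected_space_def by blast
qed

section \<open>Coxeter groups and the exchange condition\<close>

primrec alt :: "nat \<Rightarrow> 's \<Rightarrow> 's \<Rightarrow> 's list" where
  "alt 0 s t = []"
| "alt (Suc n) s t = s # alt n t s"

lemma length_alt [simp]: "length (alt n s t) = n" by (induction n arbitrary: s t) auto

lemma set_alt: "set (alt n s t) \<subseteq> {s, t}" by (induction n arbitrary: s t) auto

lemma alt_add: "alt (k + n) s t = alt k s t @ (if even k then alt n s t else alt n t s)"
  by (induction k arbitrary: s t) auto

lemma alt_snoc: "alt (Suc n) s t = alt n s t @ [if even n then s else t]"
  using alt_add[of n 1 s t] by auto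

lemma rev_alt: "rev (alt n s t) = (if even n then alt n t s else alt n s t)"
proof (induction n arbitrary: s t)
  case (Suc n)
  have "rev (alt (Suc n) s t) = rev (alt n t s) @ [s]" by simp
  also have "\<dots> = (if even n then alt n s t else alt n t s) @ [s]" using Suc[of t s] by simp
  also have "\<dots> = (if even (Suc n) then alt (Suc n) t s else alt (Suc n) s t)"
    using alt_snoc[of n s t] alt_snoc[of n t s] by (simp del: alt.simps)
  finally show ?case .
qed simp

locale coxeter =
  fixes S :: "'s set" and m :: "'s \<Rightarrow> 's \<Rightarrow> enat"
  assumes finite_S: "finite S" and matrix: "coxeter_matrix S m"
begin

lemma m_sym: "s \<in> S \<Longrightarrow> t \<in> S \<Longrightarrow> m s t = m t s"
  using matrix unfolding coxeter_matrix_def by (cases "s = t") auto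

text \<open>
  Equality in the Coxeter group of \<open>m\<close>, for words whose letters are all their own
  inverses. The square relation holds for every letter of the type, so that \<open>rev w\<close>
  inverts any word \<open>w\<close>.
\<close>

inductive ceq :: "'s list \<Rightarrow> 's list \<Rightarrow> bool" (infix \<open>\<doteq>\<close> 50) where
  refl: "w \<doteq> w"
| sym: "u \<doteq> v \<Longrightarrow> v \<doteq> u"
| trans: "u \<doteq> v \<Longrightarrow> v \<doteq> w \<Longrightarrow> u \<doteq> w"
| append: "u \<doteq> u' \<Longrightarrow> v \<doteq> v' \<Longrightarrow> u @ v \<doteq> u' @ v'"
| square: "[s, s] \<doteq> []"
| braid: "s \<in> S \<Longrightarrow> t \<in> S \<Longrightarrow> s \<noteq> t \<Longrightarrow> m s t = enat n \<Longrightarrow> alt n s t \<doteq> alt n t s"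

declare ceq.refl [simp, intro]

lemma ceq_sym_iff: "u \<doteq> v \<longleftrightarrow> v \<doteq> u" using ceq.sym by blast

lemma ceq_left: "u \<doteq> u' \<Longrightarrow> u @ v \<doteq> u' @ v" by (simp add: ceq.append)
lemma ceq_right: "v \<doteq> v' \<Longrightarrow> u @ v \<doteq> u @ v'" by (simp add: ceq.append)
lemma ceq_Cons: "v \<doteq> v' \<Longrightarrow> s # v \<doteq> s # v'" using ceq_right[of v v' "[s]"] by simp

lemma rev_right: "w @ rev w \<doteq> []"
proof (induction w)
  case (Cons s w)
  have h: "[s] @ ((w @ rev w) @ [s]) \<doteq> [s] @ ([] @ [s])" by (intro ceq_right ceq_left Cons.IH)
  then show ?case using ceq.trans[OF h, of "[]"] ceq.square[of s] by simp
qed simp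

lemma cancel1: "u @ w @ rev w @ v \<doteq> u @ v" using ceq_right[OF ceq_left[OF rev_right[of w], of v], of u] by simp
lemma cancel2: "u @ rev w @ w @ v \<doteq> u @ v" using cancel1[of u "rev w" v] by simp

lemmas [trans] = ceq.trans

lemma move_right: "u @ w \<doteq> v \<longleftrightarrow> u \<doteq> v @ rev w"
proof
  assume h: "u @ w \<doteq> v"
  have "u \<doteq> (u @ w) @ rev w" using ceq.sym[OF cancel1[of u w "[]"]] by simp
  also have "(u @ w) @ rev w \<doteq> v @ rev w" using h by (rule ceq_left)
  finally show "u \<doteq> v @ rev w" .
next
  assume h: "u \<doteq> v @ rev w"
  have "u @ w \<doteq> (v @ rev w) @ w" using h by (rule ceq_left)
  also have "(v @ rev w) @ w \<doteq> v" using cancel2[of v w "[]"] by simp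
  finally show "u @ w \<doteq> v" .
qed

lemma move_left: "w @ u \<doteq> v \<longleftrightarrow> u \<doteq> rev w @ v"
proof
  assume h: "w @ u \<doteq> v"
  have "u \<doteq> rev w @ (w @ u)" using ceq.sym[OF cancel2[of "[]" w u]] by simp
  also have "rev w @ (w @ u) \<doteq> rev w @ v" using h by (rule ceq_right)
  finally show "u \<doteq> rev w @ v" .
next
  assume h: "u \<doteq> rev w @ v"
  have "w @ u \<doteq> w @ (rev w @ v)" using h by (rule ceq_right)
  also have "w @ (rev w @ v) \<doteq> v" using cancel1[of "[]" w v] by simp
  finally show "w @ u \<doteq> v" .
qed

lemma rcancel: "u @ w \<doteq> v @ w \<longleftrightarrow> u \<doteq> v"
proof
  assume "u @ w \<doteq> v @ w"
  then have "u \<doteq> (v @ w) @ rev w" by (simp only: move_right)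
  also have "(v @ w) @ rev w \<doteq> v" using cancel1[of v w "[]"] by simp
  finally show "u \<doteq> v" .
qed (rule ceq_left)

lemma lcancel: "w @ u \<doteq> w @ v \<longleftrightarrow> u \<doteq> v"
proof
  assume "w @ u \<doteq> w @ v"
  then have "u \<doteq> rev w @ (w @ v)" by (simp only: move_left)
  also have "rev w @ (w @ v) \<doteq> v" using cancel2[of "[]" w v] by simp
  finally show "u \<doteq> v" .
qed (rule ceq_right)

lemma ceq_rev: assumes "u \<doteq> v" shows "rev u \<doteq> rev v"
proof -
  have "u @ rev v \<doteq> v @ rev v" using assms by (rule ceq_left)
  also have "v @ rev v \<doteq> []" by (rule rev_right)
  finally have "rev v \<doteq> rev u @ []" by (simp only: move_left)
  then show ?thesis by (simp add: ceq_sym_iff)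
qed

lemma ceq_length: "u \<doteq> v \<Longrightarrow> even (length u) = even (length v)"
  by (induction rule: ceq.induct) auto

lemma alt_full: assumes "alt n s t \<doteq> alt n t s" shows "alt (2 * n) s t \<doteq> []"
proof -
  have "alt (2 * n) s t = alt n s t @ rev (alt n t s)"
    using alt_add[of n n s t] by (simp add: mult_2 rev_alt)
  then show ?thesis using ceq.trans[OF ceq_left[OF assms, of "rev (alt n t s)"] rev_right] by simp
qed

lemma alt_opposite:
  assumes "alt n s t \<doteq> alt n t s" "i < n"
  shows "alt (2 * (n - 1 - i) + 1) t s \<doteq> alt (2 * i + 1) s t"
proof -
  have e: "(2 * i + 1) + (2 * (n - 1 - i) + 1) = 2 * n" using assms(2) by simp
  have "alt (2 * n) s t = alt (2 * i + 1) s t @ alt (2 * (n - 1 - i) + 1) t s"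
    using alt_add[of "2 * i + 1" "2 * (n - 1 - i) + 1" s t] e by (simp del: alt.simps)
  then have "alt (2 * (n - 1 - i) + 1) t s \<doteq> rev (alt (2 * i + 1) s t) @ []"
    using alt_full[OF assms(1)] move_left by metis
  then show ?thesis by (simp add: rev_alt del: alt.simps)
qed

text \<open>
  A word crosses the reflections \<open>s\<^sub>1\<close>, \<open>s\<^sub>1 s\<^sub>2
  s\<^sub>1\<close>, \<open>s\<^sub>1 s\<^sub>2 s\<^sub>3 s\<^sub>2 s\<^sub>1\<close> and so on. The
  parity of the number of times that it crosses a given \<open>r\<close> is an invariant of the
  group element; this is the sign in the permutation representation of the Coxeter group on
  reflections and signs.
\<close>

primrec crossing_parity :: "'s list \<Rightarrow> 's list \<Rightarrow> bool" where
  "crossing_parity [] r \<longleftrightarrow> False"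
| "crossing_parity (s # w) r \<longleftrightarrow> (([s] \<doteq> r) \<noteq> crossing_parity w (s # r @ [s]))"

lemma crossing_parity_cong: "r \<doteq> r' \<Longrightarrow> crossing_parity w r = crossing_parity w r'"
proof (induction w arbitrary: r r')
  case (Cons s w)
  have "[s] \<doteq> r \<longleftrightarrow> [s] \<doteq> r'" using Cons.prems ceq.trans ceq.sym by blast
  moreover have "s # r @ [s] \<doteq> s # r' @ [s]" by (intro ceq_Cons ceq_left Cons.prems)
  ultimately show ?case using Cons.IH by simp
qed simp

lemma crossing_parity_append: "crossing_parity (u @ v) r = (crossing_parity u r \<noteq> crossing_parity v (rev u @ r @ u))"
  by (induction u arbitrary: r) auto

lemma conj_iff: "[s] \<doteq> t # r @ [t] \<longleftrightarrow> t # s # [t] \<doteq> r"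
  using move_left[of "[t]" "r @ [t]" "[s]"] move_right[of r "[t]" "[t, s]"] by (auto simp: ceq_sym_iff)

lemma conj_iff': "w \<doteq> t # r @ [t] \<longleftrightarrow> t # w @ [t] \<doteq> r"
  using move_left[of "[t]" "r @ [t]" "w"] move_right[of r "[t]" "[t] @ w"] by (auto simp: ceq_sym_iff)

lemma card_less_Suc_split: "card {i. i < Suc n \<and> P i} = (if P 0 then 1 else 0) + card {i. i < n \<and> P (Suc i)}"
proof -
  have "{i. i < Suc n \<and> P i} = {i. i = 0 \<and> P 0} \<union> Suc ` {i. i < n \<and> P (Suc i)}"
    by (auto simp: image_iff less_Suc_eq_0_disj)
  also have "card \<dots> = card {i. i = (0::nat) \<and> P 0} + card (Suc ` {i. i < n \<and> P (Suc i)})"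
    by (intro card_Un_disjoint) auto
  also have "\<dots> = (if P 0 then 1 else 0) + card {i. i < n \<and> P (Suc i)}"
    by (simp add: card_image)
  finally show ?thesis .
qed

lemma crossing_parity_alt: "crossing_parity (alt n s t) r = odd (card {i. i < n \<and> alt (2 * i + 1) s t \<doteq> r})"
proof (induction n arbitrary: s t r)
  case (Suc n)
  have "alt (2 * i + 1) t s \<doteq> s # r @ [s] \<longleftrightarrow> alt (2 * Suc i + 1) s t \<doteq> r" for i
  proof -
    have "alt (2 * Suc i + 1) s t = s # alt (2 * i + 1) t s @ [s]"
      using alt_snoc[of "2 * i + 1" t s] by simp
    then show ?thesis using conj_iff' by metis
  qed
  then show ?case using card_less_Suc_split[of n "\<lambda>i. alt (2 * i + 1) s t \<doteq> r"] Suc.IH[of t s "s # r @ [s]"] by simp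
qed simp

text \<open>
  The two sides of a braid relation cross the same reflections in opposite order.
\<close>

lemma crossing_parity_ceq: "u \<doteq> v \<Longrightarrow> crossing_parity u r = crossing_parity v r"
proof (induction arbitrary: r rule: ceq.induct)
  case (append u u' v v')
  have "rev u @ r @ u \<doteq> rev u' @ r @ u'" using append by (intro ceq.append ceq_rev ceq.refl)
  then show ?case using append crossing_parity_cong by (simp add: crossing_parity_append)
next
  case (square s)
  have "[s] \<doteq> s # r @ [s] \<longleftrightarrow> [s] \<doteq> r"
  proof -
    have "s # s # [s] \<doteq> [s]" using ceq_left[OF ceq.square, of s "[s]"] by simp
    then show ?thesis using conj_iff[of s s r] ceq.trans ceq.sym by blast
  qed
  then show ?case by simp
next
  case (braid s t n)
  have b: "alt n s t \<doteq> alt n t s" using braid by (rule ceq.braid)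
  have "bij_betw (\<lambda>i. n - 1 - i) {i. i < n \<and> alt (2 * i + 1) s t \<doteq> r} {i. i < n \<and> alt (2 * i + 1) t s \<doteq> r}"
  proof (rule bij_betwI[where g = "\<lambda>i. n - 1 - i"])
    show "(\<lambda>i. n - 1 - i) \<in> {i. i < n \<and> alt (2 * i + 1) s t \<doteq> r} \<rightarrow> {i. i < n \<and> alt (2 * i + 1) t s \<doteq> r}"
      using ceq.trans[OF alt_opposite[OF b]] by auto
    show "(\<lambda>i. n - 1 - i) \<in> {i. i < n \<and> alt (2 * i + 1) t s \<doteq> r} \<rightarrow> {i. i < n \<and> alt (2 * i + 1) s t \<doteq> r}"
      using ceq.trans[OF alt_opposite[OF ceq.sym[OF b]]] by auto
  qed auto
  from bij_betw_same_card[OF this] show ?case by (simp only: crossing_parity_alt)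
next
  case (trans u v w) then show ?case by simp
qed simp_all

text \<open>
  If a word crosses \<open>r\<close>, then multiplication by \<open>r\<close> deletes the letter at
  which it does so.
\<close>

lemma crossing_parity_delete: "crossing_parity w r \<Longrightarrow> \<exists>u s v. w = u @ [s] @ v \<and> r @ w \<doteq> u @ v"
proof (induction w arbitrary: r)
  case (Cons s w)
  show ?case
  proof (cases "[s] \<doteq> r")
    case True
    then have "r @ (s # w) \<doteq> [s] @ (s # w)" using ceq_left ceq.sym by blast
    also have "[s] @ (s # w) \<doteq> w" using ceq_left[OF ceq.square[of s], of w] by simp
    finally have "r @ (s # w) \<doteq> [] @ w" by simp
    then show ?thesis by (metis append_Cons append_Nil)
  next
    case False
    then have "crossing_parity w (s # r @ [s])" using Cons.prems by simp
    then obtain u t v where h: "w = u @ [t] @ v" "(s # r @ [s]) @ w \<doteq> u @ v" using Cons.IH by blast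
    have "r @ (s # w) \<doteq> [s] @ (u @ v)"
      using h(2) move_left[of "[s]" "r @ [s] @ w" "u @ v"] by simp
    then show ?thesis using h(1) by (metis append_Cons append_Nil)
  qed
qed simp

definition len :: "'s list \<Rightarrow> nat" where "len w = (LEAST k. \<exists>v. w \<doteq> v \<and> length v = k)"

lemma len_ex: "\<exists>v. w \<doteq> v \<and> length v = len w"
  unfolding len_def by (rule LeastI_ex) blast

lemma len_le: "w \<doteq> v \<Longrightarrow> len w \<le> length v"
  unfolding len_def by (rule Least_le) blast

lemma len_cong: "u \<doteq> v \<Longrightarrow> len u = len v"
  using len_ex len_le ceq.trans ceq.sym by (metis order_antisym)

lemma len_le_length: "len w \<le> length w" by (simp add: len_le)

lemma len_rev: "len (rev w) = len w"
proof -
  have "len (rev w) \<le> len w" for w using len_ex[of w] len_le[OF ceq_rev] by (metis length_rev)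
  from this[of w] this[of "rev w"] show ?thesis by simp
qed

lemma len_append_le: "len (u @ v) \<le> len u + len v"
  using len_ex[of u] len_ex[of v] len_le[OF ceq.append] by (metis length_append)

lemma len_snoc: "len (w @ [s]) \<le> Suc (len w)" "len w \<le> Suc (len (w @ [s]))" "len (w @ [s]) \<noteq> len w"
proof -
  have 1: "len (w @ [s]) \<le> Suc (len w)" for w using len_append_le[of w "[s]"] len_le_length[of "[s]"] by simp
  then show "len (w @ [s]) \<le> Suc (len w)" .
  have "len ((w @ [s]) @ [s]) = len w" using cancel1[of w "[s]" "[]"] by (intro len_cong) simp
  then show "len w \<le> Suc (len (w @ [s]))" using 1[of "w @ [s]"] by simp
  have p: "even (len w) = even (length w)" for w using len_ex[of w] ceq_length by metis
  show "len (w @ [s]) \<noteq> len w" using p[of w] p[of "w @ [s]"] by auto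
qed

lemma len_eq_0: "len w = 0 \<longleftrightarrow> w \<doteq> []"
  using len_ex[of w] len_le[of w "[]"] by auto

text \<open>
  The reflection \<open>r\<close> with \<open>r w = w s\<close> is crossed by every word for
  \<open>w\<close>. By invariance of the parity it suffices to see this for \<open>u s\<close>,
  where \<open>u\<close> is a reduced word for \<open>w s\<close>: the last letter crosses
  \<open>r\<close>, and \<open>u\<close> cannot, since deleting a letter from it would give a word
  for \<open>w\<close> that is shorter than the length of \<open>w\<close>.
\<close>

lemma exchange:
  assumes "len (w @ [s]) < len w" "w \<doteq> v"
  shows "\<exists>a t b. v = a @ [t] @ b \<and> w @ [s] \<doteq> a @ b"
proof -
  let ?r = "w @ [s] @ rev w"
  obtain u where u: "w @ [s] \<doteq> u" "length u = len (w @ [s])" using len_ex by blast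
  have wu: "w \<doteq> u @ [s]" using u(1) move_right[of w "[s]" u] by simp
  have ru: "?r @ u \<doteq> w"
  proof -
    have "?r @ u \<doteq> ?r @ (w @ [s])" by (rule ceq_right[OF ceq.sym[OF u(1)]])
    also have "?r @ (w @ [s]) \<doteq> w @ [s, s]" using cancel2[of "w @ [s]" w "[s]"] by simp
    also have "w @ [s, s] \<doteq> w" using ceq_right[OF ceq.square[of s], of w] by simp
    finally show ?thesis .
  qed
  have "\<not> crossing_parity u ?r"
  proof
    assume "crossing_parity u ?r"
    then obtain a t b where h: "u = a @ [t] @ b" "?r @ u \<doteq> a @ b" using crossing_parity_delete by blast
    then have "w \<doteq> a @ b" using ru ceq.trans ceq.sym by blast
    then have "len w \<le> length (a @ b)" by (rule len_le)
    then show False using h(1) u(2) assms(1) by simp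
  qed
  moreover have "[s] \<doteq> rev u @ ?r @ u"
  proof -
    have "rev u @ ?r @ u \<doteq> rev u @ w" using ru by (rule ceq_right)
    also have "rev u @ w \<doteq> rev u @ (u @ [s])" using wu by (rule ceq_right)
    also have "rev u @ (u @ [s]) \<doteq> [s]" using cancel2[of "[]" u "[s]"] by simp
    finally show ?thesis by (rule ceq.sym)
  qed
  ultimately have "crossing_parity (u @ [s]) ?r" by (simp add: crossing_parity_append)
  then have "crossing_parity v ?r" using crossing_parity_ceq wu assms(2) by blast
  then obtain a t b where h: "v = a @ [t] @ b" "?r @ v \<doteq> a @ b" using crossing_parity_delete by blast
  have "?r @ v \<doteq> w @ [s]"
  proof -
    have "?r @ v \<doteq> (w @ [s] @ rev w) @ w" by (rule ceq_right[OF ceq.sym[OF assms(2)]])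
    also have "(w @ [s] @ rev w) @ w \<doteq> w @ [s]" using cancel2[of "w @ [s]" w "[]"] by simp
    finally show ?thesis .
  qed
  then show ?thesis using h ceq.trans ceq.sym by blast
qed

lemma exchange_left:
  assumes "len (s # w) < len w" "w \<doteq> v"
  shows "\<exists>a t b. v = a @ [t] @ b \<and> s # w \<doteq> a @ b"
proof -
  have "len (rev w @ [s]) < len (rev w)" using assms(1) len_rev[of w] len_rev[of "s # w"] by simp
  then obtain a t b where h: "rev v = a @ [t] @ b" "rev w @ [s] \<doteq> a @ b"
    using exchange ceq_rev[OF assms(2)] by blast
  have "v = rev b @ [t] @ rev a" using arg_cong[OF h(1), of rev] by simp
  moreover have "s # w \<doteq> rev b @ rev a" using ceq_rev[OF h(2)] by simp
  ultimately show ?thesis by blast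
qed

text \<open>
  Reduction only deletes letters, so an element of a parabolic subgroup has its length realized
  inside this subgroup.
\<close>

lemma reduced_subword: "\<exists>v. w \<doteq> v \<and> length v = len w \<and> set v \<subseteq> set w"
proof (induction w rule: rev_induct)
  case Nil then show ?case using len_eq_0[of "[]"] by auto
next
  case (snoc s w)
  then obtain v where v: "w \<doteq> v" "length v = len w" "set v \<subseteq> set w" by blast
  have ws: "w @ [s] \<doteq> v @ [s]" using v(1) by (rule ceq_left)
  show ?case
  proof (cases "len (w @ [s]) < len w")
    case True
    then obtain a t b where h: "v = a @ [t] @ b" "w @ [s] \<doteq> a @ b" using exchange v(1) by blast
    then have "length (a @ b) = len (w @ [s])" using len_le[OF h(2)] len_snoc[of w s] v(2) True by auto
    then show ?thesis using h v(3) by (intro exI[of _ "a @ b"]) auto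
  next
    case False
    then have "len (w @ [s]) = Suc (len w)" using len_snoc[of w s] by linarith
    then show ?thesis using ws v by (intro exI[of _ "v @ [s]"]) auto
  qed
qed

section \<open>Minimal coset representatives\<close>

definition minimal :: "'s set \<Rightarrow> 's list \<Rightarrow> bool" where
  "minimal T x \<longleftrightarrow> (\<forall>v\<in>lists T. len x \<le> len (v @ x))"

definition coset :: "'s set \<Rightarrow> 's list \<Rightarrow> 's list set" where
  "coset T x = {y. \<exists>v\<in>lists T. y \<doteq> v @ x}"

lemma coset_self: "x \<in> coset T x" unfolding coset_def by (auto intro!: bexI[of _ "[]"])

lemma coset_eq_iff: "coset T x = coset T y \<longleftrightarrow> (\<exists>v\<in>lists T. y \<doteq> v @ x)"
proof
  assume "coset T x = coset T y"
  then show "\<exists>v\<in>lists T. y \<doteq> v @ x" using coset_self[of y T] unfolding coset_def by auto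
next
  assume "\<exists>v\<in>lists T. y \<doteq> v @ x"
  then obtain v where v: "v \<in> lists T" "y \<doteq> v @ x" by blast
  then have v': "rev v \<in> lists T" "x \<doteq> rev v @ y" using move_left[of v x y] by (auto simp: ceq_sym_iff)
  have sub: "coset T a \<subseteq> coset T b" if ac: "c \<in> lists T" "a \<doteq> c @ b" for a b c
  proof
    fix z assume "z \<in> coset T a"
    then obtain d where d: "d \<in> lists T" "z \<doteq> d @ a" unfolding coset_def by blast
    have "z \<doteq> (d @ c) @ b" using ceq.trans[OF d(2) ceq_right[OF ac(2), of d]] by simp
    then show "z \<in> coset T b" using d(1) ac(1) unfolding coset_def by (auto intro!: bexI[of _ "d @ c"])
  qed
  show "coset T x = coset T y" using sub[OF v] sub[OF v'] by blast
qed

lemma coset_cong: "x \<doteq> y \<Longrightarrow> coset T x = coset T y"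
  unfolding coset_eq_iff by (rule bexI[of _ "[]"]) (simp_all add: ceq_sym_iff)

lemma coset_right: "coset T x = coset T y \<Longrightarrow> coset T (x @ u) = coset T (y @ u)"
  unfolding coset_eq_iff using ceq_left by (metis append_assoc)

lemma coset_cancel: "coset T (x @ u) = coset T (y @ u) \<longleftrightarrow> coset T x = coset T y"
proof
  assume "coset T (x @ u) = coset T (y @ u)"
  then have "coset T ((x @ u) @ rev u) = coset T ((y @ u) @ rev u)" by (rule coset_right)
  then show "coset T x = coset T y" using coset_cong[OF cancel1[of _ u "[]"]] by simp
qed (rule coset_right)

lemma coset_left: "v \<in> lists T \<Longrightarrow> coset T (v @ x) = coset T x"
proof -
  assume "v \<in> lists T"
  then have "coset T x = coset T (v @ x)" unfolding coset_eq_iff by auto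
  then show ?thesis by simp
qed

text \<open>
  Otherwise the exchange condition, applied to a reduced word of \<open>v\<close> followed by one of
  \<open>x\<close>, deletes a letter. Deletion in the first part contradicts its reducedness, and
  deletion in the second part gives an element of the coset of \<open>x\<close> which is shorter
  than \<open>x\<close>.
\<close>

lemma minimal_additive: assumes x: "minimal T x" and v: "v \<in> lists T" shows "len (v @ x) = len v + len x"
proof -
  have *: "len (v @ x) = length v + len x" if "v \<in> lists T" "length v = len v" for v
    using that
  proof (induction v rule: list.induct)
    case (Cons t v)
    have tv: "t \<in> T" "v \<in> lists T" using Cons.prems(1) by auto
    have "len (t # v) \<le> Suc (len v)"
      using len_append_le[of "[t]" v] len_le_length[of "[t]"] by simp
    then have red: "length v = len v" using Cons.prems(2) len_le_length[of v] by simp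
    have IH: "len (v @ x) = length v + len x" using Cons.IH[OF tv(2) red] .
    show ?case
    proof (rule ccontr)
      assume ne: "len ((t # v) @ x) \<noteq> length (t # v) + len x"
      have "len ((t # v) @ x) \<le> length (t # v) + len x" using len_append_le[of "t # v" x] Cons.prems(2) by simp
      moreover have "len (t # (v @ x)) \<noteq> len (v @ x)"
        using len_snoc(3)[of "rev (v @ x)" t] len_rev[of "v @ x"] len_rev[of "t # (v @ x)"] by simp
      ultimately have less: "len (t # (v @ x)) < len (v @ x)" using ne IH by simp
      obtain y where y: "x \<doteq> y" "length y = len x" using len_ex by blast
      obtain a u b where h: "v @ y = a @ [u] @ b" "t # (v @ x) \<doteq> a @ b"
        using exchange_left[OF less ceq_right[OF y(1)]] by blast
      show False
      proof (cases "length a < length v")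
        case True
        then have "a @ [u] = take (Suc (length a)) v"
          using arg_cong[OF h(1), of "take (Suc (length a))"] by simp
        then obtain c where c: "v = a @ [u] @ c" by (metis append_take_drop_id append_assoc)
        then have "b = c @ y" using h(1) by simp
        then have "t # (v @ x) \<doteq> (a @ c) @ y" using h(2) by simp
        also have "(a @ c) @ y \<doteq> (a @ c) @ x" by (rule ceq_right[OF ceq.sym[OF y(1)]])
        finally have "(t # v) @ x \<doteq> (a @ c) @ x" by simp
        then have "len (t # v) \<le> length (a @ c)" using rcancel len_le by blast
        then show False using Cons.prems(2) c by simp
      next
        case False
        then have "a = v @ drop (length v) a" using arg_cong[OF h(1), of "take (length v)"] by (metis append_take_drop_id append_eq_conv_conj take_all_iff not_less take_append diff_is_0_eq' take0 append_Nil2)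
        then obtain c where c: "a = v @ c" by blast
        then have y': "y = c @ [u] @ b" using h(1) by simp
        have "v @ (c @ b) \<doteq> ([t] @ v) @ x" using h(2) c by (simp add: ceq_sym_iff)
        then have "c @ b \<doteq> (rev v @ [t] @ v) @ x" using move_left[of v "c @ b"] by simp
        then have "len ((rev v @ [t] @ v) @ x) \<le> length (c @ b)" using len_le ceq.sym by blast
        moreover have "rev v @ [t] @ v \<in> lists T" using tv by auto
        then have "len x \<le> len ((rev v @ [t] @ v) @ x)" using x unfolding minimal_def by blast
        ultimately show False using y' y(2) by simp
      qed
    qed
  qed simp
  obtain v' where v': "v \<doteq> v'" "length v' = len v" "set v' \<subseteq> set v" using reduced_subword by blast
  have "len (v @ x) = len (v' @ x)" using v'(1) by (intro len_cong ceq_left)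
  also have "\<dots> = length v' + len x" using *[of v'] v' v len_cong[OF v'(1)] by auto
  finally show ?thesis using v'(2) by simp
qed

lemma minimal_exists: "\<exists>y. minimal T y \<and> coset T y = coset T x"
proof -
  obtain v where v: "v \<in> lists T" "\<And>u. u \<in> lists T \<Longrightarrow> len (v @ x) \<le> len (u @ x)"
    using ex_has_least_nat[of "\<lambda>v. v \<in> lists T" "[]" "\<lambda>v. len (v @ x)"] by auto
  have "len (v @ x) \<le> len (u @ v @ x)" if "u \<in> lists T" for u
    using v(2)[of "u @ v"] that v(1) by simp
  then have "minimal T (v @ x)" by (auto simp: minimal_def)
  then show ?thesis using coset_left[OF v(1)] by blast
qed

lemma minimal_unique: assumes "minimal T x" "minimal T y" "coset T x = coset T y" shows "x \<doteq> y"
proof -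
  obtain v where v: "v \<in> lists T" "y \<doteq> v @ x" using assms(3) unfolding coset_eq_iff by blast
  have 1: "len y = len v + len x" using len_cong[OF v(2)] minimal_additive[OF assms(1) v(1)] by simp
  have "len y \<le> len (rev v @ y)" using assms(2) v(1) unfolding minimal_def by (simp add: in_lists_conv_set)
  also have "len (rev v @ y) = len x" using move_left[of v x y] v(2) by (intro len_cong) (auto simp: ceq_sym_iff)
  finally have "v \<doteq> []" using 1 len_eq_0 by simp
  then have "v @ x \<doteq> x" using ceq_left[of v "[]" x] by simp
  then show ?thesis using v(2) ceq.trans ceq.sym by blast
qed

lemma not_minimal_descent:
  assumes "\<not> minimal T y" shows "\<exists>t\<in>T. len (t # y) < len y"
proof -
  obtain x where x: "minimal T x" "coset T x = coset T y" using minimal_exists by blast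
  obtain v0 where v0: "v0 \<in> lists T" "y \<doteq> v0 @ x" using x(2) unfolding coset_eq_iff by blast
  obtain v where v: "v0 \<doteq> v" "length v = len v0" "set v \<subseteq> set v0" using reduced_subword by blast
  have vT: "v \<in> lists T" using v(3) v0(1) by auto
  have y: "y \<doteq> v @ x" using v0(2) ceq_left[OF v(1), of x] ceq.trans by blast
  have ly: "len y = length v + len x"
    using minimal_additive[OF x(1) vT] len_cong[OF y] len_cong[OF v(1)] v(2) by simp
  show ?thesis
  proof (cases v)
    case Nil
    have "len y \<le> len (u @ y)" if "u \<in> lists T" for u
    proof -
      have "u @ y \<doteq> u @ x" using y Nil by (intro ceq_right) simp
      then show ?thesis using that x(1) ly Nil len_cong unfolding minimal_def by auto
    qed
    then show ?thesis using assms unfolding minimal_def by blast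
  next
    case (Cons t u)
    have "t # y \<doteq> u @ x" using y Cons move_left[of "[t]" "u @ x" y] by (auto simp: ceq_sym_iff)
    then have "len (t # y) \<le> length u + len x"
      using len_cong[of "t # y" "u @ x"] len_append_le[of u x] len_le_length[of u] by simp
    then have "len (t # y) < len y" using ly Cons by simp
    moreover have "t \<in> T" using Cons vT by simp
    ultimately show ?thesis by blast
  qed
qed

text \<open>
  Deodhar's lemma: right multiplication by a generator moves the minimal representative to a minimal
  representative, or fixes its coset and acts there as left multiplication by a generator in
  \<open>T\<close>. It is the source of the labels in the projection of words.
\<close>

lemma deodhar:
  assumes x: "minimal T x"
  shows "minimal T (x @ [s]) \<or> (\<exists>t\<in>T. x @ [s] \<doteq> t # x)"
proof (rule disjCI)
  assume no: "\<not> (\<exists>t\<in>T. x @ [s] \<doteq> t # x)"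
  show "minimal T (x @ [s])"
  proof (rule ccontr)
    assume "\<not> minimal T (x @ [s])"
    then obtain t where t: "t \<in> T" "len (t # x @ [s]) < len (x @ [s])" using not_minimal_descent by auto
    have tx: "len (t # x) = Suc (len x)"
    proof -
      have "len x \<le> len ([t] @ x)" using x t(1) unfolding minimal_def by (metis lists.Cons lists.Nil)
      moreover have "len (t # x) \<noteq> len x" using len_snoc(3)[of "rev x" t] len_rev[of x] len_rev[of "t # x"] by simp
      moreover have "len (t # x) \<le> Suc (len x)" using len_append_le[of "[t]" x] len_le_length[of "[t]"] by simp
      ultimately show ?thesis by simp
    qed
    have "len (t # x) \<le> Suc (len ((t # x) @ [s]))" by (rule len_snoc)
    then have "len x \<le> len (t # x @ [s])" using tx by simp
    then have xs: "len (x @ [s]) = Suc (len x)" using t(2) len_snoc(1)[of x s] by simp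
    obtain y where y: "x \<doteq> y" "length y = len x" using len_ex by blast
    obtain a u b where h: "y @ [s] = a @ [u] @ b" "t # x @ [s] \<doteq> a @ b"
      using exchange_left[OF t(2) ceq_left[OF y(1)]] by blast
    show False
    proof (cases b rule: rev_cases)
      case Nil
      then have "t # x @ [s] \<doteq> y" using h by simp
      also have "y \<doteq> x" using y(1) by (rule ceq.sym)
      finally have "t # x @ [s] \<doteq> x" .
      then have "x @ [s] \<doteq> t # x" using move_left[of "[t]" "x @ [s]" x] by simp
      then show False using no t(1) by blast
    next
      case (snoc c z)
      then have "y = a @ [u] @ c" "z = s" using h(1) by auto
      moreover from this have "(t # x) @ [s] \<doteq> (a @ c) @ [s]" using h(2) snoc by simp
      then have "t # x \<doteq> a @ c" by (simp only: rcancel)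
      then have "len (t # x) \<le> length (a @ c)" by (rule len_le)
      ultimately show False using tx y(2) by simp
    qed
  qed
qed

end

section \<open>A representation of Artin groups\<close>

text \<open>
  A generalization of the reduced Burau representation to all Coxeter matrices: the generator
  \<open>s\<close> subtracts from a vector the multiple of the basis vector of \<open>s\<close>
  given by a linear form, so that it acts on that basis vector as \<open>-p\<^sup>2\<close>. At
  \<open>p = 1\<close> it is the geometric representation of the Coxeter group, which shows that
  products of two generators have the order prescribed by the matrix. At \<open>p = 3\<close> it
  separates the powers of generators from each other well enough to exclude short relations.
\<close>

fun braid_word :: "nat \<Rightarrow> ('x \<Rightarrow> 'x) \<Rightarrow> ('x \<Rightarrow> 'x) \<Rightarrow> 'x \<Rightarrow> 'x" where
  "braid_word 0 X Y v = v"
| "braid_word (Suc n) X Y v = braid_word n Y X (X v)"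

text \<open>
  Coefficients of alternating products in the plane spanned by two basis vectors. For \<open>c = 2 p
  cos \<theta>\<close> and \<open>q = p\<^sup>2\<close> this is the recursion of the Chebyshev
  polynomials, rescaled by powers of \<open>p\<close>.
\<close>

fun recur :: "real \<Rightarrow> real \<Rightarrow> real \<Rightarrow> real \<Rightarrow> nat \<Rightarrow> real" where
  "recur c q x y 0 = x"
| "recur c q x y (Suc 0) = y"
| "recur c q x y (Suc (Suc n)) = c * recur c q x y (Suc n) - q * recur c q x y n"

lemma recur_shift: "recur c q y (c * y - q * x) n = recur c q x y (Suc n)"
  by (induction c q y "c * y - q * x" n rule: recur.induct) auto

lemma recur_closed:
  assumes "sin \<theta> \<noteq> 0"
  shows "recur (2 * p * cos \<theta>) (p\<^sup>2) x y (Suc n) = p ^ n * (y * sin (real (Suc n) * \<theta>) - p * x * sin (real n * \<theta>)) / sin \<theta>"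
proof (induction n rule: less_induct)
  case (less n)
  consider "n = 0" | "n = 1" | k where "n = Suc (Suc k)" by (metis One_nat_def not0_implies_Suc)
  then show ?case
  proof cases
    case 1 then show ?thesis using assms by simp
  next
    case 2
    have "sin (2 * \<theta>) = 2 * sin \<theta> * cos \<theta>" by (rule sin_double)
    then show ?thesis using 2 assms by (simp add: field_simps power2_eq_square)
  next
    case (3 k)
    have s: "sin (real (Suc (Suc j)) * \<theta>) = 2 * cos \<theta> * sin (real (Suc j) * \<theta>) - sin (real j * \<theta>)" for j
    proof -
      have "real (Suc (Suc j)) * \<theta> = real (Suc j) * \<theta> + \<theta>" "real j * \<theta> = real (Suc j) * \<theta> - \<theta>"
        by (simp_all add: algebra_simps)
      then show ?thesis by (simp only: sin_add sin_diff) simp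
    qed
    have "recur (2 * p * cos \<theta>) (p\<^sup>2) x y (Suc n) =
      2 * p * cos \<theta> * (p ^ Suc k * (y * sin (real (Suc (Suc k)) * \<theta>) - p * x * sin (real (Suc k) * \<theta>)) / sin \<theta>) -
      p\<^sup>2 * (p ^ k * (y * sin (real (Suc k) * \<theta>) - p * x * sin (real k * \<theta>)) / sin \<theta>)"
      using less.IH[of k] less.IH[of "Suc k"] 3 by simp
    also have "\<dots> = p ^ Suc (Suc k) * (y * (2 * cos \<theta> * sin (real (Suc (Suc k)) * \<theta>) - sin (real (Suc k) * \<theta>))
        - p * x * (2 * cos \<theta> * sin (real (Suc k) * \<theta>) - sin (real k * \<theta>))) / sin \<theta>"
      unfolding times_divide_eq_right diff_divide_distrib[symmetric]
      by (rule arg_cong[where f = "\<lambda>z. z / sin \<theta>"]) (simp add: algebra_simps power2_eq_square del: of_nat_Suc)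
    also have "\<dots> = p ^ n * (y * sin (real (Suc n) * \<theta>) - p * x * sin (real n * \<theta>)) / sin \<theta>"
      using s[of "Suc k"] s[of k] 3 by simp
    finally show ?thesis .
  qed
qed

lemma braid_word_plane:
  assumes "\<And>x y. X (P x y) = P (c * y - q * x) y" "\<And>x y. Y (P x y) = P x (c * x - q * y)"
  shows "braid_word n X Y (P x y) =
    (if even n then P (recur c q x y n) (recur c q x y (Suc n)) else P (recur c q x y (Suc n)) (recur c q x y n))"
  using assms
proof (induction n arbitrary: X Y P x y)
  case (Suc n)
  define P' where "P' = (\<lambda>a b. P b a)"
  have "braid_word n Y X (P' y (c * y - q * x)) =
    (if even n then P' (recur c q y (c * y - q * x) n) (recur c q y (c * y - q * x) (Suc n))
     else P' (recur c q y (c * y - q * x) (Suc n)) (recur c q y (c * y - q * x) n))"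
    by (rule Suc.IH) (simp_all add: P'_def Suc.prems)
  then show ?case by (auto simp: P'_def Suc.prems recur_shift)
qed simp

lemma sin_pi_frac: assumes "2 \<le> n" shows "sin (pi / real n) > 0"
  using assms by (intro sin_gt_zero) (auto simp: field_simps)

text \<open>
  At \<open>\<theta> = \<pi> / n\<close> the recursion returns to a multiple of its initial values.
  Both sides of the braid relation therefore act on the plane as \<open>-p\<^sup>n\<close>, composed
  with the exchange of the two basis vectors if \<open>n\<close> is odd.
\<close>

lemma recur_braid:
  assumes "2 \<le> n"
  shows "recur (2 * p * cos (pi / real n)) (p\<^sup>2) x y n = - (p ^ n) * x"
    and "recur (2 * p * cos (pi / real n)) (p\<^sup>2) x y (Suc n) = - (p ^ n) * y"
proof -
  let ?\<theta> = "pi / real n"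
  have s: "sin ?\<theta> \<noteq> 0" using sin_pi_frac[OF assms] by simp
  obtain k where k: "n = Suc k" using assms by (cases n) auto
  have n0: "real n * ?\<theta> = pi" using assms by simp
  have "real k * ?\<theta> = pi - ?\<theta>" "real (Suc n) * ?\<theta> = pi + ?\<theta>" using assms k by (auto simp: field_simps)
  then have 1: "sin (real k * ?\<theta>) = sin ?\<theta>" "sin (real (Suc n) * ?\<theta>) = - sin ?\<theta>" by simp_all
  show "recur (2 * p * cos ?\<theta>) (p\<^sup>2) x y n = - (p ^ n) * x"
    using recur_closed[OF s, of p x y k] 1(1) n0 s k by (simp del: of_nat_Suc)
  show "recur (2 * p * cos ?\<theta>) (p\<^sup>2) x y (Suc n) = - (p ^ n) * y"
    using recur_closed[OF s, of p x y n] 1(2) n0 s by (simp del: of_nat_Suc)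
qed

lemma braid_word_comm:
  assumes X: "\<And>x y. X (P x y) = P (2 * p * cos (pi / real n) * y - p\<^sup>2 * x) y"
    and Y: "\<And>x y. Y (P x y) = P x (2 * p * cos (pi / real n) * x - p\<^sup>2 * y)" and n: "2 \<le> n"
  shows "braid_word n X Y (P x y) = braid_word n Y X (P x y)"
proof -
  have 1: "braid_word n X Y (P x y) = (if even n then P (- (p ^ n) * x) (- (p ^ n) * y) else P (- (p ^ n) * y) (- (p ^ n) * x))"
    unfolding braid_word_plane[of X P _ "p\<^sup>2" Y, OF X Y] recur_braid[OF n] ..
  define P' where "P' = (\<lambda>a b. P b a)"
  have "braid_word n Y X (P' y x) = (if even n then P' (- (p ^ n) * y) (- (p ^ n) * x) else P' (- (p ^ n) * x) (- (p ^ n) * y))"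
    by (subst braid_word_plane[of Y P' "2 * p * cos (pi / real n)" "p\<^sup>2" X]) (simp_all add: P'_def X Y recur_braid[OF n])
  then show ?thesis using 1 by (simp add: P'_def)
qed

lemma recur_order:
  assumes "2 \<le> n" "recur (2 * cos (pi / real n)) 1 1 0 (Suc (2 * j)) = 0" "recur (2 * cos (pi / real n)) 1 0 1 (Suc (2 * j)) = 1"
  shows "n dvd j"
proof -
  let ?\<theta> = "pi / real n"
  have s: "sin ?\<theta> \<noteq> 0" using sin_pi_frac[OF assms(1)] by simp
  have 1: "sin (real (2 * j) * ?\<theta>) = 0" using recur_closed[OF s, of 1 1 0 "2 * j"] assms(2) s by (simp del: of_nat_Suc)
  have 2: "sin (real (Suc (2 * j)) * ?\<theta>) = sin ?\<theta>" using recur_closed[OF s, of 1 0 1 "2 * j"] assms(3) s by (simp del: of_nat_Suc)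
  have "real (Suc (2 * j)) * ?\<theta> = real (2 * j) * ?\<theta> + ?\<theta>" by (simp add: algebra_simps)
  then have "cos (real (2 * j) * ?\<theta>) * sin ?\<theta> = sin ?\<theta>" using 1 2 by (simp only: sin_add)
  then have "cos (real (2 * j) * ?\<theta>) = 1" using s by simp
  then obtain k :: int where "real (2 * j) * ?\<theta> = real_of_int k * 2 * pi" using cos_one_2pi_int by blast
  then have "real j = real_of_int k * real n" using assms(1) by (simp add: field_simps)
  then have "int j = k * int n" by (metis of_int_eq_iff of_int_mult of_int_of_nat_eq)
  then show ?thesis by (metis dvd_triv_right int_dvd_int_iff)
qed

lemma recur_linear: "recur 2 1 0 1 n = real n"
  by (induction "2::real" "1::real" "0::real" "1::real" n rule: recur.induct) (auto simp: algebra_simps)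

text \<open>
  The value at an infinite entry is the limit of the values at finite ones.
\<close>

definition bond :: "('s \<Rightarrow> 's \<Rightarrow> enat) \<Rightarrow> 's \<Rightarrow> 's \<Rightarrow> real" where
  "bond m s t = (case m s t of enat n \<Rightarrow> cos (pi / real n) | \<infinity> \<Rightarrow> 1)"

definition coef :: "('s \<Rightarrow> 's \<Rightarrow> enat) \<Rightarrow> real \<Rightarrow> 's \<Rightarrow> 's \<Rightarrow> real" where
  "coef m p s t = (if s = t then 1 + p\<^sup>2 else - 2 * p * bond m s t)"

definition form :: "'s set \<Rightarrow> ('s \<Rightarrow> 's \<Rightarrow> enat) \<Rightarrow> real \<Rightarrow> 's \<Rightarrow> ('s \<Rightarrow> real) \<Rightarrow> real" where
  "form S m p s v = (\<Sum>t\<in>S. coef m p s t * v t)"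

definition hecke :: "'s set \<Rightarrow> ('s \<Rightarrow> 's \<Rightarrow> enat) \<Rightarrow> real \<Rightarrow> 's \<Rightarrow> ('s \<Rightarrow> real) \<Rightarrow> 's \<Rightarrow> real" where
  "hecke S m p s v = (if s \<in> S then v(s := v s - form S m p s v) else v)"

definition plane :: "('s \<Rightarrow> real) \<Rightarrow> 's \<Rightarrow> 's \<Rightarrow> real \<Rightarrow> real \<Rightarrow> 's \<Rightarrow> real" where
  "plane v s t x y = (\<lambda>u. v u + (if u = s then x else if u = t then y else 0))"

context
  fixes S :: "'s set" and m :: "'s \<Rightarrow> 's \<Rightarrow> enat" and p :: real
  assumes fin: "finite S"
begin

lemma form_plane: assumes "s \<in> S" "t \<in> S" "s \<noteq> t"
  shows "form S m p r (plane v s t x y) = form S m p r v + coef m p r s * x + coef m p r t * y"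
proof -
  have "form S m p r (plane v s t x y) =
    (\<Sum>u\<in>S. coef m p r u * v u + (if u = s then coef m p r s * x else 0) + (if u = t then coef m p r t * y else 0))"
    unfolding form_def plane_def using assms(3) by (intro sum.cong) (auto simp: algebra_simps)
  also have "\<dots> = form S m p r v + coef m p r s * x + coef m p r t * y"
    using fin assms by (simp add: sum.distrib form_def)
  finally show ?thesis .
qed

lemma hecke_plane:
  assumes st: "s \<in> S" "t \<in> S" "s \<noteq> t" and v: "form S m p s v = 0"
  shows "hecke S m p s (plane v s t x y) = plane v s t (2 * p * bond m s t * y - p\<^sup>2 * x) y"
proof -
  have "form S m p s (plane v s t x y) = (1 + p\<^sup>2) * x - 2 * p * bond m s t * y"
    using form_plane[OF st] v st(3) by (simp add: coef_def)
  then show ?thesis using st by (auto simp: hecke_def plane_def algebra_simps)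
qed

lemma plane_swap: "s \<noteq> t \<Longrightarrow> plane v s t x y = plane v t s y x"
  by (auto simp: plane_def)

text \<open>
  The discriminant condition says that the two linear forms are independent on the plane of
  \<open>s\<close> and \<open>t\<close>. The space is then the sum of this plane and the common
  kernel of the forms, on which both generators act trivially.
\<close>

lemma plane_decomp:
  assumes st: "s \<in> S" "t \<in> S" "s \<noteq> t" "m s t = m t s" and D: "(1 + p\<^sup>2)\<^sup>2 \<noteq> (2 * p * bond m s t)\<^sup>2"
  obtains v' x y where "v = plane v' s t x y" "form S m p s v' = 0" "form S m p t v' = 0"
proof -
  define k where "k = 2 * p * bond m s t"
  define d where "d = (1 + p\<^sup>2)\<^sup>2 - k\<^sup>2"
  have d0: "d \<noteq> 0" using D by (simp add: d_def k_def)
  define \<alpha> where "\<alpha> = form S m p s v"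
  define \<beta> where "\<beta> = form S m p t v"
  define x where "x = ((1 + p\<^sup>2) * \<alpha> + k * \<beta>) / d"
  define y where "y = ((1 + p\<^sup>2) * \<beta> + k * \<alpha>) / d"
  define v' where "v' = plane v s t (-x) (-y)"
  have b: "bond m t s = bond m s t" using st by (simp add: bond_def)
  have "v = plane v' s t x y" by (auto simp: v'_def plane_def)
  moreover have "form S m p s v' = 0"
  proof -
    have "form S m p s v' = \<alpha> - (1 + p\<^sup>2) * x + k * y"
      unfolding v'_def form_plane[OF st(1-3)] using st(3) by (simp add: coef_def \<alpha>_def k_def)
    moreover have "(1 + p\<^sup>2) * x - k * y = (d * \<alpha>) / d"
      unfolding x_def y_def times_divide_eq_right diff_divide_distrib[symmetric]
      by (rule arg_cong[where f = "\<lambda>z. z / d"]) (simp add: d_def algebra_simps power2_eq_square)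
    ultimately show ?thesis using d0 by (simp add: algebra_simps)
  qed
  moreover have "form S m p t v' = 0"
  proof -
    have "form S m p t v' = \<beta> - (1 + p\<^sup>2) * y + k * x"
      unfolding v'_def form_plane[OF st(1-3)] using st(3) b by (simp add: coef_def \<beta>_def k_def)
    moreover have "(1 + p\<^sup>2) * y - k * x = (d * \<beta>) / d"
      unfolding x_def y_def times_divide_eq_right diff_divide_distrib[symmetric]
      by (rule arg_cong[where f = "\<lambda>z. z / d"]) (simp add: d_def algebra_simps power2_eq_square)
    ultimately show ?thesis using d0 by (simp add: algebra_simps)
  qed
  ultimately show thesis by (rule that)
qed

lemma hecke_braid:
  assumes st: "s \<in> S" "t \<in> S" "s \<noteq> t" "m s t = m t s" "m s t = enat n" "2 \<le> n" and p: "0 < p"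
  shows "braid_word n (hecke S m p s) (hecke S m p t) v = braid_word n (hecke S m p t) (hecke S m p s) v"
proof -
  have mt: "m t s = enat n" using st(4,5) by simp
  have b: "bond m s t = cos (pi / real n)" "bond m t s = cos (pi / real n)" by (simp_all add: bond_def st(5) mt)
  have "0 < sin (pi / real n)" by (rule sin_pi_frac) fact
  then have c: "(cos (pi / real n))\<^sup>2 < 1" using sin_cos_squared_add[of "pi / real n"] by (smt (verit) zero_less_power)
  \<comment> \<open>The forms are independent on the plane: here the entry of the matrix has to be
    finite.\<close>
  have "(2 * p * bond m s t)\<^sup>2 < (2 * p)\<^sup>2"
    unfolding b power_mult_distrib using c p by (simp add: power_mult_distrib)
  also have "(2 * p)\<^sup>2 \<le> (1 + p\<^sup>2)\<^sup>2"
  proof (rule power_mono)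
    have "0 \<le> (1 - p)\<^sup>2" by simp
    then show "2 * p \<le> 1 + p\<^sup>2" by (simp add: power2_eq_square algebra_simps)
  qed (use p in simp)
  finally have D: "(1 + p\<^sup>2)\<^sup>2 \<noteq> (2 * p * bond m s t)\<^sup>2" by simp
  obtain v' x y where v: "v = plane v' s t x y" "form S m p s v' = 0" "form S m p t v' = 0"
    using plane_decomp[where v = v, OF st(1-4) D] by blast
  show ?thesis
    unfolding v(1)
  proof (rule braid_word_comm[OF _ _ st(6)])
    show "hecke S m p s (plane v' s t x y) = plane v' s t (2 * p * cos (pi / real n) * y - p\<^sup>2 * x) y" for x y
      using hecke_plane[OF st(1-3) v(2)] b by simp
    show "hecke S m p t (plane v' s t x y) = plane v' s t x (2 * p * cos (pi / real n) * x - p\<^sup>2 * y)" for x y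
      using hecke_plane[OF st(2,1) _ v(3)] b st(3) plane_swap[of s t] by metis
  qed
qed

lemma hecke_hecke: assumes "s \<in> S" shows "form S m p s (hecke S m p s v) = - (p\<^sup>2) * form S m p s v"
proof -
  define \<phi> where "\<phi> = form S m p s v"
  have "form S m p s (hecke S m p s v) = (\<Sum>u\<in>S. coef m p s u * (v(s := v s - \<phi>)) u)"
    using assms unfolding \<phi>_def by (simp add: hecke_def form_def)
  also have "\<dots> = (\<Sum>u\<in>S. coef m p s u * v u + (if u = s then - coef m p s s * \<phi> else 0))"
    by (intro sum.cong) (auto simp: algebra_simps)
  also have "\<dots> = \<phi> - (1 + p\<^sup>2) * \<phi>"
  proof -
    have "coef m p s s = 1 + p\<^sup>2" by (simp add: coef_def)
    then show ?thesis using fin assms by (simp add: sum.distrib \<phi>_def form_def[of S m p s v] algebra_simps)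
  qed
  finally show ?thesis by (simp add: algebra_simps \<phi>_def)
qed

end

section \<open>Orders of products of two generators\<close>

context coxeter
begin

primrec act :: "'s list \<Rightarrow> ('s \<Rightarrow> real) \<Rightarrow> 's \<Rightarrow> real" where
  "act [] v = v"
| "act (s # w) v = act w (hecke S m 1 s v)"

lemma act_append: "act (u @ w) v = act w (act u v)"
  by (induction u arbitrary: v) auto

lemma act_alt: "act (alt n s t) v = braid_word n (hecke S m 1 s) (hecke S m 1 t) v"
  by (induction n arbitrary: s t v) auto

lemma m_ge_2: "s \<in> S \<Longrightarrow> t \<in> S \<Longrightarrow> s \<noteq> t \<Longrightarrow> m s t = enat n \<Longrightarrow> 2 \<le> n"
  using matrix unfolding coxeter_matrix_def by (metis enat_ord_simps(1) numeral_eq_enat)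

lemma act_ceq: "u \<doteq> v \<Longrightarrow> act u x = act v x"
proof (induction arbitrary: x rule: ceq.induct)
  case (square s)
  have "hecke S m 1 s (hecke S m 1 s x) = x"
    using hecke_hecke[OF finite_S, where s = s and m = m and p = 1 and v = x] by (cases "s \<in> S") (auto simp: hecke_def)
  then show ?case by simp
next
  case (braid s t n)
  then show ?case
    using hecke_braid[OF finite_S braid(1-3) m_sym[OF braid(1,2)] braid(4) m_ge_2[OF braid]] by (simp add: act_alt)
next
  case (trans u v w) then show ?case by simp
qed (simp_all add: act_append)

text \<open>
  On the plane of \<open>s\<close> and \<open>t\<close> the product acts as a rotation by \<open>2
  \<pi> / n\<close>, or as a shear if the entry of the matrix is infinite.
\<close>

lemma alt_order:
  assumes st: "s \<in> S" "t \<in> S" "s \<noteq> t" and e: "alt (2 * j) s t \<doteq> []"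
  shows "(case m s t of enat n \<Rightarrow> n dvd j | \<infinity> \<Rightarrow> j = 0)"
proof -
  have f: "form S m 1 r (\<lambda>_. 0) = 0" for r by (simp add: form_def)
  let ?c = "2 * 1 * bond m s t"
  have sw: "plane v s t x y = plane v t s y x" for v x y using st(3) by (auto simp: plane_def)
  have b: "bond m t s = bond m s t" using m_sym[OF st(1,2)] by (simp add: bond_def)
  have "braid_word (2 * j) (hecke S m 1 s) (hecke S m 1 t) (plane (\<lambda>_. 0) s t x y) =
    plane (\<lambda>_. 0) s t (recur ?c (1\<^sup>2) x y (2 * j)) (recur ?c (1\<^sup>2) x y (Suc (2 * j)))" for x y
  proof (subst braid_word_plane[where P = "plane (\<lambda>_. 0) s t" and c = ?c and q = "1\<^sup>2"])
    show "hecke S m 1 s (plane (\<lambda>_. 0) s t x y) = plane (\<lambda>_. 0) s t (?c * y - 1\<^sup>2 * x) y" for x y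
      by (rule hecke_plane[OF finite_S st f])
    show "hecke S m 1 t (plane (\<lambda>_. 0) s t x y) = plane (\<lambda>_. 0) s t x (?c * x - 1\<^sup>2 * y)" for x y
      using hecke_plane[OF finite_S st(2,1) _ f, where x = y and y = x] sw b st(3) by metis
  qed simp
  then have *: "plane (\<lambda>_. 0) s t (recur ?c (1\<^sup>2) x y (2 * j)) (recur ?c (1\<^sup>2) x y (Suc (2 * j))) = plane (\<lambda>_. 0) s t x y" for x y
    using act_ceq[OF e] by (simp add: act_alt)
  have 1: "recur ?c 1 x y (2 * j) = x" for x y using fun_cong[OF *, of x y s] st(3) by (simp add: plane_def)
  have 2: "recur ?c 1 x y (Suc (2 * j)) = y" for x y using fun_cong[OF *, of x y t] st(3) by (simp add: plane_def del: recur.simps)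
  show ?thesis
  proof (cases "m s t")
    case (enat n)
    have "n dvd j"
      using recur_order[OF m_ge_2[OF st enat]] 2 enat by (simp add: bond_def del: recur.simps)
    then show ?thesis using enat by simp
  next
    case infinity
    then have "recur 2 1 0 1 (2 * j) = 0" using 1[of 0 1] by (simp add: bond_def)
    then show ?thesis using infinity by (simp add: recur_linear)
  qed
qed

lemma gen_inj: assumes "s \<in> S" "t \<in> S" "[s] \<doteq> [t]" shows "s = t"
proof (rule ccontr)
  assume ne: "s \<noteq> t"
  have "[s] @ [t] \<doteq> [t] @ [t]" using assms(3) by (rule ceq_left)
  also have "[t] @ [t] \<doteq> []" using ceq.square by simp
  finally have "alt (2 * 1) s t \<doteq> []" by (simp add: numeral_2_eq_2)
  then have "(case m s t of enat n \<Rightarrow> n dvd 1 | \<infinity> \<Rightarrow> (1::nat) = 0)" by (rule alt_order[OF assms(1,2) ne])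
  then show False using m_ge_2[OF assms(1,2) ne] by (cases "m s t") auto
qed

section \<open>Projecting words to a standard parabolic subgroup\<close>

text \<open>
  There is a retraction, as a map of sets, from the Artin group to a standard parabolic subgroup.
  While reading a word one follows the right coset \<open>W\<^sub>T x\<close> of the underlying
  element \<open>x\<close> of the Coxeter group. A letter that moves the coset is dropped. A letter
  \<open>s\<close> that fixes it is replaced, with its sign, by the letter \<open>t\<close> in
  \<open>T\<close> with \<open>y s = t y\<close>, where \<open>y\<close> is the minimal
  representative of the coset.
\<close>

definition minimal_rep :: "'s set \<Rightarrow> 's list \<Rightarrow> 's list" where
  "minimal_rep T x = (SOME y. minimal T y \<and> coset T y = coset T x)"

definition label :: "'s set \<Rightarrow> 's list \<Rightarrow> 's \<Rightarrow> 's" where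
  "label T x s = (SOME t. t \<in> T \<and> minimal_rep T x @ [s] \<doteq> t # minimal_rep T x)"

primrec project :: "'s set \<Rightarrow> 's list \<Rightarrow> 's word \<Rightarrow> 's word" where
  "project T x [] = []"
| "project T x (l # w) = (if coset T (x @ [fst l]) = coset T x then [(label T x (fst l), snd l)] else []) @
     project T (x @ [fst l]) w"

lemma minimal_rep: "minimal T (minimal_rep T x)" "coset T (minimal_rep T x) = coset T x"
  using someI_ex[OF minimal_exists[of T x]] unfolding minimal_rep_def by auto

lemma minimal_rep_cong: "coset T x = coset T y \<Longrightarrow> minimal_rep T x = minimal_rep T y" by (simp add: minimal_rep_def)
lemma label_cong: "coset T x = coset T y \<Longrightarrow> label T x s = label T y s" using minimal_rep_cong[of T x y] by (simp add: label_def)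

lemma coset_Cons: "t \<in> T \<Longrightarrow> coset T (t # x) = coset T x"
  using coset_left[of "[t]" T x] by simp

lemma label: assumes "coset T (x @ [s]) = coset T x"
  shows "label T x s \<in> T" "minimal_rep T x @ [s] \<doteq> label T x s # minimal_rep T x"
proof -
  let ?y = "minimal_rep T x"
  have c: "coset T (?y @ [s]) = coset T ?y" using assms minimal_rep(2)[of T x] coset_right[OF minimal_rep(2)[of T x], of "[s]"] by simp
  have "\<not> minimal T (?y @ [s])"
  proof
    assume "minimal T (?y @ [s])"
    then have "len (?y @ [s]) = len ?y" using minimal_unique[OF _ minimal_rep(1) c] len_cong by blast
    then show False using len_snoc(3) by blast
  qed
  then have "\<exists>t. t \<in> T \<and> ?y @ [s] \<doteq> t # ?y" using deodhar[OF minimal_rep(1)] by blast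
  then have "label T x s \<in> T \<and> ?y @ [s] \<doteq> label T x s # ?y" unfolding label_def by (rule someI_ex)
  then show "label T x s \<in> T" "?y @ [s] \<doteq> label T x s # ?y" by auto
qed

lemma minimal_rep_step: assumes "coset T (x @ [s]) \<noteq> coset T x" shows "minimal_rep T (x @ [s]) \<doteq> minimal_rep T x @ [s]"
proof -
  let ?y = "minimal_rep T x"
  have c: "coset T (?y @ [s]) = coset T (x @ [s])" by (rule coset_right[OF minimal_rep(2)])
  have "\<not> (\<exists>t\<in>T. ?y @ [s] \<doteq> t # ?y)"
    using coset_cong coset_Cons c assms minimal_rep(2) by metis
  then have "minimal T (?y @ [s])" using deodhar[OF minimal_rep(1)] by blast
  then show ?thesis using minimal_unique[OF minimal_rep(1), of T "?y @ [s]" "x @ [s]"] c minimal_rep(2) by simp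
qed

lemma project_cong: "coset T x = coset T y \<Longrightarrow> project T x w = project T y w"
proof (induction w arbitrary: x y)
  case (Cons l w)
  have c: "coset T (x @ [fst l]) = coset T (y @ [fst l])" by (rule coset_right[OF Cons.prems])
  show ?case using Cons.IH[OF c] c Cons.prems label_cong[OF Cons.prems] by simp
qed simp

lemma project_append: "project T x (u @ v) = project T x u @ project T (x @ map fst u) v"
  by (induction u arbitrary: x) auto

lemma project_words: "project T x w \<in> words T"
  by (induction w arbitrary: x) (auto simp: words_def label)

lemma project_none:
  assumes "\<And>i. i < length w \<Longrightarrow> coset T (x @ take (Suc i) (map fst w)) \<noteq> coset T (x @ take i (map fst w))"
  shows "project T x w = [] \<and> minimal_rep T (x @ map fst w) \<doteq> minimal_rep T x @ map fst w"
  using assms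
proof (induction w arbitrary: x)
  case (Cons l w)
  have 1: "coset T (x @ [fst l]) \<noteq> coset T x" using Cons.prems[of 0] by simp
  have "project T (x @ [fst l]) w = [] \<and> minimal_rep T ((x @ [fst l]) @ map fst w) \<doteq> minimal_rep T (x @ [fst l]) @ map fst w"
  proof (rule Cons.IH)
    fix i assume "i < length w"
    then show "coset T ((x @ [fst l]) @ take (Suc i) (map fst w)) \<noteq> coset T ((x @ [fst l]) @ take i (map fst w))"
      using Cons.prems[of "Suc i"] by simp
  qed
  moreover have "minimal_rep T (x @ [fst l]) @ map fst w \<doteq> (minimal_rep T x @ [fst l]) @ map fst w"
    by (intro ceq_left minimal_rep_step 1)
  ultimately show ?case using 1 ceq.trans by auto
qed simp

text \<open>
  If exactly one letter fixes the coset reached so far, the projection is one letter, and this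
  letter is the reflection crossed there by the word, transported by the minimal representative of
  the initial coset.
\<close>

lemma project_one:
  assumes i: "i < length w" "coset T (x @ take (Suc i) (map fst w)) = coset T (x @ take i (map fst w))"
    and other: "\<And>j. j < length w \<Longrightarrow> j \<noteq> i \<Longrightarrow> coset T (x @ take (Suc j) (map fst w)) \<noteq> coset T (x @ take j (map fst w))"
  obtains p where "p \<in> T" "project T x w = [(p, snd (w ! i))]"
    "[p] \<doteq> minimal_rep T x @ take i (map fst w) @ [fst (w ! i)] @ rev (minimal_rep T x @ take i (map fst w))"
proof -
  define u where "u = take i w"
  define l where "l = w ! i"
  define v where "v = drop (Suc i) w"
  have w: "w = u @ l # v" using i(1) by (simp add: u_def l_def v_def id_take_nth_drop)
  have lu: "length u = i" using i(1) by (simp add: u_def)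
  have mu: "map fst u = take i (map fst w)" by (simp add: u_def take_map)
  have sl: "take (Suc i) (map fst w) = map fst u @ [fst l]" using w lu by simp
  have "project T x u = [] \<and> minimal_rep T (x @ map fst u) \<doteq> minimal_rep T x @ map fst u"
  proof (rule project_none)
    fix j assume "j < length u"
    then show "coset T (x @ take (Suc j) (map fst u)) \<noteq> coset T (x @ take j (map fst u))"
      using other[of j] lu i(1) unfolding mu by (simp add: min_def)
  qed
  then have 1: "project T x u = []" "minimal_rep T (x @ map fst u) \<doteq> minimal_rep T x @ map fst u" by auto
  have 2: "project T (x @ map fst u @ [fst l]) v = []"
  proof (rule project_none[THEN conjunct1])
    fix j assume "j < length v"
    then show "coset T ((x @ map fst u @ [fst l]) @ take (Suc j) (map fst v)) \<noteq> coset T ((x @ map fst u @ [fst l]) @ take j (map fst v))"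
      using other[of "Suc (i + j)"] w lu by simp
  qed
  have fx: "coset T ((x @ map fst u) @ [fst l]) = coset T (x @ map fst u)" using i(2) sl mu by simp
  define p where "p = label T (x @ map fst u) (fst l)"
  have p: "p \<in> T" "minimal_rep T (x @ map fst u) @ [fst l] \<doteq> [p] @ minimal_rep T (x @ map fst u)"
    using label[OF fx] by (auto simp: p_def)
  let ?y = "minimal_rep T x @ map fst u"
  have "?y @ [fst l] \<doteq> minimal_rep T (x @ map fst u) @ [fst l]" using 1(2) by (intro ceq_left) (rule ceq.sym)
  also note p(2)
  also have "[p] @ minimal_rep T (x @ map fst u) \<doteq> [p] @ ?y" using 1(2) by (rule ceq_right)
  finally have "[p] \<doteq> (?y @ [fst l]) @ rev ?y" using move_right[of "[p]" ?y "?y @ [fst l]"] ceq.sym by blast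
  moreover have "project T x w = [(p, snd l)]"
    using 1(1) 2 fx unfolding w by (simp add: project_append p_def)
  ultimately show thesis using that[OF p(1)] by (simp add: mu l_def)
qed

lemma alternating_word_alt: "alternating_word n s t = map (\<lambda>s. (s, True)) (alt n s t)"
  by (induction n arbitrary: s t) auto

lemma map_fst_alternating: "map fst (alternating_word n s t) = alt n s t"
  by (simp add: alternating_word_alt comp_def)

lemma take_alt: "i \<le> n \<Longrightarrow> take i (alt n s t) = alt i s t"
  using alt_add[of i "n - i" s t] by simp

lemma alt_palindrome: "alt (2 * i + 1) s t = alt (Suc i) s t @ rev (alt i s t)"
  using alt_add[of "Suc i" i s t] by (simp add: rev_alt mult_2 del: alt.simps)

lemma fixed_iff: "coset T (x @ alt (Suc i) s t) = coset T (x @ alt i s t) \<longleftrightarrow> coset T (x @ alt (2 * i + 1) s t) = coset T x"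
proof -
  have "coset T (x @ alt (2 * i + 1) s t) = coset T ((x @ alt (Suc i) s t) @ rev (alt i s t))"
    unfolding alt_palindrome by simp
  moreover have "coset T x = coset T ((x @ alt i s t) @ rev (alt i s t))"
    using coset_cong[OF cancel1[of x "alt i s t" "[]"]] by simp
  ultimately show ?thesis by (simp only: coset_cancel)
qed

lemma project_both:
  assumes "coset T (x @ [s]) = coset T x" "coset T (x @ [t]) = coset T x"
  shows "project T x (alternating_word n s t) = alternating_word n (label T x s) (label T x t)"
  using assms
proof (induction n arbitrary: s t)
  case (Suc n)
  have "project T (x @ [s]) (alternating_word n t s) = project T x (alternating_word n t s)"
    by (rule project_cong) (rule Suc.prems(1))
  then show ?case using Suc.IH[OF Suc.prems(2,1)] Suc.prems(1) by simp
qed simp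

lemma single_letter_reduced: assumes "set w \<subseteq> {b}" "length w = len w" "odd (length w)" shows "w = [b]"
proof (cases w rule: remdups_adj.cases)
  case (3 c d r)
  then have "w = [b] @ [b] @ r" using assms(1) by simp
  then have "w \<doteq> r" using ceq_left[OF ceq.square[of b], of r] by simp
  then have "len w \<le> length r" by (rule len_le)
  then show ?thesis using 3 assms(2) by simp
qed (use assms in auto)

text \<open>
  The reflections in the dihedral subgroup of \<open>s\<close> and \<open>t\<close> which fix a
  coset of \<open>W\<^sub>T\<close>: unless the generators both fix it, and hence everything does,
  there is at most one. For a shortest element \<open>d\<close> of the double coset, the stabilizer
  of the coset of \<open>d\<close> is generated by those of \<open>s\<close> and \<open>t\<close>
  which it contains, and a stabilizer with at most one generator contains at most one element of odd
  length. The general case follows by conjugation.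
\<close>

lemma dihedral_fixed_points:
  assumes no: "\<not> (coset T (x @ [s]) = coset T x \<and> coset T (x @ [t]) = coset T x)"
  obtains \<sigma> where "\<And>z. z \<in> lists {s, t} \<Longrightarrow> odd (length z) \<Longrightarrow> coset T (x @ z) = coset T x \<Longrightarrow> z \<doteq> \<sigma>"
proof -
  have "\<exists>q. (fst q \<in> lists T \<and> snd q \<in> lists {s, t}) \<and>
    (\<forall>q'. fst q' \<in> lists T \<and> snd q' \<in> lists {s, t} \<longrightarrow> len (fst q @ x @ snd q) \<le> len (fst q' @ x @ snd q'))"
    by (rule ex_has_least_nat[of _ "([], [])"]) simp
  then obtain q where q: "fst q \<in> lists T" "snd q \<in> lists {s, t}"
    "\<And>q'. fst q' \<in> lists T \<Longrightarrow> snd q' \<in> lists {s, t} \<Longrightarrow> len (fst q @ x @ snd q) \<le> len (fst q' @ x @ snd q')" by blast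
  define v0 where "v0 = fst q"
  define u0 where "u0 = snd q"
  have vu: "v0 \<in> lists T" "u0 \<in> lists {s, t}" using q by (simp_all only: v0_def u0_def)
  have least: "len (v0 @ x @ u0) \<le> len (v @ x @ u)" if "v \<in> lists T" "u \<in> lists {s, t}" for v u
    using q(3)[of "(v, u)"] that by (simp add: v0_def u0_def)
  define d where "d = v0 @ x @ u0"
  have dmin: "len d \<le> len (d @ u)" if "u \<in> lists {s, t}" for u
    using least[OF vu(1), of "u0 @ u"] that vu by (simp add: d_def)
  have "minimal {s, t} (rev d)"
    unfolding minimal_def
  proof
    fix v assume "v \<in> lists {s, t}"
    then have "len d \<le> len (d @ rev v)" by (intro dmin) (simp add: in_lists_conv_set)
    then show "len (rev d) \<le> len (v @ rev d)" using len_rev[of "d @ rev v"] len_rev[of d] by simp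
  qed
  then have add: "len (d @ u) = len d + len u" if "u \<in> lists {s, t}" for u
    using minimal_additive[of "{s, t}" "rev d" "rev u"] that len_rev[of "d @ u"] len_rev[of d] len_rev[of u]
    by (simp add: in_lists_conv_set)
  \<comment> \<open>The generators in the stabilizer of the coset of \<open>d\<close>. By the
    exchange condition, the last letter of a reduced word in this stabilizer is one of them.\<close>
  define L where "L a \<longleftrightarrow> coset T (d @ [a]) = coset T d" for a
  have descent: "L a" if r: "r \<in> lists {s, t}" "coset T (d @ r) = coset T d" and a: "a \<in> {s, t}" "len (r @ [a]) < len r" for r a
  proof -
    obtain v where v: "v \<in> lists T" "d @ r \<doteq> v @ d" using r(2) unfolding coset_eq_iff[of T d "d @ r"] by (metis coset_eq_iff)
    obtain e where e: "d \<doteq> e" "length e = len d" using len_ex by blast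
    have "len ((d @ r) @ [a]) < len (d @ r)" using add[of "r @ [a]"] add[OF r(1)] a r(1) by simp
    moreover have "d @ r \<doteq> v @ e" using v(2) ceq_right[OF e(1)] ceq.trans by blast
    ultimately obtain p c q where h: "v @ e = p @ [c] @ q" "(d @ r) @ [a] \<doteq> p @ q" using exchange by blast
    have da: "coset T ((d @ r) @ [a]) = coset T (d @ [a])" by (rule coset_right[OF r(2)])
    show ?thesis
    proof (cases "length p < length v")
      case True
      then have "p @ [c] = take (Suc (length p)) v" using arg_cong[OF h(1), of "take (Suc (length p))"] by simp
      then obtain b where b: "v = p @ [c] @ b" by (metis append_take_drop_id append_assoc)
      then have q: "q = b @ e" using h(1) by simp
      have "(d @ r) @ [a] \<doteq> (p @ b) @ e" using h(2) q by simp
      also have "(p @ b) @ e \<doteq> (p @ b) @ d" by (rule ceq_right[OF ceq.sym[OF e(1)]])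
      finally have "coset T ((d @ r) @ [a]) = coset T ((p @ b) @ d)" by (rule coset_cong)
      also have "\<dots> = coset T d" using b v(1) by (intro coset_left) auto
      finally show ?thesis using da L_def by simp
    next
      case False
      then have "v = take (length v) p" using arg_cong[OF h(1), of "take (length v)"] by simp
      then obtain b where b: "p = v @ b" by (metis append_take_drop_id)
      then have e': "e = b @ [c] @ q" using h(1) by simp
      have "v @ (d @ [a]) \<doteq> (d @ r) @ [a]" using ceq_left[OF ceq.sym[OF v(2)], of "[a]"] by simp
      also note h(2)
      also have "p @ q = v @ (b @ q)" using b by simp
      finally have "d @ [a] \<doteq> b @ q" by (simp only: lcancel)
      then have "len (d @ [a]) \<le> length (b @ q)" by (rule len_le)
      then have "len (d @ [a]) < len d" using e' e(2) by simp
      then show ?thesis using dmin[of "[a]"] a(1) by simp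
    qed
  qed
  have letters: "\<forall>a\<in>set r. L a" if "r \<in> lists {s, t}" "coset T (d @ r) = coset T d" "length r = len r" for r
    using that
  proof (induction r rule: rev_induct)
    case (snoc a r)
    have rl: "r \<in> lists {s, t}" "a \<in> {s, t}" using snoc.prems(1) by auto
    have red: "length r = len r" using snoc.prems(3) len_snoc(1)[of r a] len_le_length[of r] by simp
    have "(r @ [a]) @ [a] \<doteq> r" using ceq_right[OF ceq.square[of a], of r] by simp
    then have "len ((r @ [a]) @ [a]) < len (r @ [a])" using len_cong red snoc.prems(3) by simp
    then have La: "L a" using descent[OF snoc.prems(1,2) rl(2)] by simp
    then have "coset T ((d @ r) @ [a]) = coset T (d @ [a])" using snoc.prems(2) L_def by simp
    then have "coset T (d @ r) = coset T d" by (simp only: coset_cancel)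
    then show ?case using snoc.IH[OF rl(1) _ red] La by simp
  qed simp
  have "coset T d = coset T (x @ u0)" unfolding d_def by (rule coset_left[OF vu(1)])
  then have "coset T (d @ rev u0) = coset T ((x @ u0) @ rev u0)" by (rule coset_right)
  then have cx: "coset T (d @ rev u0) = coset T x" using coset_cong[OF cancel1[of x u0 "[]"]] by simp
  have all: "coset T (d @ u) = coset T d" if "L s" "L t" "u \<in> lists {s, t}" for u
    using that(3)
  proof (induction u rule: rev_induct)
    case (snoc a u)
    then have "coset T ((d @ u) @ [a]) = coset T (d @ [a])" by (intro coset_right) auto
    then show ?case using snoc.prems that L_def by auto
  qed simp
  have "\<exists>b. \<forall>a\<in>{s, t}. L a \<longrightarrow> a = b"
  proof (cases "L s \<and> L t")
    case True
    have u: "rev u0 \<in> lists {s, t}" using vu(2) by (simp add: in_lists_conv_set)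
    have "coset T (x @ [a]) = coset T x" if "a \<in> {s, t}" for a
    proof -
      have "coset T ((d @ rev u0) @ [a]) = coset T (x @ [a])" by (rule coset_right[OF cx])
      moreover have "coset T ((d @ rev u0) @ [a]) = coset T d" using all[of "rev u0 @ [a]"] True u that by simp
      moreover have "coset T (d @ rev u0) = coset T d" using all True u by simp
      ultimately show ?thesis using cx by simp
    qed
    then show ?thesis using no by blast
  qed blast
  then obtain b where b: "\<And>a. a \<in> {s, t} \<Longrightarrow> L a \<Longrightarrow> a = b" by blast
  show thesis
  proof (rule that)
    fix z assume z: "z \<in> lists {s, t}" "odd (length z)" "coset T (x @ z) = coset T x"
    let ?r = "rev u0 @ z @ u0"
    have "coset T ((d @ rev u0) @ z) = coset T (d @ rev u0)" using coset_right[OF cx, of z] z(3) cx by simp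
    then have "coset T (((d @ rev u0) @ z) @ u0) = coset T ((d @ rev u0) @ u0)" by (rule coset_right)
    also have "\<dots> = coset T d" using coset_cong[OF cancel2[of d u0 "[]"]] by simp
    finally have cr: "coset T (d @ ?r) = coset T d" by simp
    obtain r where r: "?r \<doteq> r" "length r = len ?r" "set r \<subseteq> set ?r" using reduced_subword by blast
    have rl: "r \<in> lists {s, t}" using r(3) z(1) vu(2) by (auto simp: in_lists_conv_set)
    have red: "length r = len r" using r(2) len_cong[OF r(1)] by simp
    have "coset T (d @ r) = coset T d" using cr coset_cong[OF ceq_right[OF r(1), of d]] by simp
    then have "set r \<subseteq> {b}" using letters[OF rl _ red] b rl by (auto simp: in_lists_conv_set)
    moreover have "odd (length r)" using ceq_length[OF r(1)] z(2) by simp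
    ultimately have "r = [b]" using single_letter_reduced red by blast
    then have "z @ u0 \<doteq> u0 @ [b]" using r(1) move_left[of "rev u0" "z @ u0" "[b]"] by simp
    then show "z \<doteq> (u0 @ [b]) @ rev u0" by (simp only: move_right)
  qed
qed

lemma alt_conj: "y @ [s] \<doteq> p # y \<Longrightarrow> y @ [t] \<doteq> q # y \<Longrightarrow> y @ alt k s t \<doteq> alt k p q @ y"
proof (induction k arbitrary: s t p q)
  case (Suc k)
  have "(y @ [s]) @ alt k t s \<doteq> (p # y) @ alt k t s" using Suc.prems(1) by (rule ceq_left)
  also have "(p # y) @ alt k t s = [p] @ (y @ alt k t s)" by simp
  also have "[p] @ (y @ alt k t s) \<doteq> [p] @ (alt k q p @ y)" using Suc.IH[OF Suc.prems(2,1)] by (rule ceq_right)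
  finally show ?case by simp
qed simp

text \<open>
  Conjugation by a group element preserves the order of the product of two generators, and this
  order is the entry of the matrix.
\<close>

lemma conj_order:
  assumes st: "s \<in> S" "t \<in> S" "s \<noteq> t" "m s t = enat n" and pq: "p \<in> S" "q \<in> S"
    and y: "y @ [s] \<doteq> p # y" "y @ [t] \<doteq> q # y"
  shows "p \<noteq> q" "m p q = enat n"
proof -
  show pq_ne: "p \<noteq> q"
  proof
    assume "p = q"
    then have "y @ [s] \<doteq> y @ [t]" using y ceq.trans ceq.sym by blast
    then have "[s] \<doteq> [t]" by (simp only: lcancel)
    then show False using gen_inj st by blast
  qed
  have iff: "alt (2 * k) s t \<doteq> [] \<longleftrightarrow> alt (2 * k) p q \<doteq> []" for k
  proof
    note c = alt_conj[OF y, of "2 * k"]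
    show "alt (2 * k) p q \<doteq> []" if h: "alt (2 * k) s t \<doteq> []"
    proof -
      have "alt (2 * k) p q @ y \<doteq> [] @ y" using ceq.trans[OF ceq.sym[OF c] ceq_right[OF h, of y]] by simp
      then show ?thesis by (simp only: rcancel)
    qed
    show "alt (2 * k) s t \<doteq> []" if h: "alt (2 * k) p q \<doteq> []"
    proof -
      have "y @ alt (2 * k) s t \<doteq> y @ []" using ceq.trans[OF c ceq_left[OF h, of y]] by simp
      then show ?thesis by (simp only: lcancel)
    qed
  qed
  have "alt (2 * n) s t \<doteq> []" by (rule alt_full[OF ceq.braid[OF st]])
  then have o1: "case m p q of enat n' \<Rightarrow> n' dvd n | \<infinity> \<Rightarrow> n = 0" using alt_order[OF pq pq_ne] iff by blast
  have n2: "2 \<le> n" using m_ge_2[OF st] .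
  show "m p q = enat n"
  proof (cases "m p q")
    case (enat n')
    have "alt (2 * n') p q \<doteq> []" by (rule alt_full[OF ceq.braid[OF pq pq_ne enat]])
    then have "n dvd n'" using alt_order[OF st(1-3), of n'] iff st(4) by simp
    then show ?thesis using o1 enat dvd_antisym by simp
  next
    case infinity
    then show ?thesis using o1 n2 by simp
  qed
qed

text \<open>
  If \<open>s\<close> and \<open>t\<close> both fix the coset, the projections are the two sides of
  a braid relation between the labels, which have the same entry in the matrix. Otherwise at most
  one reflection of the dihedral group fixes it. The two sides of the relation cross the same
  \<open>n\<close> reflections in opposite order, so each projects to at most one letter, and to the
  same one.
\<close>

lemma project_braid:
  assumes T: "T \<subseteq> S" and st: "s \<in> S" "t \<in> S" "s \<noteq> t" "m s t = enat n"
  shows "pres_eq T (artin_relations T m) (project T x (alternating_word n s t)) (project T x (alternating_word n t s))"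
proof (cases "coset T (x @ [s]) = coset T x \<and> coset T (x @ [t]) = coset T x")
  case True
  let ?p = "label T x s" and ?q = "label T x t"
  have l: "?p \<in> T" "minimal_rep T x @ [s] \<doteq> ?p # minimal_rep T x" "?q \<in> T" "minimal_rep T x @ [t] \<doteq> ?q # minimal_rep T x"
    using label True by blast+
  have c: "?p \<noteq> ?q" "m ?p ?q = enat n" using conj_order[OF st _ _ l(2,4)] l(1,3) T by auto
  have w: "alternating_word n ?p ?q \<in> words T" "alternating_word n ?q ?p \<in> words T"
    using set_alt[of n ?p ?q] set_alt[of n ?q ?p] l(1,3) by (auto simp: words_def alternating_word_alt)
  have "(alternating_word n ?p ?q, alternating_word n ?q ?p) \<in> artin_relations T m"
    using c l(1,3) unfolding artin_relations_def by blast
  then show ?thesis using project_both[of T x s t n] project_both[of T x t s n] True w by (simp add: pres_eq.relator)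
next
  case False
  obtain \<sigma> where \<sigma>: "\<And>z. z \<in> lists {s, t} \<Longrightarrow> odd (length z) \<Longrightarrow> coset T (x @ z) = coset T x \<Longrightarrow> z \<doteq> \<sigma>"
    using dihedral_fixed_points[OF False] by blast
  have b: "alt n s t \<doteq> alt n t s" by (rule ceq.braid[OF st])
  \<comment> \<open>The \<open>i\<close>-th reflection crossed by the left-hand side fixes the
    coset.\<close>
  define fx where "fx i \<longleftrightarrow> coset T (x @ alt (2 * i + 1) s t) = coset T x" for i
  have dist: "i = j" if ij: "alt (2 * i + 1) s t \<doteq> alt (2 * j + 1) s t" "i < n" "j < n" for i j
  proof -
    have *: "i = j" if h: "alt (2 * i + 1) s t \<doteq> alt (2 * j + 1) s t" "i \<le> j" "j < n" for i j
    proof -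
      have "alt (2 * j + 1) s t = alt (2 * (j - i)) s t @ alt (2 * i + 1) s t"
        using alt_add[of "2 * (j - i)" "2 * i + 1" s t] h(2) by (simp add: algebra_simps del: alt.simps)
      then have "alt (2 * (j - i)) s t @ alt (2 * i + 1) s t \<doteq> [] @ alt (2 * i + 1) s t" using h(1) ceq.sym by simp
      then have "alt (2 * (j - i)) s t \<doteq> []" by (simp only: rcancel)
      then have "n dvd (j - i)" using alt_order[OF st(1-3)] st(4) by fastforce
      then show ?thesis using h(2,3) by (auto dest: dvd_imp_le)
    qed
    show ?thesis using *[of i j] *[of j i] ij ceq.sym by (metis nat_le_linear)
  qed
  have al: "alt k s t \<in> lists {s, t}" "alt k t s \<in> lists {s, t}" for k
    using set_alt[of k s t] set_alt[of k t s] by (auto simp: in_lists_conv_set)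
  have fs: "alt (2 * i + 1) s t \<doteq> \<sigma>" if "fx i" for i
  proof (rule \<sigma>[OF al(1)])
    show "odd (length (alt (2 * i + 1) s t))" by (simp del: alt.simps)
    show "coset T (x @ alt (2 * i + 1) s t) = coset T x" using that by (simp only: fx_def)
  qed
  have uniq: "i = j" if "fx i" "fx j" "i < n" "j < n" for i j
    by (rule dist[OF ceq.trans[OF fs[OF that(1)] ceq.sym[OF fs[OF that(2)]]] that(3,4)])
  have fx': "coset T (x @ alt (2 * i + 1) t s) = coset T x \<longleftrightarrow> fx (n - 1 - i)" if "i < n" for i
    using coset_cong[OF ceq_right[OF alt_opposite[OF ceq.sym[OF b] that], of x]] unfolding fx_def by simp
  let ?w = "alternating_word n s t" and ?w' = "alternating_word n t s"
  have lw: "length ?w = n" "length ?w' = n" by (simp_all add: alternating_word_alt)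
  have f1: "coset T (x @ take (Suc i) (map fst ?w)) = coset T (x @ take i (map fst ?w)) \<longleftrightarrow> fx i" if "i < n" for i
    using that fixed_iff[of T x i s t] unfolding map_fst_alternating fx_def by (simp add: take_alt del: alt.simps)
  have f2: "coset T (x @ take (Suc i) (map fst ?w')) = coset T (x @ take i (map fst ?w')) \<longleftrightarrow> fx (n - 1 - i)" if "i < n" for i
    using that fixed_iff[of T x i t s] fx'[OF that] unfolding map_fst_alternating by (simp add: take_alt del: alt.simps)
  show ?thesis
  proof (cases "\<exists>i<n. fx i")
    case no: False
    have "project T x ?w = []" using project_none[of ?w T x] f1 no lw by auto
    moreover have "project T x ?w' = []" using project_none[of ?w' T x] f2 no lw by auto
    ultimately show ?thesis by (simp add: pres_eq.refl words_def)
  next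
    case True
    then obtain i where i: "i < n" "fx i" by blast
    define i' where "i' = n - 1 - i"
    have i': "i' < n" "n - 1 - i' = i" using i(1) by (auto simp: i'_def)
    have key: "take k (alt n a c) @ [fst (alternating_word n a c ! k)] @ rev (minimal_rep T x @ take k (alt n a c)) =
       alt (2 * k + 1) a c @ rev (minimal_rep T x)" if "k < n" for k a c
    proof -
      have "take k (alt n a c) @ [alt n a c ! k] = alt (Suc k) a c"
        using that take_alt[of "Suc k" n a c] by (metis Suc_leI length_alt take_Suc_conv_app_nth)
      moreover have "fst (alternating_word n a c ! k) = alt n a c ! k" using that by (simp add: alternating_word_alt)
      moreover have "alt (2 * k + 1) a c = alt (Suc k) a c @ rev (alt k a c)" by (rule alt_palindrome)
      moreover have "take k (alt n a c) = alt k a c" using that by (simp add: take_alt)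
      ultimately show ?thesis by (metis append_assoc rev_append)
    qed
    have snd: "snd (alternating_word n a c ! k) = True" if "k < n" for k a c using that by (simp add: alternating_word_alt)
    obtain p where p: "p \<in> T" "project T x ?w = [(p, True)]" "[p] \<doteq> minimal_rep T x @ alt (2 * i + 1) s t @ rev (minimal_rep T x)"
    proof (rule project_one[of i ?w T x])
      show "i < length ?w" using i lw by simp
      show "coset T (x @ take (Suc i) (map fst ?w)) = coset T (x @ take i (map fst ?w))" using f1 i by simp
      show "coset T (x @ take (Suc j) (map fst ?w)) \<noteq> coset T (x @ take j (map fst ?w))" if "j < length ?w" "j \<noteq> i" for j
        using f1[of j] uniq[of i j] that i lw by auto
      fix r
      assume h: "r \<in> T" "project T x ?w = [(r, snd (?w ! i))]"
        "[r] \<doteq> minimal_rep T x @ take i (map fst ?w) @ [fst (?w ! i)] @ rev (minimal_rep T x @ take i (map fst ?w))"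
      show thesis
      proof (rule that[OF h(1)])
        show "project T x ?w = [(r, True)]" using h(2) snd[OF i(1)] by simp
        show "[r] \<doteq> minimal_rep T x @ alt (2 * i + 1) s t @ rev (minimal_rep T x)"
          using h(3) key[OF i(1), of s t] by (simp only: map_fst_alternating)
      qed
    qed
    obtain q where q: "q \<in> T" "project T x ?w' = [(q, True)]" "[q] \<doteq> minimal_rep T x @ alt (2 * i' + 1) t s @ rev (minimal_rep T x)"
    proof (rule project_one[of i' ?w' T x])
      show "i' < length ?w'" using i' lw by simp
      show "coset T (x @ take (Suc i') (map fst ?w')) = coset T (x @ take i' (map fst ?w'))" using f2 i i' by simp
      show "coset T (x @ take (Suc j) (map fst ?w')) \<noteq> coset T (x @ take j (map fst ?w'))" if "j < length ?w'" "j \<noteq> i'" for j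
        using f2[of j] uniq[of i "n - 1 - j"] that i i' lw by (auto simp: i'_def)
      fix r
      assume h: "r \<in> T" "project T x ?w' = [(r, snd (?w' ! i'))]"
        "[r] \<doteq> minimal_rep T x @ take i' (map fst ?w') @ [fst (?w' ! i')] @ rev (minimal_rep T x @ take i' (map fst ?w'))"
      show thesis
      proof (rule that[OF h(1)])
        show "project T x ?w' = [(r, True)]" using h(2) snd[OF i'(1)] by simp
        show "[r] \<doteq> minimal_rep T x @ alt (2 * i' + 1) t s @ rev (minimal_rep T x)"
          using h(3) key[OF i'(1), of t s] by (simp only: map_fst_alternating)
      qed
    qed
    have "alt (2 * i' + 1) t s \<doteq> alt (2 * i + 1) s t" using alt_opposite[OF b i(1)] by (simp add: i'_def)
    then have "minimal_rep T x @ (alt (2 * i' + 1) t s @ rev (minimal_rep T x)) \<doteq> minimal_rep T x @ (alt (2 * i + 1) s t @ rev (minimal_rep T x))"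
      by (intro ceq_right ceq_left)
    then have "[q] \<doteq> [p]" using p(3) q(3) ceq.trans ceq.sym by blast
    then have "q = p" using gen_inj p(1) q(1) T by blast
    then show ?thesis using p q by (simp add: pres_eq.refl words_def)
  qed
qed

lemma pres_eq_ceq: "pres_eq S (artin_relations S m) u v \<Longrightarrow> map fst u \<doteq> map fst v"
proof (induction rule: pres_eq.induct)
  case (sym u v) show ?case by (rule ceq.sym[OF sym.IH])
next
  case (trans u v w) show ?case by (rule ceq.trans[OF trans.IH])
next
  case (append u u' v v') show ?case using ceq.append[OF append.IH] by simp
next
  case (cancel s b) then show ?case by (simp add: ceq.square)
next
  case (relator u v)
  then obtain n s t where "u = alternating_word n s t" "v = alternating_word n t s" "s \<in> S" "t \<in> S" "s \<noteq> t" "m s t = enat n"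
    unfolding artin_relations_def by blast
  then show ?case by (simp add: map_fst_alternating ceq.braid)
qed simp

lemma project_pres_eq:
  assumes T: "T \<subseteq> S" and "pres_eq S (artin_relations S m) u v"
  shows "pres_eq T (artin_relations T m) (project T x u) (project T x v)"
  using assms(2)
proof (induction arbitrary: x rule: pres_eq.induct)
  case (refl w) then show ?case by (intro pres_eq.refl project_words)
next
  case (sym u v) show ?case by (rule pres_eq.sym[OF sym.IH])
next
  case (trans u v w) show ?case by (rule pres_eq.trans[OF trans.IH])
next
  case (append u u' v v')
  have "coset T (x @ map fst u) = coset T (x @ map fst u')"
    using pres_eq_ceq[OF append.hyps(1)] by (intro coset_cong ceq_right)
  then have "project T (x @ map fst u) v' = project T (x @ map fst u') v'" by (rule project_cong)
  then show ?case using pres_eq.append[OF append.IH(1)[of x] append.IH(2)[of "x @ map fst u"]] by (simp add: project_append)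
next
  case (cancel s b)
  have twice: "coset T (x @ [s] @ [s]) = coset T x"
    using coset_cong[OF ceq_right[OF ceq.square[of s], of x]] by simp
  show ?case
  proof (cases "coset T (x @ [s]) = coset T x")
    case True
    then show ?thesis using twice label(1)[OF True] label_cong[OF True] pres_eq.cancel[of "label T x s" T _ b] by simp
  next
    case False
    then show ?thesis using twice pres_eq.refl[of "[]" T] by (auto simp: words_def)
  qed
next
  case (relator u v)
  then obtain n s t where "u = alternating_word n s t" "v = alternating_word n t s" "s \<in> S" "t \<in> S" "s \<noteq> t" "m s t = enat n"
    unfolding artin_relations_def by blast
  then show ?case using project_braid[OF T] by simp
qed

lemma minimal_Nil: "minimal T []"
proof -
  have "len [] = 0" using len_eq_0[of "[]"] by simp
  then show ?thesis by (simp add: minimal_def)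
qed

lemma project_parabolic:
  assumes "T \<subseteq> S" "w \<in> words T" "coset T x = coset T []"
  shows "project T x w = w"
  using assms(2,3)
proof (induction w arbitrary: x)
  case (Cons l w)
  obtain s b where l: "l = (s, b)" by (cases l)
  have s: "s \<in> T" and w: "w \<in> words T" using Cons.prems(1) l by (auto simp: words_def)
  have "coset T (x @ [s]) = coset T ([] @ [s])" by (rule coset_right[OF Cons.prems(2)])
  also have "\<dots> = coset T []" using coset_Cons[OF s, of "[]"] by simp
  finally have c: "coset T (x @ [s]) = coset T []" .
  then have fx: "coset T (x @ [s]) = coset T x" using Cons.prems(2) by simp
  have m: "minimal_rep T x \<doteq> []" using minimal_unique[OF minimal_rep(1) minimal_Nil] minimal_rep(2) Cons.prems(2) by simp
  have "[] @ [s] \<doteq> minimal_rep T x @ [s]" using m by (intro ceq_left) (rule ceq.sym)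
  also note label(2)[OF fx]
  also have "label T x s # minimal_rep T x \<doteq> label T x s # []" using m by (rule ceq_Cons)
  finally have "[s] \<doteq> [label T x s]" by simp
  moreover have "s \<in> S" "label T x s \<in> S" using s label(1)[OF fx] assms(1) by auto
  ultimately have "label T x s = s" using gen_inj by metis
  then show ?case using Cons.IH[OF w c] fx l by simp
qed simp

text \<open>
  Deodhar's lemma builds the representative letter by letter out of the letters of the given word.
\<close>

lemma minimal_in_parabolic:
  assumes "x \<in> lists U"
  shows "\<exists>y\<in>lists U. minimal T y \<and> coset T y = coset T x"
  using assms
proof (induction x rule: rev_induct)
  case Nil then show ?case using minimal_Nil by (intro bexI[of _ "[]"]) auto
next
  case (snoc s x)
  then obtain y where y: "y \<in> lists U" "minimal T y" "coset T y = coset T x" and s: "s \<in> U" by auto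
  have c: "coset T (y @ [s]) = coset T (x @ [s])" by (rule coset_right[OF y(3)])
  show ?case
  proof (cases "minimal T (y @ [s])")
    case True
    then show ?thesis using c y(1) s by (intro bexI[of _ "y @ [s]"]) auto
  next
    case False
    then obtain t where "t \<in> T" "y @ [s] \<doteq> t # y" using deodhar[OF y(2)] by blast
    then have "coset T (y @ [s]) = coset T y" using coset_cong coset_Cons by metis
    then show ?thesis using c y by (intro bexI[of _ y]) auto
  qed
qed

lemma project_into_inter:
  assumes "T \<subseteq> S" "U \<subseteq> S" "x \<in> lists U" "w \<in> words U"
  shows "project T x w \<in> words (T \<inter> U)"
  using assms(4,3)
proof (induction w arbitrary: x)
  case (Cons l w)
  obtain s b where l: "l = (s, b)" by (cases l)
  have s: "s \<in> U" and w: "w \<in> words U" using Cons.prems(1) l by (auto simp: words_def)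
  have xs: "x @ [s] \<in> lists U" using Cons.prems(2) s by simp
  have "label T x s \<in> U" if fx: "coset T (x @ [s]) = coset T x"
  proof -
    obtain y where y: "y \<in> lists U" "minimal T y" "coset T y = coset T x" using minimal_in_parabolic[OF Cons.prems(2)] by blast
    have my: "minimal_rep T x \<doteq> y" using minimal_unique[OF minimal_rep(1) y(2)] minimal_rep(2) y(3) by simp
    have "[label T x s] @ minimal_rep T x \<doteq> minimal_rep T x @ [s]" using label(2)[OF fx] ceq.sym by simp
    then have "[label T x s] \<doteq> (minimal_rep T x @ [s]) @ rev (minimal_rep T x)" by (simp only: move_right)
    also have "(minimal_rep T x @ [s]) @ rev (minimal_rep T x) \<doteq> (y @ [s]) @ rev y"
      using my by (intro ceq.append ceq_rev ceq.refl)
    finally have e: "[label T x s] \<doteq> (y @ [s]) @ rev y" .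
    obtain v where v: "(y @ [s]) @ rev y \<doteq> v" "length v = len ((y @ [s]) @ rev y)" "set v \<subseteq> set ((y @ [s]) @ rev y)"
      using reduced_subword by blast
    have vU: "set v \<subseteq> U" using v(3) y(1) s by auto
    have ev: "[label T x s] \<doteq> v" using e v(1) by (rule ceq.trans)
    have "length v \<le> 1" using v(2) len_le[OF ceq.sym[OF e]] by simp
    moreover have "odd (length v)" using ceq_length[OF ev] by simp
    ultimately obtain u where u: "v = [u]" by (cases v) auto
    have "u \<in> S" "label T x s \<in> S" using vU u label(1)[OF fx] assms(1,2) by auto
    then have "label T x s = u" using gen_inj ev u by metis
    then show ?thesis using vU u by simp
  qed
  then have "(if coset T (x @ [s]) = coset T x then [(label T x s, b)] else []) \<in> words (T \<inter> U)"
    using label(1) by (auto simp: words_def)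
  then show ?case using Cons.IH[OF w xs] l words_append by fastforce
qed (simp add: words_def)

text \<open>
  Van der Lek's theorem: the projection is the identity on words over \<open>T\<close> and carries
  relations of the Artin group of \<open>S\<close> to relations of that of \<open>T\<close>.
\<close>

theorem parabolic_injective:
  assumes "T \<subseteq> S" "u \<in> words T" "v \<in> words T" "pres_eq S (artin_relations S m) u v"
  shows "pres_eq T (artin_relations T m) u v"
  using project_pres_eq[OF assms(1,4), of "[]"] project_parabolic[OF assms(1)] assms(2,3) by simp

lemma pres_eq_mono:
  assumes "T \<subseteq> S" "pres_eq T (artin_relations T m) u v"
  shows "pres_eq S (artin_relations S m) u v"
  using assms(2)
proof (induction rule: pres_eq.induct)
  case (refl w) then show ?case using assms(1) by (intro pres_eq.refl) (auto simp: words_def)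
next
  case (sym u v) show ?case by (rule pres_eq.sym[OF sym.IH])
next
  case (trans u v w) show ?case by (rule pres_eq.trans[OF trans.IH])
next
  case (append u u' v v') show ?case by (rule pres_eq.append[OF append.IH])
next
  case (cancel s b) then show ?case using assms(1) by (intro pres_eq.cancel) auto
next
  case (relator u v)
  have "artin_relations T m \<subseteq> artin_relations S m" using assms(1) unfolding artin_relations_def by blast
  then show ?case using relator assms(1) by (intro pres_eq.relator) (auto simp: words_def)
qed

text \<open>
  Also due to van der Lek: the projection to \<open>T\<close> leaves \<open>v\<close> unchanged and
  sends words over \<open>U\<close> to words over \<open>T \<inter> U\<close>.
\<close>

theorem parabolic_intersection:
  assumes "T \<subseteq> S" "U \<subseteq> S" "u \<in> words U" "v \<in> words T" "pres_eq S (artin_relations S m) u v"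
  shows "\<exists>w\<in>words (T \<inter> U). pres_eq S (artin_relations S m) v w"
proof -
  have "pres_eq T (artin_relations T m) (project T [] u) v"
    using project_pres_eq[OF assms(1,5), of "[]"] project_parabolic[OF assms(1,4)] by simp
  then have "pres_eq S (artin_relations S m) v (project T [] u)"
    using pres_eq_mono[OF assms(1)] pres_eq.sym by blast
  moreover have "project T [] u \<in> words (T \<inter> U)" using project_into_inter[OF assms(1,2) _ assms(3)] by simp
  ultimately show ?thesis by blast
qed

end

section \<open>Vertices of the Artin complex\<close>

definition inv_word :: "'s word \<Rightarrow> 's word" where
  "inv_word w = rev (map (\<lambda>l. (fst l, \<not> snd l)) w)"

lemma inv_word_words [simp]: "w \<in> words T \<Longrightarrow> inv_word w \<in> words T"
  by (force simp: words_def inv_word_def)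

lemma inv_inv_word [simp]: "inv_word (inv_word w) = w"
  by (simp add: inv_word_def rev_map comp_def)

lemma words_simps [simp]: "[] \<in> words T" "u @ v \<in> words T \<longleftrightarrow> u \<in> words T \<and> v \<in> words T"
  "l # w \<in> words T \<longleftrightarrow> fst l \<in> T \<and> w \<in> words T"
  by (auto simp: words_def mem_Times_iff)

lemma words_mono: "T \<subseteq> U \<Longrightarrow> w \<in> words T \<Longrightarrow> w \<in> words U"
  by (auto simp: words_def)

context coxeter
begin

abbreviation R where "R \<equiv> artin_relations S m"
abbreviation peq where "peq \<equiv> pres_eq S R"

lemma peq_refl: "w \<in> words S \<Longrightarrow> peq w w" by (rule pres_eq.refl)

lemma peq_words: "peq u v \<Longrightarrow> u \<in> words S" "peq u v \<Longrightarrow> v \<in> words S"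
  using pres_eq_words by blast+

lemma peq_left: "peq u u' \<Longrightarrow> v \<in> words S \<Longrightarrow> peq (u @ v) (u' @ v)"
  by (simp add: pres_eq.append pres_eq.refl)

lemma peq_right: "peq v v' \<Longrightarrow> u \<in> words S \<Longrightarrow> peq (u @ v) (u @ v')"
  by (simp add: pres_eq.append pres_eq.refl)

lemma peq_inv_right: "w \<in> words S \<Longrightarrow> peq (w @ inv_word w) []"
proof (induction w)
  case Nil then show ?case by (simp add: inv_word_def peq_refl)
next
  case (Cons l w)
  obtain s b where l: "l = (s, b)" by (cases l)
  have s: "s \<in> S" and w: "w \<in> words S" using Cons.prems l by auto
  have "peq ([(s, b)] @ ((w @ inv_word w) @ [(s, \<not> b)])) ([(s, b)] @ ([] @ [(s, \<not> b)]))"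
    using Cons.IH[OF w] s by (intro peq_right peq_left) auto
  then have "peq (l # w @ inv_word (l # w)) [(s, b), (s, \<not> b)]" by (simp add: l inv_word_def)
  then show ?case using pres_eq.trans[OF _ pres_eq.cancel[OF s]] by auto
qed

lemma peq_inv_left: "w \<in> words S \<Longrightarrow> peq (inv_word w @ w) []"
  using peq_inv_right[of "inv_word w"] by simp

lemma peq_move: assumes "w \<in> words S" "u \<in> words S" shows "peq (w @ u) v \<Longrightarrow> peq u (inv_word w @ v)"
proof -
  assume h: "peq (w @ u) v"
  have "peq ((inv_word w @ w) @ u) ([] @ u)" using assms by (intro peq_left peq_inv_left)
  moreover have "peq (inv_word w @ (w @ u)) (inv_word w @ v)" using h assms by (intro peq_right) auto
  ultimately show ?thesis using pres_eq.trans[OF pres_eq.sym] by fastforce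
qed

lemma peq_cancel: assumes "w \<in> words S" "u \<in> words S" "v \<in> words S" "peq (w @ u) (w @ v)" shows "peq u v"
proof -
  have "peq u (inv_word w @ (w @ v))" using peq_move[OF assms(1,2,4)] .
  moreover have "peq ((inv_word w @ w) @ v) ([] @ v)" using assms by (intro peq_left peq_inv_left)
  ultimately show ?thesis using pres_eq.trans by fastforce
qed

abbreviation cls where "cls \<equiv> pres_class S R"

lemma cls_eq_iff: "u \<in> words S \<Longrightarrow> cls u = cls v \<longleftrightarrow> peq u v" by (rule pres_class_eq_iff)

lemma cls_mult: "u \<in> words S \<Longrightarrow> v \<in> words S \<Longrightarrow> cls u \<otimes>\<^bsub>artin_group S m\<^esub> cls v = cls (u @ v)"
  unfolding artin_group_def by (rule presented_mult)

lemma carrier_artin: "carrier (artin_group S m) = cls ` words S"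
  by (simp add: artin_group_def presented_group_def)

lemma one_artin: "\<one>\<^bsub>artin_group S m\<^esub> = cls []"
  by (simp add: artin_group_def presented_group_def)

lemma cls_inv: "w \<in> words S \<Longrightarrow> inv\<^bsub>artin_group S m\<^esub> cls w = cls (inv_word w)"
proof -
  assume w: "w \<in> words S"
  interpret group "artin_group S m" by (rule group_artin_group)
  have "cls (inv_word w) \<otimes>\<^bsub>artin_group S m\<^esub> cls w = \<one>\<^bsub>artin_group S m\<^esub>"
    using w peq_inv_left[OF w] by (simp add: cls_mult one_artin cls_eq_iff)
  moreover have "cls w \<in> carrier (artin_group S m)" "cls (inv_word w) \<in> carrier (artin_group S m)"
    using w by (auto simp: carrier_artin)
  ultimately show ?thesis by (rule inv_equality)
qed

lemma standard_parabolic_words: assumes "T \<subseteq> S" shows "standard_parabolic S m T = cls ` words T"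
proof
  have gen: "artin_generator S m s = cls [(s, True)]" for s by (simp add: artin_generator_def)
  have TS: "w \<in> words T \<Longrightarrow> w \<in> words S" for w using assms words_mono by blast
  show "standard_parabolic S m T \<subseteq> cls ` words T"
  proof
    fix x assume "x \<in> standard_parabolic S m T"
    then show "x \<in> cls ` words T"
      unfolding standard_parabolic_def
    proof (induction rule: generate.induct)
      case one then show ?case by (simp add: one_artin)
    next
      case (incl h) then show ?case using gen by auto
    next
      case (inv h)
      then obtain s where s: "s \<in> T" "h = cls [(s, True)]" using gen by auto
      have "[(s, True)] \<in> words S" using s assms by auto
      then have "inv\<^bsub>artin_group S m\<^esub> h = cls (inv_word [(s, True)])" using s cls_inv by blast
      moreover have "inv_word [(s, True)] \<in> words T" using s by simp
      ultimately show ?case by blast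
    next
      case (eng h1 h2)
      then obtain u v where uv: "u \<in> words T" "v \<in> words T" "h1 = cls u" "h2 = cls v" by blast
      then have "h1 \<otimes>\<^bsub>artin_group S m\<^esub> h2 = cls (u @ v)" using cls_mult TS by blast
      then show ?case using uv by simp
    qed
  qed
  show "cls ` words T \<subseteq> standard_parabolic S m T"
  proof
    fix x assume "x \<in> cls ` words T"
    then obtain w where w: "w \<in> words T" "x = cls w" by blast
    have "cls w \<in> generate (artin_group S m) (artin_generator S m ` T)"
      using w(1)
    proof (induction w)
      case Nil then show ?case using generate.one[of "artin_group S m"] by (simp add: one_artin)
    next
      case (Cons l w)
      obtain s b where l: "l = (s, b)" by (cases l)
      have s: "s \<in> T" "w \<in> words T" using Cons.prems l by auto
      have sS: "[(s, b)] \<in> words S" "[(s, True)] \<in> words S" "w \<in> words S" using s TS assms by auto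
      have "cls [(s, b)] \<in> generate (artin_group S m) (artin_generator S m ` T)"
      proof (cases b)
        case True
        have "cls [(s, True)] \<in> artin_generator S m ` T" using s gen by (metis imageI)
        then have "cls [(s, True)] \<in> generate (artin_group S m) (artin_generator S m ` T)" by (rule generate.incl)
        then show ?thesis using True by simp
      next
        case False
        have "inv\<^bsub>artin_group S m\<^esub> cls [(s, True)] \<in> generate (artin_group S m) (artin_generator S m ` T)"
          using s gen by (intro generate.inv) auto
        then show ?thesis using cls_inv[OF sS(2)] False by (simp add: inv_word_def)
      qed
      then have "cls [(s, b)] \<otimes>\<^bsub>artin_group S m\<^esub> cls w \<in> generate (artin_group S m) (artin_generator S m ` T)"
        using Cons.IH[OF s(2)] by (rule generate.eng)
      then show ?case using cls_mult[OF sS(1,3)] l by simp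
    qed
    then show "x \<in> standard_parabolic S m T" using w by (simp add: standard_parabolic_def)
  qed
qed

definition vtx :: "'s word \<Rightarrow> 's \<Rightarrow> 's word set set" where
  "vtx w s = cls w <#\<^bsub>artin_group S m\<^esub> standard_parabolic S m (S - {s})"

lemma vtx_alt: assumes "w \<in> words S" shows "vtx w s = (\<lambda>u. cls (w @ u)) ` words (S - {s})"
proof -
  have "u \<in> words S" if "u \<in> words (S - {s})" for u using that words_mono[of "S - {s}" S] by blast
  then show ?thesis
    unfolding vtx_def l_coset_def standard_parabolic_words[OF Diff_subset] using cls_mult[OF assms] by auto
qed

lemma vtx_eq_iff: assumes "w \<in> words S" "w' \<in> words S"
  shows "vtx w s = vtx w' s \<longleftrightarrow> (\<exists>u\<in>words (S - {s}). peq w' (w @ u))"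
proof
  have sub: "u \<in> words S" if "u \<in> words (S - {s})" for u using that words_mono[of "S - {s}" S] by blast
  assume "vtx w s = vtx w' s"
  moreover have "cls (w' @ []) \<in> vtx w' s" unfolding vtx_alt[OF assms(2)] by (rule imageI) simp
  ultimately have "cls w' \<in> vtx w s" by simp
  then obtain u where "u \<in> words (S - {s})" "cls w' = cls (w @ u)" unfolding vtx_alt[OF assms(1)] by blast
  then show "\<exists>u\<in>words (S - {s}). peq w' (w @ u)" using cls_eq_iff[OF assms(2)] by blast
next
  have sub: "u \<in> words S" if "u \<in> words (S - {s})" for u using that words_mono[of "S - {s}" S] by blast
  have incl: "vtx w' s \<subseteq> vtx w s" if h: "w \<in> words S" "w' \<in> words S" "u \<in> words (S - {s})" "peq w' (w @ u)" for w w' u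
  proof
    fix x assume "x \<in> vtx w' s"
    then obtain v where v: "v \<in> words (S - {s})" "x = cls (w' @ v)" unfolding vtx_alt[OF h(2)] by blast
    have "peq (w' @ v) ((w @ u) @ v)" using h(4) sub[OF v(1)] by (rule peq_left)
    moreover have "w' @ v \<in> words S" using h(2) sub[OF v(1)] by simp
    ultimately have "x = cls (w @ (u @ v))" using v(2) cls_eq_iff[of "w' @ v" "w @ (u @ v)"] by simp
    then show "x \<in> vtx w s" unfolding vtx_alt[OF h(1)] using h(3) v(1) by auto
  qed
  assume "\<exists>u\<in>words (S - {s}). peq w' (w @ u)"
  then obtain u where u: "u \<in> words (S - {s})" "peq w' (w @ u)" by blast
  have "peq (w' @ inv_word u) ((w @ u) @ inv_word u)" using u sub by (intro peq_left) auto
  moreover have "peq (w @ (u @ inv_word u)) (w @ [])" using u sub assms by (intro peq_right peq_inv_right) auto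
  ultimately have "peq (w' @ inv_word u) w" using pres_eq.trans by fastforce
  then have "peq w (w' @ inv_word u)" by (rule pres_eq.sym)
  then show "vtx w s = vtx w' s" using incl[OF assms u] incl[OF assms(2,1) inv_word_words[OF u(1)]] by blast
qed

lemma vtx_cong: "peq w w' \<Longrightarrow> vtx w s = vtx w' s"
proof -
  assume h: "peq w w'"
  have "peq w' (w @ [])" using h pres_eq.sym by simp
  then show ?thesis using vtx_eq_iff[of w w' s] peq_words[OF h] by (meson words_simps(1))
qed

lemma vtx_append: assumes "w \<in> words S" "u \<in> words (S - {s})" shows "vtx (w @ u) s = vtx w s"
proof -
  have u: "u \<in> words S" using assms(2) words_mono[of "S - {s}" S] by blast
  then show ?thesis using vtx_eq_iff[of w "w @ u" s] assms peq_refl[of "w @ u"] by auto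
qed

text \<open>
  Equal cosets are cosets of the same subgroup. For \<open>s \<noteq> t\<close> the generator
  \<open>s\<close> lies in the parabolic subgroup of \<open>S - {t}\<close>, but not in that of
  \<open>S - {s}\<close>, which meets the cyclic group generated by \<open>s\<close> trivially.
\<close>

lemma vtx_type:
  assumes "w \<in> words S" "w' \<in> words S" "s \<in> S" "t \<in> S" "vtx w s = vtx w' t" shows "s = t"
proof (rule ccontr)
  assume ne: "s \<noteq> t"
  have sub: "u \<in> words S" if "u \<in> words (S - {s})" for u using that words_mono[of "S - {s}" S] by blast
  have mem: "\<exists>u\<in>words (S - {s}). peq (w' @ x) (w @ u)" if x: "x \<in> words (S - {t})" for x
  proof -
    have "cls (w' @ x) \<in> vtx w s" using x unfolding assms(5) vtx_alt[OF assms(2)] by blast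
    then obtain u where "u \<in> words (S - {s})" "cls (w' @ x) = cls (w @ u)" unfolding vtx_alt[OF assms(1)] by blast
    moreover have "w' @ x \<in> words S" using x assms(2) words_mono[of "S - {t}" S] by auto
    ultimately show ?thesis using cls_eq_iff by blast
  qed
  let ?g = "[(s, True)]"
  obtain u where u: "u \<in> words (S - {s})" "peq (w' @ []) (w @ u)" using mem[of "[]"] by auto
  obtain v where v: "v \<in> words (S - {s})" "peq (w' @ ?g) (w @ v)" using mem[of ?g] ne assms(3) by auto
  have g: "?g \<in> words S" using assms(3) by simp
  have "peq (w' @ ?g) ((w @ u) @ ?g)" using u(2) g peq_left[of w' "w @ u" ?g] by simp
  then have "peq (w @ (u @ ?g)) (w @ v)" using v(2) pres_eq.trans[OF pres_eq.sym] by fastforce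
  then have "peq (u @ ?g) v" using peq_cancel[OF assms(1)] sub u v g by simp
  then have "peq ?g (inv_word u @ v)" using peq_move[of u ?g v] sub u g by simp
  then have "peq (inv_word u @ v) ?g" by (rule pres_eq.sym)
  then obtain x where x: "x \<in> words ({s} \<inter> (S - {s}))" "peq ?g x"
    using parabolic_intersection[of "{s}" "S - {s}" "inv_word u @ v" ?g] u(1) v(1) assms(3) by auto
  have "x = []" using x(1) by (cases x) auto
  then have "[s] \<doteq> []" using pres_eq_ceq[OF x(2)] by simp
  then show False using ceq_length[of "[s]" "[]"] by simp
qed

text \<open>
  The intersection theorem, iterated over the finite set \<open>F\<close>.
\<close>

lemma parabolic_difference:
  assumes "U \<subseteq> S" "finite F" "k \<in> words U" "\<And>s. s \<in> F \<Longrightarrow> \<exists>u\<in>words (S - {s}). peq k u"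
  shows "\<exists>k'\<in>words (U - F). peq k k'"
  using assms(2,4)
proof (induction F rule: finite_induct)
  case empty
  then show ?case using assms(1,3) peq_refl words_mono[of U S k] by auto
next
  case (insert s F)
  then obtain k' where k': "k' \<in> words (U - F)" "peq k k'" by blast
  obtain u where u: "u \<in> words (S - {s})" "peq k u" using insert.prems by blast
  have "peq u k'" using pres_eq.trans[OF pres_eq.sym[OF u(2)] k'(2)] .
  then obtain x where x: "x \<in> words ((U - F) \<inter> (S - {s}))" "peq k' x"
    using parabolic_intersection[of "U - F" "S - {s}" u k'] assms(1) u(1) k'(1) by auto
  have "x \<in> words (U - insert s F)" using x(1) by (rule words_mono[rotated]) auto
  then show ?case using pres_eq.trans[OF k'(2) x(2)] by blast
qed

section \<open>Coset complexes and their links\<close>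

text \<open>
  The simplices of the Artin complex that have all their types in \<open>U\<close> and come from
  chambers in \<open>w A\<^sub>U\<close>. It is a copy of the Artin complex of \<open>U\<close> and
  the link of a simplex with the complementary types, which makes inductions over links possible
  without a change of the group.
\<close>

definition coset_complex :: "'s word \<Rightarrow> 's set \<Rightarrow> 's word set set set set" where
  "coset_complex w U = {vtx (w @ h) ` T | h T. h \<in> words U \<and> T \<subseteq> U \<and> T \<noteq> {}}"

lemma artin_complex_eq: "artin_complex S m = coset_complex [] S"
  unfolding artin_complex_def coset_complex_def carrier_artin vtx_def by auto

lemma abstract_coset_complex: assumes "U \<subseteq> S" shows "abstract_complex (coset_complex w U)"
  unfolding abstract_complex_def
proof (intro ballI conjI allI impI)
  fix \<sigma> assume "\<sigma> \<in> coset_complex w U"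
  then obtain h T where h: "\<sigma> = vtx (w @ h) ` T" "h \<in> words U" "T \<subseteq> U" "T \<noteq> {}" unfolding coset_complex_def by blast
  show "finite \<sigma>" using finite_subset[OF h(3) finite_subset[OF assms finite_S]] h(1) by simp
  show "\<sigma> \<noteq> {}" using h by blast
  fix \<tau> assume t: "\<tau> \<subseteq> \<sigma> \<and> \<tau> \<noteq> {}"
  then obtain T' where "T' \<subseteq> T" "\<tau> = vtx (w @ h) ` T'" using h(1) by (auto simp: subset_image_iff)
  moreover from this have "T' \<subseteq> U" "T' \<noteq> {}" using t h(3) by auto
  ultimately show "\<tau> \<in> coset_complex w U" using h(2) unfolding coset_complex_def by blast
qed

lemma coset_complex_rebase:
  assumes "U \<subseteq> S" "w \<in> words S" "h \<in> words U" shows "coset_complex (w @ h) U = coset_complex w U"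
proof -
  have hS: "x \<in> words S" if "x \<in> words U" for x using words_mono[OF assms(1) that] .
  have sub: "coset_complex (w @ h) U \<subseteq> coset_complex w U" if h: "h \<in> words U" for w h
  proof
    fix \<sigma> assume "\<sigma> \<in> coset_complex (w @ h) U"
    then obtain k T where k: "\<sigma> = vtx ((w @ h) @ k) ` T" "k \<in> words U" "T \<subseteq> U" "T \<noteq> {}" unfolding coset_complex_def by blast
    then have "\<sigma> = vtx (w @ (h @ k)) ` T" "h @ k \<in> words U" using h by auto
    then show "\<sigma> \<in> coset_complex w U" unfolding coset_complex_def using k(3,4) by blast
  qed
  have "coset_complex w U = coset_complex ((w @ h) @ inv_word h) U"
  proof -
    have e: "vtx (((w @ h) @ inv_word h) @ x) = vtx (w @ x)" if "x \<in> words U" for x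
    proof
      fix s
      have "peq ((w @ (h @ inv_word h)) @ x) ((w @ []) @ x)"
        using assms hS that by (intro peq_left peq_right peq_inv_right) auto
      then show "vtx (((w @ h) @ inv_word h) @ x) s = vtx (w @ x) s" using vtx_cong by simp
    qed
    show ?thesis unfolding coset_complex_def using e by (intro Collect_cong) metis
  qed
  also have "\<dots> \<subseteq> coset_complex (w @ h) U" using sub[of "inv_word h" "w @ h"] assms(3) by simp
  finally show ?thesis using sub[OF assms(3)] by blast
qed

text \<open>
  If the chamber of \<open>w k\<close> contains the vertices of \<open>w\<close> of all types in
  \<open>F\<close>, then \<open>k\<close> lies in all parabolic subgroups of the types \<open>S -
  {s}\<close> with \<open>s \<in> F\<close>, and hence in that of \<open>U - F\<close>.
\<close>

lemma link_coset_complex: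
  assumes U: "U \<subseteq> S" and w: "w \<in> words S" and F: "F \<subseteq> U" "F \<noteq> {}"
  shows "link (coset_complex w U) (vtx w ` F) = coset_complex w (U - F)"
proof
  have US: "x \<in> words S" if "x \<in> words U" for x using words_mono[OF U that] .
  show "link (coset_complex w U) (vtx w ` F) \<subseteq> coset_complex w (U - F)"
  proof
    fix \<sigma> assume "\<sigma> \<in> link (coset_complex w U) (vtx w ` F)"
    then have s: "\<sigma> \<in> coset_complex w U" "\<sigma> \<inter> vtx w ` F = {}" "\<sigma> \<union> vtx w ` F \<in> coset_complex w U"
      unfolding link_def by auto
    obtain k T where k: "k \<in> words U" "T \<subseteq> U" "\<sigma> \<union> vtx w ` F = vtx (w @ k) ` T"
      using s(3) unfolding coset_complex_def by blast
    have wk: "w @ k \<in> words S" using w k US by simp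
    have same: "vtx w s = vtx (w @ k) s" if sF: "s \<in> F" for s
    proof -
      have "vtx w s \<in> vtx (w @ k) ` T" using k(3) sF by blast
      then obtain t where t: "t \<in> T" "vtx w s = vtx (w @ k) t" by blast
      then have "s = t" using vtx_type[OF w wk] sF F k(2) U by blast
      then show ?thesis using t by simp
    qed
    have "\<exists>u\<in>words (S - {s}). peq k u" if sF: "s \<in> F" for s
    proof -
      obtain u where u: "u \<in> words (S - {s})" "peq (w @ k) (w @ u)" using same[OF sF] vtx_eq_iff[OF w wk, of s] by blast
      then have "peq k u" using peq_cancel[OF w] US k(1) words_mono[of "S - {s}" S u] by auto
      then show ?thesis using u(1) by blast
    qed
    then obtain k' where k': "k' \<in> words (U - F)" "peq k k'"
      using parabolic_difference[OF U _ k(1), of F] F finite_S U by (meson finite_subset subset_trans)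
    have vk: "vtx (w @ k) = vtx (w @ k')" using vtx_cong[OF peq_right[OF k'(2) w]] by blast
    obtain T' where T': "T' \<subseteq> T" "\<sigma> = vtx (w @ k) ` T'"
      using k(3) by (metis Un_upper1 subset_imageE)
    have "T' \<subseteq> U - F" using T' k(2) same s(2) by blast
    moreover have "T' \<noteq> {}" using s(1) T'(2) unfolding coset_complex_def by blast
    ultimately show "\<sigma> \<in> coset_complex w (U - F)" unfolding coset_complex_def using T'(2) vk k'(1) by auto
  qed
  show "coset_complex w (U - F) \<subseteq> link (coset_complex w U) (vtx w ` F)"
  proof
    fix \<sigma> assume "\<sigma> \<in> coset_complex w (U - F)"
    then obtain h T where h: "\<sigma> = vtx (w @ h) ` T" "h \<in> words (U - F)" "T \<subseteq> U - F" "T \<noteq> {}"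
      unfolding coset_complex_def by blast
    have hU: "h \<in> words U" using h(2) words_mono[of "U - F" U] by blast
    have wh: "w @ h \<in> words S" using w hU US by simp
    have same: "vtx (w @ h) s = vtx w s" if "s \<in> F" for s
    proof -
      have "U - F \<subseteq> S - {s}" using U that by blast
      then show ?thesis using vtx_append[OF w] h(2) words_mono by blast
    qed
    have "vtx w ` F = vtx (w @ h) ` F" using same by (intro image_cong) auto
    then have "\<sigma> \<union> vtx w ` F = vtx (w @ h) ` (T \<union> F)" using h(1) by blast
    moreover have "T \<union> F \<subseteq> U" "T \<union> F \<noteq> {}" using h F by auto
    ultimately have 1: "\<sigma> \<union> vtx w ` F \<in> coset_complex w U" unfolding coset_complex_def using hU by blast
    have 2: "\<sigma> \<inter> vtx w ` F = {}"
    proof (rule ccontr)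
      assume "\<not> ?thesis"
      then obtain s t where "s \<in> T" "t \<in> F" "vtx (w @ h) s = vtx w t" using h(1) by blast
      moreover from this have "s = t" using vtx_type[OF wh w] h(3) F U by blast
      ultimately show False using h(3) by blast
    qed
    have 3: "\<sigma> \<in> coset_complex w U" unfolding coset_complex_def using h hU by auto
    show "\<sigma> \<in> link (coset_complex w U) (vtx w ` F)" unfolding link_def using 1 2 3 by blast
  qed
qed

lemma coset_complex_simplex_link:
  assumes U: "U \<subseteq> S" and w: "w \<in> words S" and s: "\<sigma> \<in> coset_complex w U"
  obtains g F where "g \<in> words S" "F \<subseteq> U" "F \<noteq> {}" "\<sigma> = vtx g ` F" "link (coset_complex w U) \<sigma> = coset_complex g (U - F)"
proof -
  obtain h F where h: "\<sigma> = vtx (w @ h) ` F" "h \<in> words U" "F \<subseteq> U" "F \<noteq> {}" using s unfolding coset_complex_def by blast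
  have g: "w @ h \<in> words S" using w h(2) words_mono[OF U] by simp
  have "link (coset_complex w U) \<sigma> = coset_complex (w @ h) (U - F)"
    using link_coset_complex[OF U g h(3,4)] coset_complex_rebase[OF U w h(2)] h(1) by simp
  then show thesis using that[OF g h(3,4,1)] by blast
qed

lemma coset_complex_edge:
  assumes U: "U \<subseteq> S" and w: "w \<in> words S" and e: "edge (coset_complex w U) x y"
  obtains h s t where "h \<in> words U" "s \<in> U" "t \<in> U" "s \<noteq> t" "x = vtx (w @ h) s" "y = vtx (w @ h) t"
proof -
  obtain h T where h: "{x, y} = vtx (w @ h) ` T" "h \<in> words U" "T \<subseteq> U" using e unfolding edge_def coset_complex_def by blast
  have "x \<in> vtx (w @ h) ` T" "y \<in> vtx (w @ h) ` T" using h(1) by blast+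
  then obtain s t where st: "s \<in> T" "t \<in> T" "x = vtx (w @ h) s" "y = vtx (w @ h) t" by blast
  moreover have "s \<noteq> t" using e st unfolding edge_def by blast
  ultimately show thesis using that[OF h(2)] h(3) by blast
qed

end

section \<open>Edge paths in coset complexes\<close>

lemma path_homotopic_suffix: "path_homotopic X p q \<Longrightarrow> path_homotopic X (p @ v) (q @ v)"
proof (induction rule: path_homotopic.induct)
  case (sym p q) show ?case by (rule path_homotopic.sym[OF sym.IH])
next
  case (trans p q r) show ?case by (rule path_homotopic.trans[OF trans.IH])
next
  case (dup a p) show ?case using path_homotopic.dup[of X a "p @ v"] by simp
next
  case (tri a b c p) show ?case using path_homotopic.tri[OF tri, of "p @ v"] by simp
next
  case (cons p q a) show ?case using path_homotopic.cons[OF cons.IH] by simp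
qed (rule path_homotopic.refl)

lemma path_homotopic_prefix: "path_homotopic X p q \<Longrightarrow> path_homotopic X (u @ p) (u @ q)"
  by (induction u) (auto intro: path_homotopic.cons)

context coxeter
begin

context
  fixes w0 :: "'s word" and U :: "'s set"
  assumes w0: "w0 \<in> words S" and U: "U \<subseteq> S" and cardU: "3 \<le> card U"
begin

abbreviation X where "X \<equiv> coset_complex w0 U"
abbreviation V where "V g a \<equiv> vtx (w0 @ g) a"
abbreviation hom (infix \<open>\<sim>h\<close> 50) where "p \<sim>h q \<equiv> path_homotopic X p q"

lemma UU: "g \<in> words U \<Longrightarrow> g \<in> words S" using words_mono[OF U] .

lemma other1: "\<exists>r\<in>U. r \<noteq> s"
proof (rule ccontr)
  assume "\<not> ?thesis"
  then have "U \<subseteq> {s}" by blast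
  then have "card U \<le> card {s}" by (intro card_mono) auto
  then show False using cardU by simp
qed

lemma other2: "\<exists>r\<in>U. r \<noteq> s \<and> r \<noteq> t"
proof (rule ccontr)
  assume "\<not> ?thesis"
  then have "U \<subseteq> {s, t}" by blast
  then have "card U \<le> card {s, t}" by (intro card_mono) auto
  also have "\<dots> \<le> 2" by (simp add: card_insert_if)
  finally show False using cardU by simp
qed

text \<open>
  Crossing from a chamber to its neighbour along a letter \<open>s\<close> keeps the vertices of all
  types but \<open>s\<close>; the gallery of a word records one of them for each letter.
\<close>

definition spare where "spare s = (SOME r. r \<in> U \<and> r \<noteq> s)"

lemma spare: "spare s \<in> U" "spare s \<noteq> s"
proof -
  have "\<exists>r. r \<in> U \<and> r \<noteq> s" using other1 by blast
  then have "spare s \<in> U \<and> spare s \<noteq> s" unfolding spare_def by (rule someI_ex)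
  then show "spare s \<in> U" "spare s \<noteq> s" by auto
qed

primrec gallery :: "'s word \<Rightarrow> 's word \<Rightarrow> 's word set set list" where
  "gallery g [] = []"
| "gallery g (l # w) = V g (spare (fst l)) # gallery (g @ [l]) w"

lemma chamber: "g \<in> words U \<Longrightarrow> T \<subseteq> U \<Longrightarrow> T \<noteq> {} \<Longrightarrow> V g ` T \<in> X"
  unfolding coset_complex_def by blast

lemma chamber3: "g \<in> words U \<Longrightarrow> a \<in> U \<Longrightarrow> b \<in> U \<Longrightarrow> r \<in> U \<Longrightarrow> {V g a, V g b, V g r} \<in> X"
  using chamber[of g "{a, b, r}"] by simp

lemma chamber2: "g \<in> words U \<Longrightarrow> a \<in> U \<Longrightarrow> b \<in> U \<Longrightarrow> {V g a, V g b} \<in> X"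
  using chamber[of g "{a, b}"] by simp

lemma V_append: assumes "g \<in> words U" "u \<in> words (U - {s})" shows "V (g @ u) s = V g s"
proof -
  have "u \<in> words (S - {s})" using assms(2) by (rule words_mono[rotated]) (use U in auto)
  then show ?thesis using vtx_append[of "w0 @ g" u s] w0 UU[OF assms(1)] by simp
qed

lemma V_step: assumes "g \<in> words U" "fst l \<in> U" shows "V (g @ [l]) (spare (fst l)) = V g (spare (fst l))"
  using V_append[OF assms(1), of "[l]" "spare (fst l)"] assms(2) spare(2)[of "fst l"] by auto

lemma V_peq: assumes "peq g g'" shows "V g a = V g' a"
  using vtx_cong[OF peq_right[OF assms w0]] .

lemma insert_vertex:
  assumes "g \<in> words U" "a \<in> U" "b \<in> U" "r \<in> U"
  shows "V g a # V g b # q \<sim>h V g a # V g r # V g b # q"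
  using path_homotopic.sym[OF path_homotopic.tri[OF chamber3[OF assms(1,2,4,3)], of q]] .

text \<open>
  All chambers of the gallery share the vertex of type \<open>r\<close>, so the path cones off to
  it.
\<close>

lemma fixing_gallery:
  assumes r: "r \<in> U"
  shows "w \<in> words (U - {r}) \<Longrightarrow> g \<in> words U \<Longrightarrow> a \<in> U \<Longrightarrow> b \<in> U \<Longrightarrow>
    V g a # gallery g w @ [V (g @ w) b] \<sim>h [V g a, V g r, V (g @ w) b]"
proof (induction w arbitrary: g a)
  case Nil then show ?case using insert_vertex[OF _ _ _ r, of g a b "[]"] by simp
next
  case (Cons l w)
  have l: "fst l \<in> U" "fst l \<noteq> r" "w \<in> words (U - {r})" using Cons.prems(1) by auto
  have gl: "g @ [l] \<in> words U" using Cons.prems(2) l by simp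
  let ?spare = "spare (fst l)"
  have Vr: "V (g @ [l]) r = V g r" using V_append[OF Cons.prems(2), of "[l]" r] l by auto
  have "V (g @ [l]) ?spare # gallery (g @ [l]) w @ [V ((g @ [l]) @ w) b] \<sim>h [V (g @ [l]) ?spare, V (g @ [l]) r, V ((g @ [l]) @ w) b]"
    by (rule Cons.IH[OF l(3) gl spare(1) Cons.prems(4)])
  then have "V g ?spare # gallery (g @ [l]) w @ [V (g @ l # w) b] \<sim>h [V g ?spare, V g r, V (g @ l # w) b]"
    using V_step[OF Cons.prems(2) l(1)] Vr by simp
  then have 1: "V g a # V g ?spare # gallery (g @ [l]) w @ [V (g @ l # w) b] \<sim>h [V g a, V g ?spare, V g r, V (g @ l # w) b]"
    by (rule path_homotopic.cons)
  have 2: "[V g a, V g ?spare, V g r, V (g @ l # w) b] \<sim>h [V g a, V g r, V (g @ l # w) b]"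
    by (rule path_homotopic.tri) (rule chamber3[OF Cons.prems(2,3) spare(1) r])
  show ?case using path_homotopic.trans[OF 1 2] by simp
qed

lemma insert_after_gallery:
  assumes "e \<in> U" "f \<in> U"
  shows "u \<in> words U \<Longrightarrow> g \<in> words U \<Longrightarrow> a \<in> U \<Longrightarrow>
    V g a # gallery g u @ V (g @ u) f # q \<sim>h V g a # gallery g u @ V (g @ u) e # V (g @ u) f # q"
proof (induction u arbitrary: g a)
  case Nil then show ?case using insert_vertex[of g a f e q] assms by simp
next
  case (Cons l u)
  have l: "fst l \<in> U" "u \<in> words U" using Cons.prems(1) by auto
  have gl: "g @ [l] \<in> words U" using Cons.prems(2) l by simp
  have "V (g @ [l]) (spare (fst l)) # gallery (g @ [l]) u @ V ((g @ [l]) @ u) f # q \<sim>h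
    V (g @ [l]) (spare (fst l)) # gallery (g @ [l]) u @ V ((g @ [l]) @ u) e # V ((g @ [l]) @ u) f # q"
    by (rule Cons.IH[OF l(2) gl spare(1)])
  from path_homotopic.cons[OF this, of "V g a"] show ?case using V_step[OF Cons.prems(2) l(1)] by simp
qed

lemma gallery_append: "gallery g (u @ v) = gallery g u @ gallery (g @ u) v"
  by (induction u arbitrary: g) auto

lemma gallery_peq: "peq g g' \<Longrightarrow> w \<in> words U \<Longrightarrow> gallery g w = gallery g' w"
proof (induction w arbitrary: g g')
  case (Cons l w)
  have "[l] \<in> words S" using Cons.prems(2) U by auto
  then have "peq (g @ [l]) (g' @ [l])" using Cons.prems(1) by (intro peq_left)
  then show ?case using Cons.IH[of "g @ [l]" "g' @ [l]"] Cons.prems V_peq[OF Cons.prems(1)] by simp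
qed simp

lemma gallery_head: assumes "g \<in> words U" "v \<in> words U" "b \<in> U"
  shows "\<exists>f q. f \<in> U \<and> gallery g v @ [V (g @ v) b] = V g f # q"
  using assms spare by (cases v) auto

lemma split_gallery:
  assumes "g \<in> words U" "u \<in> words U" "v \<in> words U" "a \<in> U" "b \<in> U" "e \<in> U"
  shows "V g a # gallery g (u @ v) @ [V (g @ u @ v) b] \<sim>h
    (V g a # gallery g u @ [V (g @ u) e]) @ gallery (g @ u) v @ [V ((g @ u) @ v) b]"
proof -
  obtain f q where f: "f \<in> U" "gallery (g @ u) v @ [V ((g @ u) @ v) b] = V (g @ u) f # q"
    using gallery_head[of "g @ u" v b] assms by auto
  show ?thesis using insert_after_gallery[OF assms(6) f(1) assms(2,1,4), of q] f(2) by (simp add: gallery_append)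
qed

text \<open>
  A relation involves at most two letters. As \<open>U\<close> has a third one, the galleries of
  both sides of the relation stay in the star of a vertex of this third type.
\<close>

lemma gallery_invariance:
  assumes "pres_eq U (artin_relations U m) u v"
  shows "g \<in> words U \<Longrightarrow> a \<in> U \<Longrightarrow> b \<in> U \<Longrightarrow> V g a # gallery g u @ [V (g @ u) b] \<sim>h V g a # gallery g v @ [V (g @ v) b]"
  using assms
proof (induction arbitrary: g a b rule: pres_eq.induct)
  case (refl w) show ?case by (rule path_homotopic.refl)
next
  case (sym u v) show ?case by (rule path_homotopic.sym[OF sym.IH[OF sym.prems]])
next
  case (trans u v w) show ?case by (rule path_homotopic.trans[OF trans.IH(1)[OF trans.prems] trans.IH(2)[OF trans.prems]])
next
  case (append u u' v v')
  have w: "u \<in> words U" "u' \<in> words U" "v \<in> words U" "v' \<in> words U"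
    using pres_eq_words[OF append.hyps(1)] pres_eq_words[OF append.hyps(2)] by auto
  have gu: "g @ u \<in> words U" "g @ u' \<in> words U" using append.prems w by auto
  have pq: "peq (g @ u) (g @ u')" using pres_eq_mono[OF U append.hyps(1)] UU append.prems by (intro peq_right)
  have pv: "peq ((g @ u) @ v') ((g @ u') @ v')" using pq UU[OF w(4)] by (rule peq_left)
  have 1: "V g a # gallery g (u @ v) @ [V (g @ u @ v) b] \<sim>h (V g a # gallery g u @ [V (g @ u) a]) @ gallery (g @ u) v @ [V ((g @ u) @ v) b]"
    using append.prems w by (intro split_gallery) auto
  have 2: "(V g a # gallery g u @ [V (g @ u) a]) @ gallery (g @ u) v @ [V ((g @ u) @ v) b] \<sim>h
      (V g a # gallery g u @ [V (g @ u) a]) @ gallery (g @ u) v' @ [V ((g @ u) @ v') b]"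
    using path_homotopic_prefix[OF append.IH(2)[OF gu(1) append.prems(2,3)], of "V g a # gallery g u"] by simp
  have 3: "(V g a # gallery g u @ [V (g @ u) a]) @ gallery (g @ u) v' @ [V ((g @ u) @ v') b] \<sim>h
      (V g a # gallery g u' @ [V (g @ u') a]) @ gallery (g @ u) v' @ [V ((g @ u) @ v') b]"
    by (rule path_homotopic_suffix[OF append.IH(1)[OF append.prems(1,2,2)]])
  have 4: "(V g a # gallery g u' @ [V (g @ u') a]) @ gallery (g @ u) v' @ [V ((g @ u) @ v') b] =
      (V g a # gallery g u' @ [V (g @ u') a]) @ gallery (g @ u') v' @ [V ((g @ u') @ v') b]"
    using gallery_peq[OF pq w(4)] V_peq[OF pv] by simp
  have 5: "(V g a # gallery g u' @ [V (g @ u') a]) @ gallery (g @ u') v' @ [V ((g @ u') @ v') b] \<sim>h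
      V g a # gallery g (u' @ v') @ [V (g @ u' @ v') b]"
    using append.prems w by (intro path_homotopic.sym[OF split_gallery]) auto
  show ?case
    using path_homotopic.trans[OF 1 path_homotopic.trans[OF 2 path_homotopic.trans[OF 3[unfolded 4] 5]]] by simp
next
  case (cancel s b' g a b)
  obtain r where r: "r \<in> U" "r \<noteq> s" using other1 by blast
  let ?w = "[(s, b'), (s, \<not> b')]"
  have w: "?w \<in> words (U - {r})" "[] \<in> words (U - {r})" using r cancel by auto
  have "peq (g @ ?w) (g @ [])"
    using pres_eq.cancel[of s S _ b'] cancel U UU by (intro peq_right) auto
  then have e: "V (g @ ?w) b = V g b" using V_peq by fastforce
  have 1: "V g a # gallery g ?w @ [V (g @ ?w) b] \<sim>h [V g a, V g r, V (g @ ?w) b]"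
    by (rule fixing_gallery[OF r(1) w(1) cancel.prems])
  have 2: "V g a # gallery g [] @ [V (g @ []) b] \<sim>h [V g a, V g r, V (g @ []) b]"
    by (rule fixing_gallery[OF r(1) w(2) cancel.prems])
  have 3: "[V g a, V g r, V (g @ ?w) b] = [V g a, V g r, V (g @ []) b]" using e by simp
  show ?case by (rule path_homotopic.trans[OF 1[unfolded 3] path_homotopic.sym[OF 2]])
next
  case (relator u v)
  then obtain n s t where h: "u = alternating_word n s t" "v = alternating_word n t s" "s \<in> U" "t \<in> U"
    unfolding artin_relations_def by blast
  obtain r where r: "r \<in> U" "r \<noteq> s" "r \<noteq> t" using other2 by blast
  have w: "u \<in> words (U - {r})" "v \<in> words (U - {r})"
    using set_alt[of n s t] set_alt[of n t s] h r by (auto simp: alternating_word_alt words_def)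
  have "pres_eq U (artin_relations U m) u v" using relator by (intro pres_eq.relator)
  then have "peq (g @ u) (g @ v)" using pres_eq_mono[OF U] UU relator.prems by (intro peq_right) auto
  then have e: "V (g @ u) b = V (g @ v) b" by (rule V_peq)
  have 1: "V g a # gallery g u @ [V (g @ u) b] \<sim>h [V g a, V g r, V (g @ u) b]"
    by (rule fixing_gallery[OF r(1) w(1) relator.prems])
  have 2: "V g a # gallery g v @ [V (g @ v) b] \<sim>h [V g a, V g r, V (g @ v) b]"
    by (rule fixing_gallery[OF r(1) w(2) relator.prems])
  have 3: "[V g a, V g r, V (g @ u) b] = [V g a, V g r, V (g @ v) b]" using e by simp
  show ?case by (rule path_homotopic.trans[OF 1[unfolded 3] path_homotopic.sym[OF 2]])
qed

text \<open>
  Turning around the vertex at which a path ends does not change its class.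
\<close>

lemma absorb:
  assumes "g \<in> words U" "w \<in> words U" "u \<in> words (U - {b})" "a \<in> U" "b \<in> U" "f \<in> U"
  shows "V g a # gallery g (w @ u) @ [V (g @ w @ u) f] \<sim>h (V g a # gallery g w @ [V (g @ w) b]) @ [V (g @ w @ u) f]"
proof -
  have uU: "u \<in> words U" using assms(3) by (rule words_mono[rotated]) auto
  have gw: "g @ w \<in> words U" using assms by simp
  have 1: "V g a # gallery g (w @ u) @ [V (g @ w @ u) f] \<sim>h
    (V g a # gallery g w @ [V (g @ w) b]) @ gallery (g @ w) u @ [V ((g @ w) @ u) f]"
    by (rule split_gallery[OF assms(1,2) uU assms(4,6,5)])
  have "V (g @ w) b # gallery (g @ w) u @ [V ((g @ w) @ u) f] \<sim>h [V (g @ w) b, V (g @ w) b, V ((g @ w) @ u) f]"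
    by (rule fixing_gallery[OF assms(5,3) gw assms(5,6)])
  then have "V (g @ w) b # gallery (g @ w) u @ [V ((g @ w) @ u) f] \<sim>h [V (g @ w) b, V ((g @ w) @ u) f]"
    by (rule path_homotopic.trans[OF _ path_homotopic.dup])
  then have "(V g a # gallery g w) @ V (g @ w) b # gallery (g @ w) u @ [V ((g @ w) @ u) f] \<sim>h
    (V g a # gallery g w) @ [V (g @ w) b, V ((g @ w) @ u) f]"
    by (rule path_homotopic_prefix)
  then have 2: "(V g a # gallery g w @ [V (g @ w) b]) @ gallery (g @ w) u @ [V ((g @ w) @ u) f] \<sim>h
    (V g a # gallery g w @ [V (g @ w) b]) @ [V (g @ w @ u) f]" by simp
  show ?thesis by (rule path_homotopic.trans[OF 1 2])
qed

lemma same_vertex_word: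
  assumes "g \<in> words U" "h \<in> words U" "b \<in> U" "V g b = V h b"
  obtains u where "u \<in> words (U - {b})" "peq h (g @ u)"
proof -
  have wg: "w0 @ g \<in> words S" "w0 @ h \<in> words S" using w0 assms UU by auto
  obtain x where x: "x \<in> words (S - {b})" "peq (w0 @ h) ((w0 @ g) @ x)" using vtx_eq_iff[OF wg] assms(4) by blast
  have xS: "x \<in> words S" using x(1) by (rule words_mono[rotated]) auto
  have "peq h (g @ x)" using peq_cancel[OF w0, of h "g @ x"] x(2) xS UU assms by simp
  then have "peq x (inv_word g @ h)" using peq_move[of g x h] pres_eq.sym UU assms xS by blast
  then obtain u where u: "u \<in> words (U \<inter> (S - {b}))" "peq (inv_word g @ h) u"
    using parabolic_intersection[OF U, of "S - {b}" x "inv_word g @ h"] x(1) assms by auto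
  have uU: "u \<in> words (U - {b})" using u(1) by (rule words_mono[rotated]) auto
  have "peq (g @ (inv_word g @ h)) (g @ u)" using u(2) UU assms by (intro peq_right) auto
  moreover have "peq ((g @ inv_word g) @ h) ([] @ h)" using UU assms by (intro peq_left peq_inv_right) auto
  ultimately have "peq h (g @ u)" using pres_eq.trans[OF pres_eq.sym] by fastforce
  then show thesis using that uU by blast
qed

lemma vertex_form: assumes "{x} \<in> X" obtains g a where "g \<in> words U" "a \<in> U" "x = V g a"
proof -
  obtain h T where h: "{x} = V h ` T" "h \<in> words U" "T \<subseteq> U" "T \<noteq> {}" using assms unfolding coset_complex_def by blast
  then obtain t where "t \<in> T" by blast
  then show thesis using that[OF h(2), of t] h by blast
qed

lemma V_type: "g \<in> words U \<Longrightarrow> h \<in> words U \<Longrightarrow> a \<in> U \<Longrightarrow> b \<in> U \<Longrightarrow> V g a = V h b \<Longrightarrow> a = b"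
  using vtx_type[of "w0 @ g" "w0 @ h" a b] w0 UU U by auto

text \<open>
  Every edge path follows a gallery: consecutive edges share a vertex, and the chambers which
  contain them differ by an element of the stabilizer of this vertex.
\<close>

lemma path_normal_form:
  assumes g: "g \<in> words U" "a \<in> U"
  shows "edge_path X p \<Longrightarrow> hd p = V g a \<Longrightarrow>
    \<exists>w\<in>words U. \<exists>b\<in>U. last p = V (g @ w) b \<and> p \<sim>h V g a # gallery g w @ [V (g @ w) b]"
proof (induction p rule: rev_induct)
  case Nil then show ?case by (simp add: edge_path_def)
next
  case (snoc y p)
  show ?case
  proof (cases "p = []")
    case True
    then have "y = V g a" using snoc.prems by simp
    then show ?thesis using True g path_homotopic.sym[OF path_homotopic.dup[of X "V g a" "[]"]]
      by (intro bexI[of _ "[]"] bexI[of _ a]) auto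
  next
    case False
    have ep: "edge_path X p" "hd p = V g a" "{last p, y} \<in> X"
      using snoc.prems False by (auto simp: edge_path_def successively_append_iff)
    obtain w b where w: "w \<in> words U" "b \<in> U" "last p = V (g @ w) b" "p \<sim>h V g a # gallery g w @ [V (g @ w) b]"
      using snoc.IH[OF ep(1,2)] by blast
    obtain h T where h: "{last p, y} = V h ` T" "h \<in> words U" "T \<subseteq> U" using ep(3) unfolding coset_complex_def by blast
    have "last p \<in> V h ` T" "y \<in> V h ` T" using h(1) by blast+
    then obtain b' f where bf: "b' \<in> U" "f \<in> U" "last p = V h b'" "y = V h f" using h(3) by blast
    have gw: "g @ w \<in> words U" using g w by simp
    have "b = b'" using V_type[OF gw h(2) w(2) bf(1)] w(3) bf(3) by simp
    then obtain u where u: "u \<in> words (U - {b})" "peq h ((g @ w) @ u)"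
      using same_vertex_word[OF gw h(2) w(2)] w(3) bf(3) by metis
    have uU: "u \<in> words U" using u(1) by (rule words_mono[rotated]) auto
    have y: "y = V (g @ w @ u) f" using V_peq[OF u(2)] bf(4) by simp
    have 1: "p @ [y] \<sim>h (V g a # gallery g w @ [V (g @ w) b]) @ [y]" by (rule path_homotopic_suffix[OF w(4)])
    have 2: "V g a # gallery g (w @ u) @ [V (g @ w @ u) f] \<sim>h (V g a # gallery g w @ [V (g @ w) b]) @ [y]"
      using absorb[OF g(1) w(1) u(1) g(2) w(2) bf(2)] y by simp
    have "p @ [y] \<sim>h V g a # gallery g (w @ u) @ [V (g @ w @ u) f]"
      by (rule path_homotopic.trans[OF 1 path_homotopic.sym[OF 2]])
    then show ?thesis using w(1) uU bf(2) y by (intro bexI[of _ "w @ u"] bexI[of _ f]) auto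
  qed
qed

lemma gallery_edge_path:
  "w \<in> words U \<Longrightarrow> g \<in> words U \<Longrightarrow> a \<in> U \<Longrightarrow> b \<in> U \<Longrightarrow> edge_path X (V g a # gallery g w @ [V (g @ w) b])"
proof (induction w arbitrary: g a)
  case Nil then show ?case using chamber2[of g a a] chamber2[of g a b] by (simp add: edge_path_def)
next
  case (Cons l w)
  have l: "fst l \<in> U" "w \<in> words U" using Cons.prems(1) by auto
  have gl: "g @ [l] \<in> words U" using Cons.prems(2) l by simp
  have "edge_path X (V (g @ [l]) (spare (fst l)) # gallery (g @ [l]) w @ [V ((g @ [l]) @ w) b])"
    by (rule Cons.IH[OF l(2) gl spare(1) Cons.prems(4)])
  then have "edge_path X (V g (spare (fst l)) # gallery (g @ [l]) w @ [V (g @ l # w) b])"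
    using V_step[OF Cons.prems(2) l(1)] by simp
  then show ?case using chamber2[OF Cons.prems(2,3), of "spare (fst l)"] chamber2[OF Cons.prems(2,3,3)] spare(1)
    by (simp add: edge_path_def)
qed

lemma edge_simply_connected_coset_complex: "edge_simply_connected X"
  unfolding edge_simply_connected_def
proof (intro conjI allI impI)
  fix x y assume "{x} \<in> X \<and> {y} \<in> X"
  then obtain g a h b where xy: "g \<in> words U" "a \<in> U" "x = V g a" "h \<in> words U" "b \<in> U" "y = V h b"
    using vertex_form by metis
  define w where "w = inv_word g @ h"
  have w: "w \<in> words U" using xy by (simp add: w_def)
  have "peq ((g @ inv_word g) @ h) ([] @ h)" using xy UU by (intro peq_left peq_inv_right) auto
  then have "V (g @ w) b = y" using V_peq[of "g @ w" h b] xy by (simp add: w_def)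
  then show "\<exists>p. edge_path X p \<and> hd p = x \<and> last p = y"
    using gallery_edge_path[OF w xy(1,2,5)] xy(3) by (intro exI[of _ "V g a # gallery g w @ [V (g @ w) b]"]) auto
next
  fix p q assume h: "edge_path X p \<and> edge_path X q \<and> hd p = hd q \<and> last p = last q"
  have "{hd p} \<in> X" using h by (simp add: edge_path_def)
  then obtain g a where g: "g \<in> words U" "a \<in> U" "hd p = V g a" using vertex_form by metis
  obtain w b where w: "w \<in> words U" "b \<in> U" "last p = V (g @ w) b" "p \<sim>h V g a # gallery g w @ [V (g @ w) b]"
    using path_normal_form[OF g(1,2)] h g(3) by metis
  obtain w' b' where w': "w' \<in> words U" "b' \<in> U" "last q = V (g @ w') b'" "q \<sim>h V g a # gallery g w' @ [V (g @ w') b']"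
    using path_normal_form[OF g(1,2)] h g(3) by metis
  have gw: "g @ w \<in> words U" "g @ w' \<in> words U" using g w w' by auto
  have bb: "b' = b" using V_type[OF gw(2,1) w'(2) w(2)] w(3) w'(3) h by simp
  have "V (g @ w) b = V (g @ w') b" using bb w(3) w'(3) h by simp
  then obtain u where u: "u \<in> words (U - {b})" "peq (g @ w') ((g @ w) @ u)" using same_vertex_word[OF gw w(2)] by blast
  have uU: "u \<in> words U" using u(1) by (rule words_mono[rotated]) auto
  have "peq w' (w @ u)" using peq_cancel[OF UU[OF g(1)], of w' "w @ u"] u(2) UU w(1) w'(1) uU by simp
  then have "pres_eq U (artin_relations U m) w' (w @ u)" using parabolic_injective[OF U w'(1)] w(1) uU by simp
  then have 1: "V g a # gallery g w' @ [V (g @ w') b] \<sim>h V g a # gallery g (w @ u) @ [V (g @ w @ u) b]"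
    by (rule gallery_invariance[OF _ g(1,2) w(2)])
  have 2: "V g a # gallery g (w @ u) @ [V (g @ w @ u) b] \<sim>h (V g a # gallery g w @ [V (g @ w) b]) @ [V (g @ w @ u) b]"
    by (rule absorb[OF g(1) w(1) u(1) g(2) w(2) w(2)])
  have "V (g @ w @ u) b = V (g @ w) b" using V_append[OF gw(1) u(1)] by simp
  then have 3: "(V g a # gallery g w @ [V (g @ w) b]) @ [V (g @ w @ u) b] \<sim>h V g a # gallery g w @ [V (g @ w) b]"
    using path_homotopic_prefix[OF path_homotopic.dup[of X "V (g @ w) b" "[]"], of "V g a # gallery g w"] by simp
  have "q \<sim>h V g a # gallery g w @ [V (g @ w) b]"
    using path_homotopic.trans[OF w'(4)[unfolded bb] path_homotopic.trans[OF 1 path_homotopic.trans[OF 2 3]]] .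
  then show "p \<sim>h q" by (rule path_homotopic.trans[OF w(4) path_homotopic.sym])
qed

end

end

section \<open>Dihedral Artin groups have no short cycles\<close>

text \<open>
  Only coincidences between two sums of two powers have to be excluded. The base is
  \<open>-9\<close> because it is the eigenvalue of a generator at \<open>p = 3\<close>;
  divisibility by \<open>9\<close> then compares the smallest exponents.
\<close>

lemma power_sum_unique_nat:
  fixes i j k l :: nat
  assumes "(-9::int) ^ i + (-9) ^ j = (-9) ^ k + (-9) ^ l"
  shows "i = k \<and> j = l \<or> i = l \<and> j = k"
proof -
  have inj: "a = b" if "(-9::int) ^ a = (-9) ^ b" for a b :: nat
  proof -
    have "\<bar>(-9::int) ^ a\<bar> = \<bar>(-9) ^ b\<bar>" using that by simp
    then have "(9::int) ^ a = 9 ^ b" by (simp add: power_abs)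
    then show ?thesis by simp
  qed
  \<comment> \<open>Divided by the smallest power, one side would be divisible by \<open>9\<close>
    and the other one would not.\<close>
  have least: "\<not> i < k" if h: "(-9::int) ^ i + (-9) ^ j = (-9) ^ k + (-9) ^ l" "i \<le> j" "k \<le> l" for i j k l :: nat
  proof
    assume ik: "i < k"
    have e: "(-9::int) ^ n = (-9) ^ i * (-9) ^ (n - i)" if "i \<le> n" for n using that by (simp flip: power_add)
    have "(-9::int) ^ i * (1 + (-9) ^ (j - i)) = (-9) ^ i * ((-9) ^ (k - i) + (-9) ^ (l - i))"
      using h(1) e[of j] e[of k] e[of l] h(2,3) ik by (simp add: distrib_left)
    then have eq: "1 + (-9::int) ^ (j - i) = (-9) ^ (k - i) + (-9) ^ (l - i)" by simp
    have d: "(9::int) dvd (-9) ^ n" if "0 < n" for n using that by (cases n) auto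
    have "(9::int) dvd (-9) ^ (k - i) + (-9) ^ (l - i)" using d ik h(3) by (intro dvd_add) auto
    then have n: "(9::int) dvd 1 + (-9) ^ (j - i)" using eq by simp
    show False
    proof (cases "j = i")
      case True then show False using n by simp
    next
      case False
      then have "(9::int) dvd (-9) ^ (j - i)" using d h(2) by simp
      then have "(9::int) dvd 1" using n dvd_add_left_iff by blast
      then show False by simp
    qed
  qed
  have sorted: "i = k \<and> j = l" if h: "(-9::int) ^ i + (-9) ^ j = (-9) ^ k + (-9) ^ l" "i \<le> j" "k \<le> l" for i j k l :: nat
  proof -
    have "i = k" using least[OF h] least[OF h(1)[symmetric] h(3,2)] by simp
    then show ?thesis using h(1) inj[of j l] by simp
  qed
  have c: "(-9::int) ^ a + (-9) ^ b = (-9) ^ b + (-9) ^ a" for a b :: nat by simp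
  consider "i \<le> j" "k \<le> l" | "i \<le> j" "l \<le> k" | "j \<le> i" "k \<le> l" | "j \<le> i" "l \<le> k" by linarith
  then show ?thesis
  proof cases
    case 1 then show ?thesis using sorted assms by blast
  next
    case 2 then show ?thesis using sorted[of i j l k] assms c by metis
  next
    case 3 then show ?thesis using sorted[of j i k l] assms c by metis
  next
    case 4 then show ?thesis using sorted[of j i l k] assms c by metis
  qed
qed

lemma power_sum_unique:
  fixes a d e :: int
  assumes "1 + (-9::real) powi e = (-9) powi a + (-9) powi d"
  shows "a = 0 \<or> d = 0"
proof -
  define N where "N = nat (\<bar>a\<bar> + \<bar>d\<bar> + \<bar>e\<bar>)"
  have shift: "(-9::real) ^ N * (-9) powi x = (-9) ^ nat (x + int N)" if "x \<in> {0, a, d, e}" for x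
  proof -
    have "0 \<le> x + int N" using that by (auto simp: N_def)
    then have "(-9::real) ^ nat (x + int N) = (-9) powi (x + int N)" by (simp add: power_int_def)
    also have "\<dots> = (-9) powi x * (-9) powi int N" by (intro power_int_add) simp
    finally show ?thesis by simp
  qed
  have "(-9::real) ^ N * (-9) powi 0 + (-9) ^ N * (-9) powi e = (-9) ^ N * (-9) powi a + (-9) ^ N * (-9) powi d"
    using arg_cong[OF assms, of "\<lambda>z. (-9) ^ N * z"] by (simp add: distrib_left)
  then have "(-9::real) ^ nat (0 + int N) + (-9) ^ nat (e + int N) = (-9) ^ nat (a + int N) + (-9) ^ nat (d + int N)"
    by (simp only: shift insertI1 insertI2)
  then have "real_of_int ((-9) ^ nat (0 + int N) + (-9) ^ nat (e + int N)) = real_of_int ((-9) ^ nat (a + int N) + (-9) ^ nat (d + int N))"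
    by simp
  then have "(-9::int) ^ nat (0 + int N) + (-9) ^ nat (e + int N) = (-9) ^ nat (a + int N) + (-9) ^ nat (d + int N)"
    by (simp only: of_int_eq_iff)
  from power_sum_unique_nat[OF this] have "nat (0 + int N) = nat (a + int N) \<or> nat (0 + int N) = nat (d + int N)" by blast
  moreover have "0 \<le> a + int N" "0 \<le> d + int N" by (auto simp: N_def)
  ultimately show ?thesis by (auto simp: nat_eq_iff)
qed

definition exponent_sum :: "'s word \<Rightarrow> int" where
  "exponent_sum w = (\<Sum>l\<leftarrow>w. if snd l then 1 else - 1)"

lemma exponent_sum_simps [simp]:
  "exponent_sum [] = 0" "exponent_sum (l # w) = (if snd l then 1 else - 1) + exponent_sum w"
  "exponent_sum (u @ v) = exponent_sum u + exponent_sum v"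
  by (simp_all add: exponent_sum_def)

lemma exponent_sum_inv [simp]: "exponent_sum (inv_word w) = - exponent_sum w"
  by (induction w) (auto simp: inv_word_def)

context coxeter
begin

lemma cyclic_trivial: assumes s: "s \<in> S" and x: "x \<in> words {s}" and 0: "exponent_sum x = 0" shows "peq x []"
proof -
  define pw where "pw k = replicate (nat \<bar>k\<bar>) (s, 0 < k)" for k :: int
  have pwS: "pw k \<in> words S" for k using s by (auto simp: pw_def words_def)
  have step: "peq ((s, b) # pw k) (pw ((if b then 1 else - 1) + k))" for b k
  proof (cases "k = 0 \<or> b = (0 < k)")
    case True
    then have "(s, b) # pw k = pw ((if b then 1 else - 1) + k)"
    proof -
      have 1: "nat \<bar>(if b then 1 else - 1) + k\<bar> = Suc (nat \<bar>k\<bar>)" using True by (auto split: if_splits)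
      have 2: "(0 < (if b then 1 else - 1) + k) = b" using True by (auto split: if_splits)
      have 3: "replicate (nat \<bar>k\<bar>) (s, 0 < k) = replicate (nat \<bar>k\<bar>) (s, b)" using True by auto
      show ?thesis unfolding pw_def 1 2 3 by simp
    qed
    then show ?thesis using peq_refl pwS by metis
  next
    case False
    let ?k = "(if b then 1 else - 1) + k"
    have 1: "nat \<bar>k\<bar> = Suc (nat \<bar>?k\<bar>)" using False by (auto split: if_splits)
    have 2: "(0 < k) = (\<not> b)" using False by auto
    have 3: "replicate (nat \<bar>?k\<bar>) (s, \<not> b) = pw ?k"
    proof (cases "?k = 0")
      case True then show ?thesis by (simp add: pw_def)
    next
      case nz: False
      then have "(0 < ?k) = (\<not> b)" using False by (auto split: if_splits)
      then show ?thesis by (simp add: pw_def)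
    qed
    have "(s, b) # pw k = [(s, b), (s, \<not> b)] @ pw ?k" unfolding pw_def[of k] 1 2 using 3 by simp
    moreover have "peq ([(s, b), (s, \<not> b)] @ pw ?k) ([] @ pw ?k)"
      using pres_eq.cancel[OF s] pwS by (rule peq_left)
    ultimately show ?thesis by simp
  qed
  have "peq x (pw (exponent_sum x))"
    using x
  proof (induction x)
    case Nil then show ?case using pwS by (simp add: pw_def peq_refl)
  next
    case (Cons l x)
    then obtain b where l: "l = (s, b)" by (cases l) auto
    have "peq ([(s, b)] @ x) ([(s, b)] @ pw (exponent_sum x))" using Cons s by (intro peq_right) auto
    then show ?case using pres_eq.trans[OF _ step[of b "exponent_sum x"]] l by simp
  qed
  then show ?thesis using 0 by (simp add: pw_def)
qed

definition hecke_inv where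
  "hecke_inv s v = (if s \<in> S then v(s := v s - form S m 3 s v / 9) else v)"

primrec hecke_act :: "'s word \<Rightarrow> ('s \<Rightarrow> real) \<Rightarrow> 's \<Rightarrow> real" where
  "hecke_act [] v = v"
| "hecke_act (l # w) v = hecke_act w ((if snd l then hecke S m 3 (fst l) else hecke_inv (fst l)) v)"

lemma hecke_act_append: "hecke_act (u @ w) v = hecke_act w (hecke_act u v)"
  by (induction u arbitrary: v) auto

lemma form_hecke_inv: assumes "s \<in> S" shows "form S m 3 s (hecke_inv s v) = - form S m 3 s v / 9"
proof -
  define \<phi> where "\<phi> = form S m 3 s v"
  have "form S m 3 s (hecke_inv s v) = (\<Sum>u\<in>S. coef m 3 s u * (v(s := v s - \<phi> / 9)) u)"
    using assms unfolding \<phi>_def by (simp add: hecke_inv_def form_def)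
  also have "\<dots> = (\<Sum>u\<in>S. coef m 3 s u * v u + (if u = s then - coef m 3 s s * \<phi> / 9 else 0))"
    by (intro sum.cong) (auto simp: algebra_simps)
  also have "\<dots> = \<phi> - 10 * \<phi> / 9"
  proof -
    have "coef m 3 s s = 10" by (simp add: coef_def)
    then show ?thesis using finite_S assms by (simp add: sum.distrib \<phi>_def form_def[of S m 3 s v])
  qed
  finally show ?thesis by (simp add: \<phi>_def)
qed

lemma hecke_inverse: "hecke_inv s (hecke S m 3 s v) = v" "hecke S m 3 s (hecke_inv s v) = v"
proof -
  show "hecke_inv s (hecke S m 3 s v) = v"
  proof (cases "s \<in> S")
    case True
    have "form S m 3 s (hecke S m 3 s v) = - 9 * form S m 3 s v"
      using hecke_hecke[OF finite_S True, where m = m and p = 3 and v = v] by simp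
    then show ?thesis using True by (auto simp: hecke_inv_def hecke_def)
  qed (simp add: hecke_inv_def hecke_def)
  show "hecke S m 3 s (hecke_inv s v) = v"
  proof (cases "s \<in> S")
    case True
    then show ?thesis using form_hecke_inv[OF True, of v] by (auto simp: hecke_inv_def hecke_def)
  qed (simp add: hecke_inv_def hecke_def)
qed

lemma hecke_act_alternating: "hecke_act (alternating_word n s t) v = braid_word n (hecke S m 3 s) (hecke S m 3 t) v"
  by (induction n arbitrary: s t v) auto

lemma hecke_act_peq: "peq u v \<Longrightarrow> hecke_act u x = hecke_act v x"
proof (induction arbitrary: x rule: pres_eq.induct)
  case (cancel s b) then show ?case by (cases b) (simp_all add: hecke_inverse)
next
  case (relator u v)
  then obtain n s t where h: "u = alternating_word n s t" "v = alternating_word n t s" "s \<in> S" "t \<in> S" "s \<noteq> t" "m s t = enat n"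
    unfolding artin_relations_def by blast
  have "braid_word n (hecke S m 3 s) (hecke S m 3 t) x = braid_word n (hecke S m 3 t) (hecke S m 3 s) x"
    by (rule hecke_braid[OF finite_S h(3-5) m_sym[OF h(3,4)] h(6) m_ge_2[OF h(3-6)]]) simp
  then show ?case using h by (simp add: hecke_act_alternating)
next
  case (trans u v w) then show ?case by simp
qed (simp_all add: hecke_act_append)

text \<open>
  On its plane a power of a generator acts triangularly, with eigenvalue \<open>(-9)\<^sup>k\<close>
  where \<open>k\<close> is the exponent sum; it fixes the line of the vector with coordinates
  \<open>\<kappa>\<close> and 1.
\<close>

lemma hecke_act_power:
  assumes st: "s \<in> S" "t \<in> S" "s \<noteq> t" and x: "x \<in> words {s}"
  defines "\<kappa> \<equiv> 6 * bond m s t / 10"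
  shows "hecke_act x (plane (\<lambda>_. 0) s t a b) =
    plane (\<lambda>_. 0) s t ((-9) powi exponent_sum x * a + (1 - (-9) powi exponent_sum x) * \<kappa> * b) b"
  using x
proof (induction x arbitrary: a)
  case Nil then show ?case by simp
next
  case (Cons l x)
  obtain e where l: "l = (s, e)" using Cons.prems by (cases l) auto
  have f: "form S m 3 r (\<lambda>_. 0) = 0" for r by (simp add: form_def)
  define a' where "a' = (if e then - 9 * a + 10 * \<kappa> * b else - a / 9 + 10 / 9 * \<kappa> * b)"
  have 1: "(if e then hecke S m 3 s else hecke_inv s) (plane (\<lambda>_. 0) s t a b) = plane (\<lambda>_. 0) s t a' b"
  proof (cases e)
    case True
    then show ?thesis using hecke_plane[OF finite_S st f, where x = a and y = b] by (simp add: a'_def \<kappa>_def algebra_simps)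
  next
    case False
    have "form S m 3 s (plane (\<lambda>_. 0) s t a b) = 10 * a - 6 * bond m s t * b"
      using form_plane[OF finite_S st, where r = s and v = "\<lambda>_. 0" and x = a and y = b and m = m and p = 3] f st(3) by (simp add: coef_def)
    then show ?thesis using False st by (auto simp: hecke_inv_def plane_def a'_def \<kappa>_def field_simps)
  qed
  have 2: "hecke_act x (plane (\<lambda>_. 0) s t a' b) =
      plane (\<lambda>_. 0) s t ((-9) powi exponent_sum x * a' + (1 - (-9) powi exponent_sum x) * \<kappa> * b) b"
    using Cons by auto
  have 3: "(-9) powi exponent_sum x * a' + (1 - (-9) powi exponent_sum x) * \<kappa> * b =
      (-9) powi exponent_sum (l # x) * a + (1 - (-9) powi exponent_sum (l # x)) * \<kappa> * b"
  proof (cases e)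
    case True
    have "(-9::real) powi (1 + exponent_sum x) = - 9 * (-9) powi exponent_sum x" by (simp add: power_int_add)
    then show ?thesis using True l by (simp add: a'_def algebra_simps)
  next
    case False
    have "(-9::real) powi (- 1 + exponent_sum x) = - (1 / 9) * (-9) powi exponent_sum x"
      by (subst power_int_add) (simp_all add: power_int_minus)
    then show ?thesis using False l by (simp add: a'_def algebra_simps)
  qed
  have "hecke_act (l # x) (plane (\<lambda>_. 0) s t a b) = hecke_act x ((if e then hecke S m 3 s else hecke_inv s) (plane (\<lambda>_. 0) s t a b))"
    by (simp add: l)
  then show ?case by (simp only: 1 2 3)
qed

text \<open>
  A relation of the form \<open>s\<^sup>a t\<^sup>b s\<^sup>c t\<^sup>d = 1\<close> is trivial.
  Apply both sides of \<open>s\<^sup>a t\<^sup>b = t\<^sup>-\<^sup>d s\<^sup>-\<^sup>c\<close> to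
  the basis vector of \<open>t\<close> and compare the coordinates at \<open>s\<close>: after
  cancellation of \<open>\<kappa>\<close>, which is nonzero because \<open>s\<close> and
  \<open>t\<close> do not commute, two sums of two powers of \<open>-9\<close> are equal, which
  forces \<open>a = 0\<close> or \<open>d = 0\<close>.
\<close>

lemma dihedral_four_cycle:
  assumes st: "s \<in> S" "t \<in> S" "s \<noteq> t" and b: "bond m s t \<noteq> 0"
    and x: "x1 \<in> words {s}" "x2 \<in> words {t}" "x3 \<in> words {s}" "x4 \<in> words {t}"
    and rel: "peq (x1 @ x2) (inv_word x4 @ inv_word x3)"
  shows "exponent_sum x1 = 0 \<or> exponent_sum x4 = 0"
proof -
  define \<kappa> where "\<kappa> = 6 * bond m s t / 10"
  have bt: "bond m t s = bond m s t" using m_sym[OF st(1,2)] by (simp add: bond_def)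
  have sw: "plane (\<lambda>_. 0) s t a b = plane (\<lambda>_. 0) t s b a" for a b :: real using st(3) by (auto simp: plane_def)
  define Q where "Q w = (-9::real) powi exponent_sum w" for w :: "'s word"
  have s_act: "hecke_act x (plane (\<lambda>_. 0) s t a b) = plane (\<lambda>_. 0) s t (Q x * a + (1 - Q x) * \<kappa> * b) b" if "x \<in> words {s}" for x a b
    using hecke_act_power[OF st that] by (simp add: Q_def \<kappa>_def)
  have t_act: "hecke_act x (plane (\<lambda>_. 0) s t a b) = plane (\<lambda>_. 0) s t a (Q x * b + (1 - Q x) * \<kappa> * a)" if "x \<in> words {t}" for x a b
    using hecke_act_power[OF st(2,1) _ that, of b a] st(3) bt by (simp add: Q_def \<kappa>_def sw)
  let ?y3 = "inv_word x3" and ?y4 = "inv_word x4"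
  have y: "?y3 \<in> words {s}" "?y4 \<in> words {t}" using x by auto
  have "hecke_act (x1 @ x2) (plane (\<lambda>_. 0) s t 0 1) = plane (\<lambda>_. 0) s t (Q x1 * 0 + (1 - Q x1) * \<kappa> * 1)
      (Q x2 * 1 + (1 - Q x2) * \<kappa> * (Q x1 * 0 + (1 - Q x1) * \<kappa> * 1))"
    by (simp only: hecke_act_append s_act[OF x(1)] t_act[OF x(2)])
  then have l: "hecke_act (x1 @ x2) (plane (\<lambda>_. 0) s t 0 1) s = (1 - Q x1) * \<kappa>" by (simp add: plane_def)
  have "hecke_act (?y4 @ ?y3) (plane (\<lambda>_. 0) s t 0 1) =
      plane (\<lambda>_. 0) s t (Q ?y3 * 0 + (1 - Q ?y3) * \<kappa> * (Q ?y4 * 1 + (1 - Q ?y4) * \<kappa> * 0)) (Q ?y4 * 1 + (1 - Q ?y4) * \<kappa> * 0)"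
    by (simp only: hecke_act_append s_act[OF y(1)] t_act[OF y(2)])
  then have r: "hecke_act (?y4 @ ?y3) (plane (\<lambda>_. 0) s t 0 1) s = (1 - Q ?y3) * \<kappa> * Q ?y4" by (simp add: plane_def)
  have "(1 - Q x1) * \<kappa> = (1 - Q ?y3) * \<kappa> * Q ?y4"
    using hecke_act_peq[OF rel, of "plane (\<lambda>_. 0) s t 0 1"] unfolding l[symmetric] r[symmetric] by (rule arg_cong)
  moreover have "\<kappa> \<noteq> 0" using b by (simp add: \<kappa>_def)
  ultimately have "1 - Q x1 = (1 - Q ?y3) * Q ?y4" by (simp add: mult.commute mult.left_commute)
  then have "1 + Q ?y3 * Q ?y4 = Q x1 + Q ?y4" by (simp add: algebra_simps)
  moreover have "Q ?y3 * Q ?y4 = (-9) powi (exponent_sum ?y3 + exponent_sum ?y4)"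
    unfolding Q_def by (rule power_int_add[symmetric]) simp
  ultimately have "exponent_sum x1 = 0 \<or> exponent_sum ?y4 = 0" unfolding Q_def by (intro power_sum_unique) simp
  then show ?thesis by simp
qed

text \<open>
  The complex is a bipartite graph, so only cycles of length four matter. The chambers along such a
  cycle differ by powers of \<open>s\<close> and \<open>t\<close> in turn, which multiply to the
  identity; if one of these powers is trivial, two opposite vertices of the cycle coincide.
\<close>

lemma coset_complex_two:
  assumes st: "s \<in> S" "t \<in> S" "s \<noteq> t" and b: "bond m s t \<noteq> 0" and w: "w \<in> words S"
  shows "six_large (coset_complex w {s, t})"
proof -
  let ?X = "coset_complex w {s, t}"
  have U: "{s, t} \<subseteq> S" using st by simp
  have US: "h \<in> words S" if "h \<in> words {s, t}" for h using words_mono[OF U that] .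
  define is_s where "is_s x = (\<exists>h\<in>words {s, t}. x = vtx (w @ h) s)" for x
  have is_s_iff: "is_s (vtx (w @ h) r) \<longleftrightarrow> r = s" if "h \<in> words {s, t}" "r \<in> {s, t}" for h r
  proof
    assume "is_s (vtx (w @ h) r)"
    then obtain h' where h': "h' \<in> words {s, t}" "vtx (w @ h) r = vtx (w @ h') s" unfolding is_s_def by blast
    show "r = s" by (rule vtx_type[OF _ _ _ _ h'(2)]) (use that h'(1) w US st in auto)
  qed (use that in \<open>auto simp: is_s_def\<close>)
  have alternate: "is_s x \<noteq> is_s y" if e: "edge ?X x y" for x y
  proof -
    obtain h a c where "h \<in> words {s, t}" "a \<in> {s, t}" "c \<in> {s, t}" "a \<noteq> c" "x = vtx (w @ h) a" "y = vtx (w @ h) c"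
      using e by (rule coset_complex_edge[OF U w])
    then show ?thesis using is_s_iff by auto
  qed
  have chamber: "\<exists>h\<in>words {s, t}. x = vtx (w @ h) s \<and> y = vtx (w @ h) t" if e: "edge ?X x y" "is_s x" for x y
  proof -
    obtain h a c where "h \<in> words {s, t}" "a \<in> {s, t}" "c \<in> {s, t}" "a \<noteq> c" "x = vtx (w @ h) a" "y = vtx (w @ h) c"
      using e(1) by (rule coset_complex_edge[OF U w])
    moreover from this have "a = s" using is_s_iff e(2) by blast
    ultimately show ?thesis by auto
  qed
  have sym: "edge ?X x y \<Longrightarrow> edge ?X y x" for x y by (auto simp: edge_def insert_commute)
  \<comment> \<open>Two chambers that share the vertex of type \<open>r\<close> differ by a power of
    the other generator \<open>q\<close>.\<close>
  have cyc: "\<exists>x\<in>words {q}. peq (w @ h') ((w @ h) @ x) \<and> peq h' (h @ x) \<and> x \<in> words S"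
    if h: "h \<in> words {s, t}" "h' \<in> words {s, t}" "vtx (w @ h) r = vtx (w @ h') r" "{s, t} = {r, q}" "r \<noteq> q" for h h' r q
  proof -
    have wh: "w @ h \<in> words S" "w @ h' \<in> words S" using h w US by auto
    obtain u where u: "u \<in> words (S - {r})" "peq (w @ h') ((w @ h) @ u)" using vtx_eq_iff[OF wh, of r] h(3) by blast
    have uS: "u \<in> words S" using u(1) words_mono[of "S - {r}" S] by blast
    have "peq (w @ h') (w @ (h @ u))" using u(2) by simp
    then have p: "peq h' (h @ u)" using peq_cancel[OF w] US h uS by simp
    then have "peq (h @ u) h'" by (rule pres_eq.sym)
    then have "peq u (inv_word h @ h')" using peq_move[of h u h'] US h uS by blast
    then obtain x where x: "x \<in> words ({s, t} \<inter> (S - {r}))" "peq (inv_word h @ h') x"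
      using parabolic_intersection[OF U, of "S - {r}" u "inv_word h @ h'"] u(1) h by auto
    have xq: "x \<in> words {q}" using x(1) by (rule words_mono[rotated]) (use h in auto)
    have xS: "x \<in> words S" using peq_words x(2) by blast
    have "peq (h @ inv_word h @ h') (h @ x)" using x(2) US h by (intro peq_right) auto
    moreover have "peq ((h @ inv_word h) @ h') ([] @ h')" using US h by (intro peq_left peq_inv_right) auto
    ultimately have "peq h' (h @ x)" using pres_eq.trans[OF pres_eq.sym] by fastforce
    moreover from this have "peq (w @ h') (w @ (h @ x))" using w by (rule peq_right)
    ultimately show ?thesis using xq xS by auto
  qed
  have no4: False if e: "edge ?X a b" "edge ?X b c" "edge ?X c d" "edge ?X d a" "a \<noteq> c" "b \<noteq> d" and ta: "is_s a" for a b c d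
  proof -
    have "is_s c" using alternate[OF e(1)] alternate[OF e(2)] ta by blast
    obtain h1 h2 h3 h4 where h: "h1 \<in> words {s, t}" "a = vtx (w @ h1) s" "b = vtx (w @ h1) t"
      "h2 \<in> words {s, t}" "c = vtx (w @ h2) s" "b = vtx (w @ h2) t"
      "h3 \<in> words {s, t}" "c = vtx (w @ h3) s" "d = vtx (w @ h3) t"
      "h4 \<in> words {s, t}" "a = vtx (w @ h4) s" "d = vtx (w @ h4) t"
      using chamber[OF e(1) ta] chamber[OF sym[OF e(2)] \<open>is_s c\<close>] chamber[OF e(3) \<open>is_s c\<close>] chamber[OF sym[OF e(4)] ta] by blast
    obtain x1 where x1: "x1 \<in> words {s}" "peq (w @ h2) ((w @ h1) @ x1)" "peq h2 (h1 @ x1)" "x1 \<in> words S"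
      using cyc[OF h(1,4), of t s] h st by auto
    obtain x2 where x2: "x2 \<in> words {t}" "peq h3 (h2 @ x2)" "x2 \<in> words S" using cyc[OF h(4,7), of s t] h st by auto
    obtain x3 where x3: "x3 \<in> words {s}" "peq h4 (h3 @ x3)" "x3 \<in> words S" using cyc[OF h(7,10), of t s] h st by auto
    obtain x4 where x4: "x4 \<in> words {t}" "peq (w @ h1) ((w @ h4) @ x4)" "peq h1 (h4 @ x4)" "x4 \<in> words S"
      using cyc[OF h(10,1), of s t] h st by auto
    have hS: "h1 \<in> words S" "h2 \<in> words S" "h3 \<in> words S" "h4 \<in> words S" using h US by auto
    have "peq h3 (h1 @ (x1 @ x2))"
      using pres_eq.trans[OF x2(2) peq_left[OF x1(3) x2(3)]] by simp
    moreover have "peq h3 (h1 @ (inv_word x4 @ inv_word x3))"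
    proof -
      have 3: "peq (h4 @ inv_word x3) h3"
      proof -
        have "peq (h4 @ inv_word x3) ((h3 @ x3) @ inv_word x3)" using x3 by (intro peq_left) auto
        moreover have "peq (h3 @ (x3 @ inv_word x3)) (h3 @ [])" using x3 hS by (intro peq_right peq_inv_right) auto
        ultimately show ?thesis using pres_eq.trans by fastforce
      qed
      have 4: "peq (h1 @ inv_word x4) h4"
      proof -
        have "peq (h1 @ inv_word x4) ((h4 @ x4) @ inv_word x4)" using x4 by (intro peq_left) auto
        moreover have "peq (h4 @ (x4 @ inv_word x4)) (h4 @ [])" using x4 hS by (intro peq_right peq_inv_right) auto
        ultimately show ?thesis using pres_eq.trans by fastforce
      qed
      have "peq ((h1 @ inv_word x4) @ inv_word x3) (h4 @ inv_word x3)" using 4 x3 by (intro peq_left) auto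
      then show ?thesis using 3 pres_eq.trans pres_eq.sym by (metis append_assoc)
    qed
    ultimately have "peq (h1 @ (x1 @ x2)) (h1 @ (inv_word x4 @ inv_word x3))" using pres_eq.trans pres_eq.sym by metis
    then have "peq (x1 @ x2) (inv_word x4 @ inv_word x3)" using peq_cancel[OF hS(1)] x1 x2 x3 x4 by simp
    then have "exponent_sum x1 = 0 \<or> exponent_sum x4 = 0" by (rule dihedral_four_cycle[OF st b x1(1) x2(1) x3(1) x4(1)])
    then show False
    proof
      assume "exponent_sum x1 = 0"
      then have "peq x1 []" using cyclic_trivial[OF st(1) x1(1)] by blast
      then have "peq ((w @ h1) @ x1) ((w @ h1) @ [])" using w hS by (intro peq_right) auto
      then have "peq (w @ h2) (w @ h1)" using pres_eq.trans[OF x1(2)] by simp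
      then show False using vtx_cong e(5) h by metis
    next
      assume "exponent_sum x4 = 0"
      then have "peq x4 []" using cyclic_trivial[OF st(2) x4(1)] by blast
      then have "peq ((w @ h4) @ x4) ((w @ h4) @ [])" using w hS by (intro peq_right) auto
      then have "peq (w @ h1) (w @ h4)" using pres_eq.trans[OF x4(2)] by simp
      then show False using vtx_cong e(6) h by metis
    qed
  qed
  show ?thesis unfolding six_large_def
  proof (intro conjI allI impI)
    fix a b c assume "edge ?X a b \<and> edge ?X b c \<and> edge ?X c a"
    then show "{a, b, c} \<in> ?X" using alternate by metis
  next
    fix a b c d assume h: "edge ?X a b \<and> edge ?X b c \<and> edge ?X c d \<and> edge ?X d a \<and> a \<noteq> c \<and> b \<noteq> d"
    show "edge ?X a c \<or> edge ?X b d"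
    proof (cases "is_s a")
      case True
      then show ?thesis using no4[of a b c d] h by blast
    next
      case False
      then have "is_s b" using alternate[of a b] h by blast
      then show ?thesis using no4[of b c d a] h by blast
    qed
  next
    fix a b c d e
    assume "edge ?X a b \<and> edge ?X b c \<and> edge ?X c d \<and> edge ?X d e \<and> edge ?X e a \<and> distinct [a, b, c, d, e]"
    then show "edge ?X a c \<or> edge ?X b d \<or> edge ?X c e \<or> edge ?X d a \<or> edge ?X e b" using alternate by metis
  qed
qed

end

section \<open>Systolicity of the Artin complex\<close>

context coxeter
begin

lemma bond_nonzero: assumes "large_type S m" "s \<in> S" "t \<in> S" "s \<noteq> t" shows "bond m s t \<noteq> 0"
proof (cases "m s t")
  case (enat n)
  have "3 \<le> n" using assms enat unfolding large_type_def by (metis enat_ord_simps(1) numeral_eq_enat)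
  then have "0 < cos (pi / n)" by (intro cos_gt_zero) (auto simp: field_simps)
  then show ?thesis using enat by (simp add: bond_def)
qed (simp add: bond_def)

text \<open>
  Induction on the number of types: links of vertices are coset complexes with fewer types, and from
  three types on the complex is simply connected.
\<close>

lemma six_large_coset_complex:
  assumes L: "large_type S m" and "U \<subseteq> S" "w \<in> words S"
  shows "six_large (coset_complex w U)"
  using assms(2,3)
proof (induction "card U" arbitrary: U w rule: less_induct)
  case less
  have fin: "finite U" using less.prems(1) finite_S by (rule finite_subset)
  consider "card U \<le> 1" | "card U = 2" | "3 \<le> card U" by linarith
  then show ?case
  proof cases
    case 1
    have "\<not> edge (coset_complex w U) x y" for x y
    proof
      assume "edge (coset_complex w U) x y"
      then obtain h s t where "s \<in> U" "t \<in> U" "s \<noteq> t" by (rule coset_complex_edge[OF less.prems])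
      then show False using 1 fin by (metis card_le_Suc0_iff_eq One_nat_def)
    qed
    then show ?thesis unfolding six_large_def by blast
  next
    case 2
    then obtain s t where st: "U = {s, t}" "s \<noteq> t" by (auto simp: card_2_iff)
    show ?thesis unfolding st(1)
      by (rule coset_complex_two[OF _ _ st(2) bond_nonzero[OF L _ _ st(2)] less.prems(2)]) (use st less.prems in auto)
  next
    case 3
    show ?thesis
    proof (rule six_large_local_to_global[OF abstract_coset_complex[OF less.prems(1)]
          edge_simply_connected_coset_complex[OF less.prems(2,1) 3]])
      fix v assume v: "{v} \<in> coset_complex w U"
      obtain g F where g: "g \<in> words S" "F \<subseteq> U" "F \<noteq> {}"
        "link (coset_complex w U) {v} = coset_complex g (U - F)"
        by (rule coset_complex_simplex_link[OF less.prems v]) blast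
      have "card (U - F) < card U" by (rule psubset_card_mono[OF fin]) (use g in auto)
      then show "six_large (link (coset_complex w U) {v})"
        unfolding g(4) by (rule less.hyps) (use g less.prems in auto)
    qed
  qed
qed

end

theorem theoremB:
  fixes S :: "'s set" and m :: "'s \<Rightarrow> 's \<Rightarrow> enat"
  assumes "finite S"
    and "card S \<ge> 3"
    and "coxeter_matrix S m"
    and "large_type S m"
  shows "systolic (artin_complex S m)"
proof -
  interpret coxeter S m using assms by unfold_locales
  let ?X = "coset_complex [] S"
  have abs: "abstract_complex ?X" by (rule abstract_coset_complex) simp
  have "edge_simply_connected ?X" by (rule edge_simply_connected_coset_complex) (use assms in auto)
  then have sc: "simply_connected_space (realization ?X)" by (rule simply_connected_realization[OF abs])
  then have conn: "connected_space (realization ?X)"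
    unfolding simply_connected_space_def by (blast intro: path_connected_imp_connected_space)
  have "enat 6 \<le> systole (link ?X \<sigma>)" if \<sigma>: "\<sigma> \<in> ?X" for \<sigma>
  proof -
    obtain g F where g: "g \<in> words S" "link ?X \<sigma> = coset_complex g (S - F)"
      by (rule coset_complex_simplex_link[OF subset_refl words_simps(1) \<sigma>]) blast
    show ?thesis unfolding g(2)
      by (intro systole_if_six_large abstract_coset_complex six_large_coset_complex assms(4) g(1)) auto
  qed
  then show ?thesis
    unfolding systolic_def k_systolic_def locally_large_def artin_complex_eq using sc conn by blast
qed

end
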